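(* Let $\{\Phi_t\}_{t\ge0}$ be a continuous semigroup of analytic functions in $\mathcal{G}_\infty$, write $\Phi_t(s)=s+\varphi_t(s)$, and let $T_t=C_{\Phi_t}$, i.e. $T_tf=f\circ\Phi_t$, for $t\ge0$. Then the following statements are equivalent: (a) The semigroup $\{T_t\}$ is strongly continuous in $\mathcal{A}(\mathbb{C}_+)$ (in particular, each $T_t$ is a bounded operator from $\mathcal{A}(\mathbb{C}_+)$ into itself). (b) $\Phi_t\in\mathcal{G}_{\mathcal{A}}$ for all $t>0$. (c) $\varphi_t\in\mathcal{A}(\mathbb{C}_+)$ for all $t>0$.
   Context: $\mathbb{N}=\{1,2,\dots\}$. For $\theta\in\mathbb{R}$, $\mathbb{C}_\theta=\{s\in\mathbb{C}:\mathrm{Re}(s)>\theta\}$ and $\mathbb{C}_+=\mathbb{C}_0$. $\mathcal{D}$ is the set of Dirichlet series $\sum_{n\ge1}a_nn^{-s}$ that converge in some half-plane $\mathbb{C}_\theta$; an analytic function on $\mathbb{C}_+$ is said to be in $\mathcal{D}$ if it coincides with such a series on some half-plane. $\mathcal{A}(\mathbb{C}_+)$ is the set of Dirichlet series convergent in $\mathbb{C}_+$ whose sum is a uniformly continuous function on $\mathbb{C}_+$; it is a Banach algebra with the norm $\|f\|_\infty=\sup_{s\in\mathbb{C}_+}|f(s)|$. An analytic $\Phi:\mathbb{C}_+\to\mathbb{C}_+$ is in $\mathcal{G}_\infty$ if there are $c_\Phi\in\mathbb{N}\cup\{0\}$ and $\varphi\in\mathcal{D}$ with $\Phi(s)=c_\Phi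 s+\varphi(s)$. It is in $\mathcal{G}_{\mathcal{A}}$ if $\Phi\in\mathcal{G}_\infty$ and, for every $M>0$, $\Phi$ is uniformly continuous on $A_M=\{s\in\mathbb{C}_+:0<\mathrm{Re}(\Phi(s))<M\}$. A semigroup of analytic functions is a family $\{\Phi_t\}_{t\ge0}$ of analytic maps $\Phi_t:\mathbb{C}_+\to\mathbb{C}_+$ with $\Phi_0(s)=s$ and $\Phi_t\circ\Phi_u=\Phi_{t+u}$ for all $t,u\ge0$; it is continuous if $\Phi_t\to\Phi_0$ uniformly on compact subsets of $\mathbb{C}_+$ as $t\to0^+$. It is a semigroup in a class if every $\Phi_t$ is in that class. It is known that every continuous semigroup in $\mathcal{G}_\infty$ satisfies $c_{\Phi_t}=1$ for all $t$, so $\Phi_t(s)=s+\varphi_t(s)$ with $\varphi_t\in\mathcal{D}$. A family $\{T_t\}_{t\ge0}$ of bounded operators on a Banach space $X$ with $T_0=\mathrm{Id}$ and $T_tT_u=T_{t+u}$ is strongly continuous if $\lim_{t\to0^+}T_tf=f$ in $X$ for all $f\in X$. *)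

theory Defs
  imports "HOL-Complex_Analysis.Complex_Analysis"
begin

text \<open>
  Functions on the right half-plane are represented by total functions of type
  \<^typ>\<open>complex \<Rightarrow> complex\<close>; only their values on \<open>half_plane 0\<close> matter, and two of them are
  identified when they agree there.
\<close>

definition half_plane :: "real \<Rightarrow> complex set" where
  "half_plane \<theta> = {s. Re s > \<theta>}"

abbreviation right_half_plane :: "complex set" ("\<complex>\<^sub>+") where
  "\<complex>\<^sub>+ \<equiv> half_plane 0"

text \<open>
  The series \<open>a 1 * 1 powr -s + a 2 * 2 powr -s + \<dots>\<close> converges to \<open>f s\<close> at every point of \<open>S\<close>
  (convergence of partial sums, not necessarily absolute). The value \<open>a 0\<close> is not used.
\<close>

definition dirichlet_sums_on :: "(nat \<Rightarrow> complex) \<Rightarrow> (complex \<Rightarrow> complex) \<Rightarrow> complex set \<Rightarrow> bool" where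
  "dirichlet_sums_on a f S \<longleftrightarrow>
     (\<forall>s\<in>S. (\<lambda>n. a (Suc n) * of_nat (Suc n) powr (- s)) sums f s)"

text \<open>
  Membership in \<open>\<D>\<close> of an analytic function on the right half-plane. Since \<open>f\<close> is only given there,
  the half-plane of coincidence is taken inside it; this is no restriction.
\<close>

definition in_D :: "(complex \<Rightarrow> complex) \<Rightarrow> bool" where
  "in_D f \<longleftrightarrow> f holomorphic_on \<complex>\<^sub>+ \<and>
     (\<exists>a. \<exists>\<theta>\<ge>0. dirichlet_sums_on a f (half_plane \<theta>))"

definition in_A :: "(complex \<Rightarrow> complex) \<Rightarrow> bool" where
  "in_A f \<longleftrightarrow> (\<exists>a. dirichlet_sums_on a f \<complex>\<^sub>+) \<and> uniformly_continuous_on \<complex>\<^sub>+ f"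

text \<open>
  The norm of \<open>\<A>\<close>. The supremum is a genuine one on \<open>\<A>\<close>: a Dirichlet series
  is bounded on a half-plane on which it converges absolutely, and uniform continuity bounds it on
  the remaining strip of finite width.
\<close>

definition supnorm :: "(complex \<Rightarrow> complex) \<Rightarrow> real" where
  "supnorm f = (SUP s\<in>\<complex>\<^sub>+. norm (f s))"

definition self_map :: "(complex \<Rightarrow> complex) \<Rightarrow> bool" where
  "self_map \<Phi> \<longleftrightarrow> \<Phi> holomorphic_on \<complex>\<^sub>+ \<and> \<Phi> ` \<complex>\<^sub>+ \<subseteq> \<complex>\<^sub>+"

definition G_infinity :: "(complex \<Rightarrow> complex) \<Rightarrow> bool" where
  "G_infinity \<Phi> \<longleftrightarrow> self_map \<Phi> \<and>
     (\<exists>c::nat. \<exists>\<phi>. in_D \<phi> \<and> (\<forall>s\<in>\<complex>\<^sub>+. \<Phi> s = of_nat c * s + \<phi> s))"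

definition G_A :: "(complex \<Rightarrow> complex) \<Rightarrow> bool" where
  "G_A \<Phi> \<longleftrightarrow> G_infinity \<Phi> \<and>
     (\<forall>M>0. uniformly_continuous_on {s\<in>\<complex>\<^sub>+. 0 < Re (\<Phi> s) \<and> Re (\<Phi> s) < M} \<Phi>)"

definition analytic_semigroup :: "(real \<Rightarrow> complex \<Rightarrow> complex) \<Rightarrow> bool" where
  "analytic_semigroup \<Phi> \<longleftrightarrow>
     (\<forall>t\<ge>0. self_map (\<Phi> t)) \<and>
     (\<forall>s\<in>\<complex>\<^sub>+. \<Phi> 0 s = s) \<and>
     (\<forall>t\<ge>0. \<forall>u\<ge>0. \<forall>s\<in>\<complex>\<^sub>+. \<Phi> t (\<Phi> u s) = \<Phi> (t + u) s)"

definition continuous_semigroup :: "(real \<Rightarrow> complex \<Rightarrow> complex) \<Rightarrow> bool" where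
  "continuous_semigroup \<Phi> \<longleftrightarrow> analytic_semigroup \<Phi> \<and>
     (\<forall>K. compact K \<and> K \<subseteq> \<complex>\<^sub>+ \<longrightarrow> uniform_limit K \<Phi> (\<Phi> 0) (at_right 0))"

definition composition_operator ::
    "(complex \<Rightarrow> complex) \<Rightarrow> (complex \<Rightarrow> complex) \<Rightarrow> (complex \<Rightarrow> complex)" where
  "composition_operator \<Phi> f = f \<circ> \<Phi>"

text \<open>
  Bounded linear operators of \<open>\<A>\<close> into itself. The second conjunct says that the operator is well
  defined on functions identified when they agree on the right half-plane.
\<close>

definition bounded_operator_A :: "((complex \<Rightarrow> complex) \<Rightarrow> (complex \<Rightarrow> complex)) \<Rightarrow> bool" where
  "bounded_operator_A T \<longleftrightarrow>
     (\<forall>f. in_A f \<longrightarrow> in_A (T f)) \<and>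
     (\<forall>f g. in_A f \<and> in_A g \<and> (\<forall>s\<in>\<complex>\<^sub>+. f s = g s) \<longrightarrow> (\<forall>s\<in>\<complex>\<^sub>+. T f s = T g s)) \<and>
     (\<forall>f g. in_A f \<and> in_A g \<longrightarrow> (\<forall>s\<in>\<complex>\<^sub>+. T (\<lambda>z. f z + g z) s = T f s + T g s)) \<and>
     (\<forall>c f. in_A f \<longrightarrow> (\<forall>s\<in>\<complex>\<^sub>+. T (\<lambda>z. c * f z) s = c * T f s)) \<and>
     (\<exists>K. \<forall>f. in_A f \<longrightarrow> supnorm (T f) \<le> K * supnorm f)"

definition strongly_continuous_semigroup_A ::
    "(real \<Rightarrow> (complex \<Rightarrow> complex) \<Rightarrow> (complex \<Rightarrow> complex)) \<Rightarrow> bool" where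
  "strongly_continuous_semigroup_A T \<longleftrightarrow>
     (\<forall>t\<ge>0. bounded_operator_A (T t)) \<and>
     (\<forall>f. in_A f \<longrightarrow> (\<forall>s\<in>\<complex>\<^sub>+. T 0 f s = f s)) \<and>
     (\<forall>t\<ge>0. \<forall>u\<ge>0. \<forall>f. in_A f \<longrightarrow> (\<forall>s\<in>\<complex>\<^sub>+. T t (T u f) s = T (t + u) f s)) \<and>
     (\<forall>f. in_A f \<longrightarrow> ((\<lambda>t. supnorm (\<lambda>s. T t f s - f s)) \<longlongrightarrow> 0) (at_right 0))"

end

theory Submission
  imports Defs "HOL-Real_Asymp.Real_Asymp"
begin

text \<open>
  Statement (c) trivially implies (b), and (a) implies (b) by applying \<open>T t\<close> to \<open>2 powr - s\<close> and
  taking a logarithm. The other implications rest on the fact that \<open>\<phi> t\<close> tends to 0 uniformly on the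
  whole half-plane as \<open>t \<rightarrow> 0\<close>, for every continuous semigroup in the class \<open>\<G>\<^sub>\<infinity>\<close>. On \<open>Re s \<ge> \<epsilon>\<close> this
  follows from Harnack's inequality and the decay of Dirichlet series at \<open>+\<infinity>\<close>. To reach the boundary,
  consider the resolvent \<open>\<rho> = \<mu> \<integral> exp (- \<mu> u) \<phi> u du\<close>. If \<open>H\<close> is the generator of the semigroup, then
  \<open>H (1 + \<rho>') = \<mu> \<rho>\<close> and \<open>Re H \<ge> 0\<close>, hence \<open>Re (\<rho> cnj (1 + \<rho>')) \<ge> 0\<close>. This says that \<open>|\<rho>|\<close> decreases
  at most at unit speed along horizontal lines, so that \<open>\<rho>\<close> is small near the boundary because it is
  small on \<open>Re s = \<epsilon>\<close>; the bound for \<open>\<rho>\<close> is then transferred to \<open>\<phi> t\<close>.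

  In particular \<open>\<phi> t\<close> is bounded. Bohr's theorem makes the Dirichlet series of \<open>\<phi> t\<close> and of
  \<open>f \<circ> \<Phi> t\<close> converge on the whole half-plane, and the strip \<open>0 < Re s < 1\<close> is contained in one of the
  sets \<open>A\<^sub>M\<close>, which gives (c) from (b).
\<close>

section \<open>Holomorphic functions on the right half-plane\<close>

text \<open>The obstacle is the boundary: Harnack constants blow up as \<open>Re s\<close> tends to
  0, and a holomorphic function with nonnegative real part may be unbounded there. The inequality
  for \<rho> contains no such constant; it is \<open>H (1 + \<rho>') = \<mu> \<rho>\<close>
  multiplied by \<open>cnj (1 + \<rho>')\<close>. The way back to \<phi> is the resolvent identity:
  \<open>\<phi> t\<close> equals \<open>exp (\<mu> t) \<rho> - \<rho> \<circ> \<Phi> t\<close> up to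
  an error of at most \<open>exp (\<mu> t) - 1\<close> times the supremum of
  \<open>|\<phi> u s|\<close> over \<open>u \<le> t\<close>. For short times this factor is at most
  1/2 and the supremum can be absorbed. That \<open>\<Phi> t s - s\<close> is a Dirichlet series is
  derived as well. A linear coefficient 0 would make \<open>\<Phi> t\<close> itself a Dirichlet
  series, which is never injective, whereas the maps of a continuous semigroup are; a coefficient
  above 1 contradicts the bounded displacement far to the right.\<close>

lemma mem_half_plane [simp]: "s \<in> half_plane \<theta> \<longleftrightarrow> Re s > \<theta>"
  by (simp add: half_plane_def)

lemma half_plane_mono: "\<theta> \<le> \<theta>' \<Longrightarrow> half_plane \<theta>' \<subseteq> half_plane \<theta>"
  by (auto simp: half_plane_def)

lemma open_half_plane [simp]: "open (half_plane \<theta>)"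
  by (simp add: half_plane_def open_halfspace_Re_gt)

lemma convex_half_plane [simp]: "convex (half_plane \<theta>)"
  by (simp add: half_plane_def convex_halfspace_Re_gt)

text \<open>Numerator and denominator of the pseudohyperbolic distance
  \<open>|a - b| / |a + cnj b|\<close> of the right half-plane: the identity makes the quotient less
  than 1, and it supplies the factor \<open>(D - d) * (D + d)\<close> in Harnack's
  inequality.\<close>

lemma norm_add_cnj_square_diff:
  "(norm (a + cnj b))\<^sup>2 - (norm (a - b))\<^sup>2 = 4 * Re a * Re b"
  unfolding cmod_power2 by (simp add: power2_eq_square algebra_simps)

lemma norm_diff_less_add_cnj:
  assumes "Re a > 0" "Re b > 0"
  shows "norm (a - b) < norm (a + cnj b)"
proof (rule power_less_imp_less_base)
  show "(norm (a - b))\<^sup>2 < (norm (a + cnj b))\<^sup>2"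
    using norm_add_cnj_square_diff[of a b] assms by (smt (verit) mult_pos_pos)
qed auto

text \<open>Schwarz's lemma between two Cayley transforms: \<open>g\<close> maps the disc to the
  half-plane with \<open>g 0 = w\<close>, and the quotient in \<open>F\<close> sends
  \<open>f w\<close> to 0.\<close>

lemma Schwarz_Pick_half_plane:
  assumes hol: "f holomorphic_on \<complex>\<^sub>+" and im: "f ` \<complex>\<^sub>+ \<subseteq> \<complex>\<^sub>+"
    and z: "z \<in> \<complex>\<^sub>+" and w: "w \<in> \<complex>\<^sub>+"
  shows "norm (f z - f w) * norm (z + cnj w) \<le> norm (z - w) * norm (f z + cnj (f w))"
proof -
  define g where "g = (\<lambda>\<zeta>. (w + cnj w * \<zeta>) / (1 - \<zeta>))"
  define F where "F = (\<lambda>\<zeta>. (f (g \<zeta>) - f w) / (f (g \<zeta>) + cnj (f w)))"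
  have fpos: "Re (f u) > 0" if "Re u > 0" for u
    using im that image_subset_iff[of f "\<complex>\<^sub>+" "\<complex>\<^sub>+"] by auto
  have Refw: "Re (f w) > 0" using fpos w by simp
  have Reg: "Re (g \<zeta>) > 0" if "norm \<zeta> < 1" for \<zeta>
  proof -
    have ne: "1 - \<zeta> \<noteq> 0" using that by auto
    have "g \<zeta> = ((w + cnj w * \<zeta>) * cnj (1 - \<zeta>)) / of_real ((norm (1 - \<zeta>))\<^sup>2)"
      unfolding g_def by (subst complex_div_cnj) simp
    then have "Re (g \<zeta>) = Re ((w + cnj w * \<zeta>) * cnj (1 - \<zeta>)) / (norm (1 - \<zeta>))\<^sup>2"
      by (simp only: Re_divide_of_real)
    also have "Re ((w + cnj w * \<zeta>) * cnj (1 - \<zeta>)) = Re w * (1 - (norm \<zeta>)\<^sup>2)"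
      unfolding cmod_power2 by (simp add: power2_eq_square algebra_simps)
    finally have "Re (g \<zeta>) = Re w * (1 - (norm \<zeta>)\<^sup>2) / (norm (1 - \<zeta>))\<^sup>2" .
    moreover have "Re w * (1 - (norm \<zeta>)\<^sup>2) > 0" using w that by (simp add: power_less_one_iff abs_square_less_1)
    ultimately show ?thesis using ne by simp
  qed
  have den: "f u + cnj (f w) \<noteq> 0" if "Re u > 0" for u
  proof -
    have "Re (f u + cnj (f w)) > 0" using Refw fpos[OF that] by simp
    then show ?thesis by (metis less_irrefl zero_complex.sel(1))
  qed
  have holg: "g holomorphic_on ball 0 1"
    unfolding g_def by (intro holomorphic_intros) auto
  have holfg: "(\<lambda>\<zeta>. f (g \<zeta>)) holomorphic_on ball 0 1"
    by (rule holomorphic_on_compose_gen[OF holg hol, unfolded o_def]) (use Reg in auto)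
  have holF: "F holomorphic_on ball 0 1"
    unfolding F_def by (intro holomorphic_intros holfg) (use Reg den in auto)
  have F0: "F 0 = 0" by (simp add: F_def g_def)
  have F1: "norm (F \<zeta>) < 1" if "norm \<zeta> < 1" for \<zeta>
  proof -
    from norm_diff_less_add_cnj[OF fpos[OF Reg[OF that]] Refw] show ?thesis
      using den[OF Reg[OF that]] by (simp add: F_def norm_divide divide_simps)
  qed
  \<comment> \<open>The point of the disc with \<open>g \<zeta> = z\<close>.\<close>
  define \<zeta> where "\<zeta> = (z - w) / (z + cnj w)"
  have zw: "z + cnj w \<noteq> 0"
    using z w by (auto simp: complex_eq_iff)
  have n\<zeta>: "norm \<zeta> < 1"
    using norm_diff_less_add_cnj[of z w] z w zw by (simp add: \<zeta>_def norm_divide divide_simps)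
  have Rw: "w + cnj w \<noteq> 0" using w by (simp add: complex_eq_iff)
  have "1 - \<zeta> = (w + cnj w) / (z + cnj w)" using zw by (simp add: \<zeta>_def field_simps)
  moreover have "w + cnj w * \<zeta> = z * (w + cnj w) / (z + cnj w)"
    using zw by (simp add: \<zeta>_def field_simps)
  ultimately have "g \<zeta> = z" using zw Rw by (simp add: g_def)
  then have "norm ((f z - f w) / (f z + cnj (f w))) \<le> norm \<zeta>"
    using Schwarz_Lemma(1)[OF holF F0 F1 n\<zeta>] by (simp add: F_def)
  then show ?thesis
    using zw den[of z] z by (simp add: \<zeta>_def norm_divide divide_simps mult.commute)
qed

text \<open>This single estimate serves both as Harnack's inequality and as a Borel--Caratheodory bound.\<close>

lemma Harnack_half_plane:
  assumes hol: "f holomorphic_on \<complex>\<^sub>+" and pos: "\<And>s. s \<in> \<complex>\<^sub>+ \<Longrightarrow> Re (f s) \<ge> 0"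
    and z: "z \<in> \<complex>\<^sub>+" and w: "w \<in> \<complex>\<^sub>+"
  shows "norm (f z - f w) \<le> norm (z - w) / Re z * (1 + norm (z - w) / Re w) * Re (f w)"
proof (rule field_le_epsilon)
  define c where "c = norm (z - w) / Re z * (1 + norm (z - w) / Re w)"
  have c0: "c \<ge> 0" using z w by (auto simp: c_def)
  fix e :: real assume e: "e > 0"
  define d where "d = norm (z - w)"
  define D where "D = norm (z + cnj w)"
  \<comment> \<open>\<open>Schwarz_Pick_half_plane\<close> asks for a strictly positive real part,
    so a constant \<open>h\<close> is added to \<open>f\<close>; its contribution
    \<open>c * h\<close> stays below \<open>e\<close>.\<close>
  define h where "h = e / (c + 1)"
  have h: "h > 0" using e c0 by (simp add: h_def)
  define f' where "f' = (\<lambda>s. f s + of_real h)"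
  define A where "A = norm (f z - f w)"
  define r where "r = Re (f' w)"
  have r: "r > 0" using pos[OF w] h by (simp add: r_def f'_def)
  have "norm (f' z - f' w) * norm (z + cnj w) \<le> norm (z - w) * norm (f' z + cnj (f' w))"
    by (rule Schwarz_Pick_half_plane)
       (use h pos z w in \<open>auto simp: f'_def intro!: holomorphic_intros hol add_nonneg_pos\<close>)
  then have 1: "A * D \<le> d * norm (f' z + cnj (f' w))"
    by (simp add: A_def D_def d_def f'_def)
  have "norm (f' z + cnj (f' w)) = norm ((f' z - f' w) + of_real (2 * r))"
    by (rule arg_cong[where f = norm]) (simp add: complex_eq_iff r_def)
  also have "\<dots> \<le> A + 2 * r"
    using norm_triangle_ineq[of "f' z - f' w" "of_real (2 * r)"] r by (simp add: A_def f'_def)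
  finally have "A * D \<le> d * (A + 2 * r)"
    using 1 by (smt (verit) d_def mult_left_mono norm_ge_zero)
  then have 2: "A * (D - d) \<le> 2 * d * r" by (simp add: algebra_simps)
  have "D = norm ((z - w) + of_real (2 * Re w))"
    unfolding D_def by (rule arg_cong[where f = norm]) (simp add: complex_eq_iff)
  also have "\<dots> \<le> d + 2 * Re w"
    using norm_triangle_ineq[of "z - w" "of_real (2 * Re w)"] w by (simp add: d_def)
  finally have D: "D \<le> d + 2 * Re w" .
  have d0: "d \<ge> 0" "D \<ge> 0" by (auto simp: d_def D_def)
  \<comment> \<open>Multiplying by \<open>D + d\<close> turns \<open>D - d\<close> into
    \<open>D\<^sup>2 - d\<^sup>2 = 4 * Re z * Re w\<close>.\<close>
  have "A * (4 * Re z * Re w) = A * (D - d) * (D + d)"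
    using norm_add_cnj_square_diff[of z w]
    by (simp add: D_def d_def power2_eq_square algebra_simps)
  also have "\<dots> \<le> (2 * d * r) * (D + d)"
    using 2 d0 by (intro mult_right_mono) auto
  also have "\<dots> \<le> (2 * d * r) * (2 * d + 2 * Re w)"
    using D d0 r by (intro mult_left_mono) auto
  finally have "A * (Re z * Re w) \<le> d * (d + Re w) * r" by (simp add: algebra_simps)
  then have "A \<le> c * r"
    using z w by (simp add: c_def d_def[symmetric] field_simps)
  also have "c * r = c * Re (f w) + c * h" by (simp add: r_def f'_def algebra_simps)
  also have "c * h \<le> e"
    using e c0 by (simp add: h_def field_simps)
  finally show "norm (f z - f w) \<le> norm (z - w) / Re z * (1 + norm (z - w) / Re w) * Re (f w) + e"
    by (simp add: A_def c_def)
qed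

corollary Harnack_half_plane_bounded:
  assumes "f holomorphic_on \<complex>\<^sub>+" "\<And>s. s \<in> \<complex>\<^sub>+ \<Longrightarrow> Re (f s) \<ge> 0"
    and "\<epsilon> > 0" "Re z \<ge> \<epsilon>" "Re w \<ge> \<epsilon>" "norm (z - w) \<le> R"
  shows "norm (f z - f w) \<le> R / \<epsilon> * (1 + R / \<epsilon>) * Re (f w)"
proof -
  have "norm (f z - f w) \<le> norm (z - w) / Re z * (1 + norm (z - w) / Re w) * Re (f w)"
    using assms by (intro Harnack_half_plane) auto
  also have "\<dots> \<le> R / \<epsilon> * (1 + R / \<epsilon>) * Re (f w)"
  proof (intro mult_right_mono mult_mono add_mono frac_le)
    show "Re (f w) \<ge> 0" "R / \<epsilon> \<ge> 0" "R \<ge> 0"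
      using assms norm_ge_zero[of "z - w"] by (auto intro!: divide_nonneg_pos simp del: norm_ge_zero)
  qed (use assms norm_ge_zero[of "z - w"] in \<open>auto intro!: add_nonneg_nonneg divide_nonneg_pos simp del: norm_ge_zero\<close>)
  finally show ?thesis .
qed

text \<open>Phragmen--Lindelof for bounded functions: divide by \<open>1 + \<eta> (s - \<delta>)\<close> and let \<open>\<eta>\<close> tend to 0.\<close>

lemma bounded_half_plane_max_modulus:
  assumes hol: "f holomorphic_on \<complex>\<^sub>+" and \<delta>: "\<delta> > 0"
    and bdd: "\<And>s. Re s \<ge> \<delta> \<Longrightarrow> norm (f s) \<le> B"
    and bnd: "\<And>s. Re s = \<delta> \<Longrightarrow> norm (f s) \<le> M"
    and s: "Re s \<ge> \<delta>"
  shows "norm (f s) \<le> M"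
proof (rule field_le_epsilon)
  fix e :: real assume e: "e > 0"
  have "0 \<le> M" using order_trans[OF norm_ge_zero bnd[of "of_real \<delta>"]] by simp
  \<comment> \<open>The slack \<open>e / 2\<close> makes the bound positive even when
    \<open>M = 0\<close>, so that \<open>B\<close> can be compared with a multiple of it.\<close>
  define M' where "M' = M + e / 2"
  have M': "M' > 0" using e \<open>0 \<le> M\<close> by (simp add: M'_def)
  have B: "B \<ge> 0" using bdd[OF s] norm_ge_zero order_trans by blast
  have main: "norm (f s) \<le> M' * (1 + \<eta> * norm (s - of_real \<delta>))" if \<eta>: "\<eta> > 0" for \<eta>
  proof -
    define q :: "complex \<Rightarrow> complex" where "q = (\<lambda>z. 1 + of_real \<eta> * (z - of_real \<delta>))"
    have q1: "norm (q z) \<ge> 1" "norm (q z) \<ge> \<eta> * norm (z - of_real \<delta>)" if "Re z \<ge> \<delta>" for z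
    proof -
      have "Re (q z) \<ge> 1" using that \<eta> by (simp add: q_def)
      then show "norm (q z) \<ge> 1" using complex_Re_le_cmod[of "q z"] by linarith
      have "norm (of_real \<eta> * (z - of_real \<delta>)) \<le> norm (q z)"
      proof (rule power2_le_imp_le)
        have "(norm (q z))\<^sup>2 = (norm (of_real \<eta> * (z - of_real \<delta>)))\<^sup>2 + 1 + 2 * \<eta> * (Re z - \<delta>)"
          unfolding cmod_power2 q_def by (simp add: power2_eq_square algebra_simps)
        then show "(norm (of_real \<eta> * (z - of_real \<delta>)))\<^sup>2 \<le> (norm (q z))\<^sup>2"
          using \<eta> that by auto
      qed auto
      then show "norm (q z) \<ge> \<eta> * norm (z - of_real \<delta>)" using \<eta> by (simp add: norm_mult)
    qed
    \<comment> \<open>On the arc of radius \<open>R\<close> one has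
      \<open>|q| \<ge> \<eta> * R \<ge> B / M'\<close>, so there the global bound \<open>B\<close>
      already gives \<open>|f / q| \<le> M'\<close>.\<close>
    define R where "R = norm (s - of_real \<delta>) + B / (\<eta> * M') + 1"
    have "0 \<le> B / (\<eta> * M')" using B \<eta> M' by simp
    then have R: "R > norm (s - of_real \<delta>)" "R > 0" and RB: "R \<ge> B / (\<eta> * M')"
      using norm_ge_zero[of "s - of_real \<delta>"] unfolding R_def by linarith+
    have R3: "B \<le> \<eta> * R * M'"
      using RB \<eta> M' by (simp add: divide_le_eq mult_ac)
    define S where "S = half_plane \<delta> \<inter> ball (of_real \<delta>) R"
    have opS: "open S" by (simp add: S_def open_Int)
    have sub: "closure S \<subseteq> {z. Re z \<ge> \<delta>} \<inter> cball (of_real \<delta>) R"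
      by (rule closure_minimal) (auto simp: S_def intro!: closed_Int closed_halfspace_Re_ge)
    define g where "g = (\<lambda>z. f z / q z)"
    have holg: "g holomorphic_on {z. Re z \<ge> \<delta>}"
      unfolding g_def
    proof (intro holomorphic_intros holomorphic_on_subset[OF hol])
      show "q holomorphic_on {z. \<delta> \<le> Re z}" unfolding q_def by (intro holomorphic_intros)
      show "{z. \<delta> \<le> Re z} \<subseteq> \<complex>\<^sub>+" using \<delta> by auto
      show "q z \<noteq> 0" if "z \<in> {z. \<delta> \<le> Re z}" for z
        using q1(1)[of z] that by auto
    qed
    have gM: "norm (g z) \<le> M' \<longleftrightarrow> norm (f z) \<le> M' * norm (q z)" if "Re z \<ge> \<delta>" for z
    proof -
      have "norm (q z) > 0" using q1(1)[OF that] by linarith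
      then show ?thesis by (simp add: g_def norm_divide divide_le_eq)
    qed
    have "norm (g s) \<le> M'" if "s \<in> S"
    proof (rule maximum_modulus_frontier[of g S])
      show "g holomorphic_on interior S"
        using holg by (rule holomorphic_on_subset) (use interior_subset in \<open>force simp: S_def\<close>)
      show "continuous_on (closure S) g"
        using holomorphic_on_imp_continuous_on[OF holg] sub continuous_on_subset by blast
      show "bounded S" by (auto simp: S_def)
      fix z assume z: "z \<in> frontier S"
      then have z': "Re z \<ge> \<delta>" "norm (z - of_real \<delta>) \<le> R" "z \<notin> S"
        using sub opS by (auto simp: frontier_def interior_open dist_norm norm_minus_commute)
      then have "Re z = \<delta> \<or> norm (z - of_real \<delta>) = R"
        by (auto simp: S_def dist_norm norm_minus_commute)
      then show "norm (g z) \<le> M'"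
      proof
        assume "Re z = \<delta>"
        then have "norm (f z) \<le> M'" using bnd[of z] e by (simp add: M'_def)
        also have "\<dots> \<le> M' * norm (q z)" using M' q1(1)[OF z'(1)] by simp
        finally show ?thesis using gM[OF z'(1)] by blast
      next
        assume "norm (z - of_real \<delta>) = R"
        then have "norm (q z) \<ge> \<eta> * R" using q1(2)[OF z'(1)] by simp
        then have "norm (f z) \<le> M' * norm (q z)"
        proof -
          have "norm (f z) \<le> M' * (\<eta> * R)" using bdd[OF z'(1)] R3 by (simp add: mult_ac)
          also have "\<dots> \<le> M' * norm (q z)" using \<open>norm (q z) \<ge> \<eta> * R\<close> M' by simp
          finally show ?thesis .
        qed
        then show ?thesis using gM[OF z'(1)] by blast
      qed
    qed (use that in auto)
    moreover have "s \<in> S \<or> Re s = \<delta>" using s R(1) by (auto simp: S_def dist_norm norm_minus_commute)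
    moreover have "norm (g s) \<le> M'" if "Re s = \<delta>"
    proof -
      have "norm (f s) \<le> M'" using bnd[OF that] e by (simp add: M'_def)
      also have "\<dots> \<le> M' * norm (q s)" using M' q1(1)[OF s] by simp
      finally show ?thesis using gM[OF s] by blast
    qed
    ultimately have "norm (g s) \<le> M'" by blast
    then have "norm (f s) \<le> M' * norm (q s)" using gM[OF s] by blast
    also have "norm (q s) \<le> 1 + \<eta> * norm (s - of_real \<delta>)"
      using norm_triangle_ineq[of 1 "of_real \<eta> * (s - of_real \<delta>)"] \<eta> by (simp add: q_def norm_mult)
    finally show ?thesis using M' by simp
  qed
  have "((\<lambda>\<eta>. M' * (1 + \<eta> * norm (s - of_real \<delta>))) \<longlongrightarrow> M' * (1 + 0 * norm (s - of_real \<delta>))) (at_right 0)"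
    by (intro tendsto_intros)
  then have "norm (f s) \<le> M' * (1 + 0 * norm (s - of_real \<delta>))"
    by (rule tendsto_lowerbound) (auto intro: eventually_mono[OF eventually_at_right_less[of 0]] main)
  then show "norm (f s) \<le> M + e" using e by (simp add: M'_def)
qed

section \<open>Absolutely convergent Dirichlet series\<close>

lemma norm_nat_powr: "norm (of_nat n powr z :: complex) = real n powr Re z"
  by (subst norm_powr_real_powr) auto

lemma nat_powr_mult: "of_nat (m * n) powr z = of_nat m powr z * (of_nat n powr z :: complex)"
  unfolding of_nat_mult by (rule powr_times_real) auto

text \<open>An upper bound \<open>M\<close> instead of the norm, and a function instead of its
  coefficients: bounds then multiply without Dirichlet convolution ever being written down. The
  index is shifted, \<open>a n\<close> belonging to the frequency \<open>n + 1\<close>.\<close>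

definition l1_dirichlet :: "real \<Rightarrow> real \<Rightarrow> (complex \<Rightarrow> complex) \<Rightarrow> bool" where
  "l1_dirichlet \<sigma> M f \<longleftrightarrow> (\<exists>a L. L \<le> M \<and>
     ((\<lambda>n. norm (a n) * real (Suc n) powr - \<sigma>) has_sum L) UNIV \<and>
     (\<forall>s. Re s \<ge> \<sigma> \<longrightarrow> ((\<lambda>n. a n * of_nat (Suc n) powr - s) has_sum f s) UNIV))"

text \<open>A series indexed by an arbitrary type is turned into a Dirichlet series by collecting equal
  frequencies.\<close>

lemma l1_dirichlet_collect:
  fixes c :: "'i \<Rightarrow> complex" and m :: "'i \<Rightarrow> nat"
  assumes m: "\<And>i. m i \<ge> 1"
    and L: "((\<lambda>i. norm (c i) * real (m i) powr - \<sigma>) has_sum L) UNIV" "L \<le> M"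
    and f: "\<And>s. Re s \<ge> \<sigma> \<Longrightarrow> f s = (\<Sum>\<^sub>\<infinity>i. c i * of_nat (m i) powr - s)"
  shows "l1_dirichlet \<sigma> M f"
proof -
  define B where "B = (\<lambda>n. {i. m i = Suc n})"
  have "bij_betw (\<lambda>(n, i). i) (Sigma UNIV B) UNIV"
  proof (rule bij_betwI[where g = "\<lambda>i. (m i - 1, i)"])
    show "(\<lambda>i. (m i - 1, i)) \<in> UNIV \<rightarrow> Sigma UNIV B"
      using m by (auto simp: B_def Suc_le_eq)
  qed (auto simp: B_def)
  then have split: "((\<lambda>(n, i). h i) has_sum x) (Sigma UNIV B)"
    if "(h has_sum x) UNIV" for h :: "'i \<Rightarrow> 'b::{topological_comm_monoid_add}" and x
    using has_sum_reindex_bij_betw[of "\<lambda>(n, i). i" "Sigma UNIV B" UNIV h x] that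
    by (simp add: case_prod_unfold)
  define h where "h = (\<lambda>i. norm (c i) * real (m i) powr - \<sigma>)"
  have hpos: "h i \<ge> 0" for i by (simp add: h_def)
  have hsum: "h summable_on A" for A
    using L(1) summable_on_subset_banach[of h UNIV A] by (auto simp: h_def summable_on_def)
  define g where "g = (\<lambda>n. infsum h (B n))"
  have g: "(g has_sum L) UNIV"
  proof (rule has_sum_SigmaD[OF split])
    show "(h has_sum L) UNIV" using L by (simp add: h_def)
    show "((\<lambda>i. case (n, i) of (n, i) \<Rightarrow> h i) has_sum g n) (B n)" for n
      using hsum by (simp add: g_def)
  qed
  define a where "a = (\<lambda>n. infsum c (B n))"
  have c_eq: "norm (c i) = h i * real (Suc n) powr \<sigma>" if "i \<in> B n" for i n
    using that by (auto simp: h_def B_def powr_minus)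
  have cabs: "(\<lambda>i. norm (c i)) summable_on B n" for n
  proof -
    have "(\<lambda>i. h i * real (Suc n) powr \<sigma>) summable_on B n"
      by (intro summable_on_cmult_left hsum)
    then show ?thesis using c_eq by (subst summable_on_cong[OF c_eq]) auto
  qed
  have a_le: "norm (a n) * real (Suc n) powr - \<sigma> \<le> g n" for n
  proof -
    have "norm (a n) \<le> (\<Sum>\<^sub>\<infinity>i\<in>B n. norm (c i))"
      unfolding a_def by (rule norm_infsum_bound[OF cabs])
    also have "\<dots> = (\<Sum>\<^sub>\<infinity>i\<in>B n. h i * real (Suc n) powr \<sigma>)"
      by (rule infsum_cong) (rule c_eq)
    also have "\<dots> = g n * real (Suc n) powr \<sigma>"
      unfolding g_def by (rule infsum_cmult_left) (use hsum in auto)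
    finally show ?thesis
      by (simp add: powr_minus divide_simps)
  qed
  have asum: "(\<lambda>n. norm (a n) * real (Suc n) powr - \<sigma>) summable_on UNIV"
    by (rule summable_on_comparison_test[of g]) (use g a_le in \<open>auto simp: summable_on_def\<close>)
  define L' where "L' = (\<Sum>\<^sub>\<infinity>n. norm (a n) * real (Suc n) powr - \<sigma>)"
  have L': "((\<lambda>n. norm (a n) * real (Suc n) powr - \<sigma>) has_sum L') UNIV"
    using asum by (simp add: L'_def)
  have "L' \<le> L" by (rule has_sum_mono[OF L' g]) (rule a_le)
  moreover have "((\<lambda>n. a n * of_nat (Suc n) powr - s) has_sum f s) UNIV" if s: "Re s \<ge> \<sigma>" for s
  proof -
    have "(\<lambda>i. norm (c i * of_nat (m i) powr - s)) summable_on UNIV"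
    proof (rule Infinite_Sum.abs_summable_on_comparison_test[of h])
      show "(\<lambda>i. norm (h i)) summable_on UNIV" using hsum hpos by simp
      show "norm (c i * of_nat (m i) powr - s) \<le> norm (h i)" for i
        using m[of i] s hpos[of i] by (auto simp: norm_mult norm_nat_powr h_def intro!: mult_left_mono powr_mono)
    qed
    then have hs: "((\<lambda>i. c i * of_nat (m i) powr - s) has_sum f s) UNIV"
      using has_sum_infsum[OF Infinite_Sum.abs_summable_summable] f[OF s] by simp
    show ?thesis
    proof (rule has_sum_SigmaD[OF split[OF hs]])
      fix n
      have "((\<lambda>i. c i * of_nat (Suc n) powr - s) has_sum (a n * of_nat (Suc n) powr - s)) (B n)"
        unfolding a_def by (rule has_sum_cmult_left[OF has_sum_infsum[OF Infinite_Sum.abs_summable_summable[OF cabs]]])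
      then show "((\<lambda>i. case (n, i) of (n, i) \<Rightarrow> c i * of_nat (m i) powr - s) has_sum
          a n * of_nat (Suc n) powr - s) (B n)"
        by (rule has_sum_cong[THEN iffD1, rotated]) (simp add: B_def)
    qed
  qed
  ultimately show ?thesis
    unfolding l1_dirichlet_def using L' L(2) by (intro exI[of _ a] exI[of _ L']) auto
qed

lemma l1_dirichlet_mono: "l1_dirichlet \<sigma> M f \<Longrightarrow> M \<le> M' \<Longrightarrow> l1_dirichlet \<sigma> M' f"
  unfolding l1_dirichlet_def by (meson order_trans)

lemma l1_dirichlet_const: "l1_dirichlet \<sigma> (norm c) (\<lambda>_. c)"
  by (rule l1_dirichlet_collect[of "\<lambda>_::unit. 1" "\<lambda>_. c" _ "norm c"])
     (auto simp: has_sum_finite_iff UNIV_unit)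

text \<open>Multiplication by a single term moves the frequency \<open>n\<close> to
  \<open>k * n\<close>. A product of two series is an infinite sum of such multiples.\<close>

lemma l1_dirichlet_monomial_mult:
  assumes "l1_dirichlet \<sigma> M f" "k \<ge> 1"
  shows "l1_dirichlet \<sigma> (norm c * real k powr - \<sigma> * M) (\<lambda>s. c * of_nat k powr - s * f s)"
proof -
  obtain a L where L: "L \<le> M" "((\<lambda>n. norm (a n) * real (Suc n) powr - \<sigma>) has_sum L) UNIV"
    and f: "\<And>s. Re s \<ge> \<sigma> \<Longrightarrow> ((\<lambda>n. a n * of_nat (Suc n) powr - s) has_sum f s) UNIV"
    using assms(1) unfolding l1_dirichlet_def by blast
  show ?thesis
  proof (rule l1_dirichlet_collect[of "\<lambda>n. k * Suc n" "\<lambda>n. c * a n" _ "norm c * real k powr - \<sigma> * L"])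
    show "1 \<le> k * Suc n" for n using assms(2) by simp
    show "((\<lambda>n. norm (c * a n) * real (k * Suc n) powr - \<sigma>) has_sum norm c * real k powr - \<sigma> * L) UNIV"
      using has_sum_cmult_right[OF L(2), of "norm c * real k powr - \<sigma>"]
      by (simp add: norm_mult powr_mult mult_ac del: of_nat_Suc mult_Suc_right mult_Suc)
    show "norm c * real k powr - \<sigma> * L \<le> norm c * real k powr - \<sigma> * M"
      using L by (intro mult_left_mono) auto
    show "c * of_nat k powr - s * f s = (\<Sum>\<^sub>\<infinity>n. c * a n * of_nat (k * Suc n) powr - s)" if "Re s \<ge> \<sigma>" for s
      using has_sum_cmult_right[OF f[OF that], of "c * of_nat k powr - s"]
      by (intro infsumI[symmetric]) (simp add: nat_powr_mult mult_ac del: of_nat_Suc of_nat_mult mult_Suc_right mult_Suc)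
  qed
qed

text \<open>Completeness of the algebra: the coefficients of all \<open>F k\<close> form an
  absolutely summable family over pairs \<open>(k, n)\<close> with total at most \<open>L\<close>,
  so Fubini applies and the pairs can be regrouped by frequency.\<close>

lemma l1_dirichlet_infsum:
  fixes F :: "nat \<Rightarrow> complex \<Rightarrow> complex"
  assumes F: "\<And>k. l1_dirichlet \<sigma> (M k) (F k)" and M: "(M has_sum L) UNIV"
    and f: "\<And>s. Re s \<ge> \<sigma> \<Longrightarrow> f s = (\<Sum>\<^sub>\<infinity>k. F k s)"
  shows "l1_dirichlet \<sigma> L f"
proof -
  define P where "P = (\<lambda>k a N. N \<le> M k \<and>
      ((\<lambda>n. norm (a n) * real (Suc n) powr - \<sigma>) has_sum N) UNIV \<and>
      (\<forall>s. Re s \<ge> \<sigma> \<longrightarrow> ((\<lambda>n. a n * of_nat (Suc n) powr - s) has_sum F k s) UNIV))"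
  have "\<forall>k. \<exists>a N. P k a N"
    using F unfolding l1_dirichlet_def P_def by blast
  then obtain a N where aN: "\<And>k. P k (a k) (N k)"
    unfolding choice_iff by blast
  have N: "N k \<le> M k" "((\<lambda>n. norm (a k n) * real (Suc n) powr - \<sigma>) has_sum N k) UNIV"
    and a: "Re s \<ge> \<sigma> \<Longrightarrow> ((\<lambda>n. a k n * of_nat (Suc n) powr - s) has_sum F k s) UNIV" for k s
    using aN[of k] by (auto simp: P_def)
  define h where "h = (\<lambda>(k, n). norm (a k n) * real (Suc n) powr - \<sigma>)"
  have hpos: "h i \<ge> 0" for i by (simp add: h_def case_prod_unfold)
  have N0: "N k \<ge> 0" for k by (rule has_sum_nonneg[OF N(2)]) auto
  have Nsum: "N summable_on UNIV"
    by (rule summable_on_comparison_test[of M]) (use M N(1) N0 in \<open>auto simp: summable_on_def\<close>)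
  have habs: "(\<lambda>i. norm (h i)) summable_on UNIV \<times> UNIV"
  proof (subst Infinite_Sum.abs_summable_on_Sigma_iff, intro conjI ballI)
    show "(\<lambda>n. norm (h (k, n))) summable_on UNIV" for k
      using N(2)[of k] by (auto simp: h_def summable_on_def)
    have "(\<Sum>\<^sub>\<infinity>n. norm (h (k, n))) = N k" for k
      using infsumI[OF N(2)[of k]] by (simp add: h_def)
    then show "(\<lambda>k. norm (\<Sum>\<^sub>\<infinity>n. norm (h (k, n)))) summable_on UNIV"
      using Nsum N0 by simp
  qed
  then have hs: "(h has_sum infsum h UNIV) (UNIV \<times> UNIV)"
    using Infinite_Sum.abs_summable_summable[OF habs] by simp
  have "(N has_sum infsum h UNIV) UNIV"
    by (rule has_sum_SigmaD[OF hs]) (use N(2) in \<open>simp add: h_def\<close>)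
  then have le: "infsum h UNIV \<le> L" using N(1) M has_sum_mono by blast
  show ?thesis
  proof (rule l1_dirichlet_collect[of "\<lambda>(k, n). Suc n" "\<lambda>(k, n). a k n" _ "infsum h UNIV"])
    show "((\<lambda>i. norm (case i of (k, n) \<Rightarrow> a k n) * real (case i of (k, n) \<Rightarrow> Suc n) powr - \<sigma>)
        has_sum infsum h UNIV) UNIV"
      using hs by (simp add: h_def case_prod_unfold)
    fix s assume s: "Re s \<ge> \<sigma>"
    define g where "g = (\<lambda>(k, n). a k n * of_nat (Suc n) powr - s)"
    have "(\<lambda>i. norm (g i)) summable_on UNIV \<times> UNIV"
    proof (rule Infinite_Sum.abs_summable_on_comparison_test[OF habs])
      show "norm (g i) \<le> norm (h i)" for i
        using s by (auto simp: g_def h_def case_prod_unfold norm_mult norm_nat_powr abs_mult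
            simp del: of_nat_Suc intro!: mult_left_mono powr_mono)
    qed
    then have gs: "(g has_sum infsum g UNIV) (UNIV \<times> UNIV)"
      using Infinite_Sum.abs_summable_summable[of g "UNIV \<times> UNIV"] by simp
    have "((\<lambda>k. F k s) has_sum infsum g UNIV) UNIV"
      by (rule has_sum_SigmaD[OF gs]) (use a[OF s] in \<open>simp add: g_def\<close>)
    then show "f s = (\<Sum>\<^sub>\<infinity>i. (case i of (k, n) \<Rightarrow> a k n) * of_nat (case i of (k, n) \<Rightarrow> Suc n) powr - s)"
      using f[OF s] by (simp add: infsumI g_def case_prod_unfold)
  qed (use le in auto)
qed

text \<open>Expanding only \<open>f\<close> and leaving \<open>g\<close> whole reduces the product
  to a convergent sum of multiples of \<open>g\<close> by single terms.\<close>

lemma l1_dirichlet_mult: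
  assumes F: "l1_dirichlet \<sigma> M f" and G: "l1_dirichlet \<sigma> N g" and N: "N \<ge> 0"
  shows "l1_dirichlet \<sigma> (M * N) (\<lambda>s. f s * g s)"
proof -
  obtain a L where L: "L \<le> M" "((\<lambda>n. norm (a n) * real (Suc n) powr - \<sigma>) has_sum L) UNIV"
    and f: "\<And>s. Re s \<ge> \<sigma> \<Longrightarrow> ((\<lambda>n. a n * of_nat (Suc n) powr - s) has_sum f s) UNIV"
    using F unfolding l1_dirichlet_def by blast
  have "l1_dirichlet \<sigma> (L * N) (\<lambda>s. f s * g s)"
  proof (rule l1_dirichlet_infsum)
    show "l1_dirichlet \<sigma> (norm (a k) * real (Suc k) powr - \<sigma> * N)
        (\<lambda>s. a k * of_nat (Suc k) powr - s * g s)" for k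
      by (rule l1_dirichlet_monomial_mult[OF G]) auto
    show "((\<lambda>k. norm (a k) * real (Suc k) powr - \<sigma> * N) has_sum L * N) UNIV"
      using L(2) by (rule has_sum_cmult_left)
    show "f s * g s = (\<Sum>\<^sub>\<infinity>k. a k * of_nat (Suc k) powr - s * g s)" if "Re s \<ge> \<sigma>" for s
      using has_sum_cmult_left[OF f[OF that]] by (rule infsumI[symmetric])
  qed
  then show ?thesis by (rule l1_dirichlet_mono) (use L N in \<open>auto intro: mult_right_mono\<close>)
qed

lemma l1_dirichlet_nonneg: "l1_dirichlet \<sigma> M f \<Longrightarrow> M \<ge> 0"
  unfolding l1_dirichlet_def by (force dest: has_sum_nonneg)

lemma l1_dirichlet_power:
  assumes "l1_dirichlet \<sigma> M f"
  shows "l1_dirichlet \<sigma> (M ^ k) (\<lambda>s. f s ^ k)"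
proof (induction k)
  case 0
  then show ?case using l1_dirichlet_const[of \<sigma> 1] by simp
next
  case (Suc k)
  then show ?case
    using l1_dirichlet_mult[OF assms Suc] l1_dirichlet_nonneg[OF assms] by simp
qed

lemma exp_has_sum:
  fixes x :: "'a :: {banach, real_normed_field}"
  shows "((\<lambda>k. x ^ k /\<^sub>R fact k) has_sum exp x) (UNIV :: nat set)"
  by (rule norm_summable_imp_has_sum[OF _ exp_converges]) (rule summable_norm_exp)

text \<open>The exponential series summed in the algebra: its k-th term has norm at most
  \<open>(norm c * M) ^ k / fact k\<close>.\<close>

lemma l1_dirichlet_exp:
  assumes "l1_dirichlet \<sigma> M f"
  shows "l1_dirichlet \<sigma> (exp (norm c * M)) (\<lambda>s. exp (c * f s))"
proof (rule l1_dirichlet_infsum)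
  have "l1_dirichlet \<sigma> (norm (c ^ k /\<^sub>R fact k) * M ^ k) (\<lambda>s. c ^ k /\<^sub>R fact k * f s ^ k)" for k
    by (rule l1_dirichlet_mult[OF l1_dirichlet_const l1_dirichlet_power[OF assms]])
       (use l1_dirichlet_nonneg[OF assms] in simp)
  then show "l1_dirichlet \<sigma> ((norm c * M) ^ k /\<^sub>R fact k) (\<lambda>s. (c * f s) ^ k /\<^sub>R fact k)" for k
    by (simp add: power_mult_distrib norm_power mult_ac)
  show "((\<lambda>k. (norm c * M) ^ k /\<^sub>R fact k) has_sum exp (norm c * M)) UNIV"
    by (rule exp_has_sum)
  show "exp (c * f s) = (\<Sum>\<^sub>\<infinity>k. (c * f s) ^ k /\<^sub>R fact k)" for s
    using exp_has_sum by (rule infsumI[symmetric])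
qed

section \<open>Series with explicit coefficients: tails and holomorphy\<close>

definition dirichlet_abs :: "(nat \<Rightarrow> complex) \<Rightarrow> real \<Rightarrow> (complex \<Rightarrow> complex) \<Rightarrow> bool" where
  "dirichlet_abs a \<sigma> f \<longleftrightarrow>
     summable (\<lambda>n. norm (a n) * real (Suc n) powr - \<sigma>) \<and>
     (\<forall>s. Re s \<ge> \<sigma> \<longrightarrow> (\<lambda>n. a n * of_nat (Suc n) powr - s) sums f s)"

text \<open>The terms are bounded at \<open>\<theta> + 1\<close>, where the series converges; moving
  2 further to the right gains the summable factor \<open>n powr - 2\<close>.\<close>

lemma dirichlet_sums_on_imp_abs:
  assumes "dirichlet_sums_on a f (half_plane \<theta>)"
  shows "dirichlet_abs (\<lambda>n. a (Suc n)) (\<theta> + 3) f"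
  unfolding dirichlet_abs_def
proof
  have "(\<lambda>n. a (Suc n) * of_nat (Suc n) powr - of_real (\<theta> + 1)) sums f (of_real (\<theta> + 1))"
    using assms unfolding dirichlet_sums_on_def by (rule bspec) simp
  then have "(\<lambda>n. a (Suc n) * of_nat (Suc n) powr - of_real (\<theta> + 1)) \<longlonglongrightarrow> 0"
    by (intro summable_LIMSEQ_zero) (auto simp: sums_iff)
  then have "Bseq (\<lambda>n. a (Suc n) * of_nat (Suc n) powr - of_real (\<theta> + 1))"
    by (intro convergent_imp_Bseq) (auto simp: convergent_def)
  then obtain K where K: "\<And>n. norm (a (Suc n) * of_nat (Suc n) powr - of_real (\<theta> + 1)) \<le> K"
    unfolding Bseq_def by blast
  show "summable (\<lambda>n. norm (a (Suc n)) * real (Suc n) powr - (\<theta> + 3))"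
  proof (rule summable_comparison_test'[where N = 0])
    have "summable (\<lambda>n. real (Suc n) powr - 2)"
      by (subst summable_Suc_iff) (subst summable_real_powr_iff, simp)
    then show "summable (\<lambda>n. K * real (Suc n) powr - 2)" by (rule summable_mult)
    fix n
    have "norm (a (Suc n)) * real (Suc n) powr - (\<theta> + 3)
        = norm (a (Suc n) * of_nat (Suc n) powr - of_real (\<theta> + 1)) * real (Suc n) powr - 2"
      by (simp add: norm_mult norm_nat_powr mult.assoc powr_add[symmetric] minus_add_distrib add.commute del: of_nat_Suc)
    also have "\<dots> \<le> K * real (Suc n) powr - 2" by (intro mult_right_mono K) auto
    finally show "norm (norm (a (Suc n)) * real (Suc n) powr - (\<theta> + 3)) \<le> K * real (Suc n) powr - 2"
      by simp
  qed
  show "\<forall>s. \<theta> + 3 \<le> Re s \<longrightarrow> (\<lambda>n. a (Suc n) * of_nat (Suc n) powr - s) sums f s"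
    using assms by (auto simp: dirichlet_sums_on_def)
qed

lemma in_D_imp_abs:
  assumes "in_D f"
  obtains a \<sigma> where "\<sigma> > 0" "dirichlet_abs a \<sigma> f"
proof -
  obtain a \<theta> where "\<theta> \<ge> 0" "dirichlet_sums_on a f (half_plane \<theta>)"
    using assms by (auto simp: in_D_def)
  then show ?thesis using that[of "\<theta> + 3"] dirichlet_sums_on_imp_abs by force
qed

lemma dirichlet_abs_summable_mono:
  assumes "dirichlet_abs a \<sigma> f" "\<sigma> \<le> \<tau>"
  shows "summable (\<lambda>n. norm (a n) * real (Suc n) powr - \<tau>)"
proof (rule summable_comparison_test'[where N = 0])
  show "summable (\<lambda>n. norm (a n) * real (Suc n) powr - \<sigma>)"
    using assms by (simp add: dirichlet_abs_def)
  show "norm (norm (a n) * real (Suc n) powr - \<tau>) \<le> norm (a n) * real (Suc n) powr - \<sigma>" for n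
    using assms(2) by (auto intro!: mult_left_mono powr_mono)
qed

lemma dirichlet_abs_mono: "dirichlet_abs a \<sigma> f \<Longrightarrow> \<sigma> \<le> \<tau> \<Longrightarrow> dirichlet_abs a \<tau> f"
  using dirichlet_abs_summable_mono by (force simp: dirichlet_abs_def)

lemma dirichlet_abs_has_sum:
  assumes "dirichlet_abs a \<sigma> f" "Re s \<ge> \<sigma>"
  shows "((\<lambda>n. a n * of_nat (Suc n) powr - s) has_sum f s) UNIV"
proof (rule norm_summable_imp_has_sum)
  have "norm (a n * of_nat (Suc n) powr - s) = norm (a n) * real (Suc n) powr - Re s" for n
    by (simp add: norm_mult norm_nat_powr del: of_nat_Suc)
  then show "summable (\<lambda>n. norm (a n * of_nat (Suc n) powr - s))"
    using dirichlet_abs_summable_mono[OF assms] by presburger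
  show "(\<lambda>n. a n * of_nat (Suc n) powr - s) sums f s"
    using assms by (simp add: dirichlet_abs_def)
qed

lemma dirichlet_abs_imp_l1_dirichlet:
  assumes "dirichlet_abs a \<sigma> f" "(\<Sum>n. norm (a n) * real (Suc n) powr - \<sigma>) \<le> M"
  shows "l1_dirichlet \<sigma> M f"
  unfolding l1_dirichlet_def
proof (intro exI conjI allI impI)
  show "((\<lambda>n. norm (a n) * real (Suc n) powr - \<sigma>) has_sum (\<Sum>n. norm (a n) * real (Suc n) powr - \<sigma>)) UNIV"
    using assms(1) by (intro norm_summable_imp_has_sum) (auto simp: dirichlet_abs_def)
qed (use assms dirichlet_abs_has_sum in auto)

lemma l1_dirichlet_imp_sums_on:
  assumes "l1_dirichlet \<sigma> M f"
  obtains a where "dirichlet_sums_on a f (half_plane \<sigma>)"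
proof -
  obtain a where a: "\<And>s. Re s \<ge> \<sigma> \<Longrightarrow> ((\<lambda>n. a n * of_nat (Suc n) powr - s) has_sum f s) UNIV"
    using assms unfolding l1_dirichlet_def by blast
  have "dirichlet_sums_on (\<lambda>n. a (n - 1)) f (half_plane \<sigma>)"
    using a has_sum_imp_sums by (force simp: dirichlet_sums_on_def)
  then show ?thesis by (rule that)
qed

text \<open>From the frequency \<open>N + 1\<close> on, \<open>n powr (\<sigma> - Re s)\<close> is
  at most its value at \<open>N + 1\<close>. The case \<open>N = 0\<close> bounds \<open>f\<close>,
  \<open>N = 1\<close> gives the limit \<open>a 0\<close> at infinity, and general \<open>N\<close>
  serves for Perron's formula and for isolating the leading non-constant term.\<close>

lemma dirichlet_abs_tail:
  assumes "dirichlet_abs a \<sigma> f" "Re s \<ge> \<sigma>"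
  shows "norm (f s - (\<Sum>n<N. a n * of_nat (Suc n) powr - s))
    \<le> (\<Sum>n. norm (a n) * real (Suc n) powr - \<sigma>) * real (Suc N) powr (\<sigma> - Re s)"
proof -
  define A where "A = (\<Sum>n. norm (a n) * real (Suc n) powr - \<sigma>)"
  have s: "(\<lambda>n. a n * of_nat (Suc n) powr - s) sums f s"
    and sm: "summable (\<lambda>n. norm (a n) * real (Suc n) powr - \<sigma>)"
    using assms by (auto simp: dirichlet_abs_def)
  have eq: "f s - (\<Sum>n<N. a n * of_nat (Suc n) powr - s)
      = (\<Sum>n. a (n + N) * of_nat (Suc (n + N)) powr - s)"
    using suminf_split_initial_segment[of "\<lambda>n. a n * of_nat (Suc n) powr - s" N] s by (simp add: sums_iff)
  have sm': "summable (\<lambda>n. norm (a (n + N)) * real (Suc (n + N)) powr - \<sigma>)"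
    using summable_iff_shift[of "\<lambda>n. norm (a n) * real (Suc n) powr - \<sigma>" N] sm by simp
  have le: "norm (a (n + N) * of_nat (Suc (n + N)) powr - s)
    \<le> norm (a (n + N)) * real (Suc (n + N)) powr - \<sigma> * real (Suc N) powr (\<sigma> - Re s)" for n
  proof -
    have "real (Suc (n + N)) powr - Re s = real (Suc (n + N)) powr - \<sigma> * real (Suc (n + N)) powr (\<sigma> - Re s)"
      by (simp add: powr_add[symmetric] del: of_nat_Suc)
    also have "\<dots> \<le> real (Suc (n + N)) powr - \<sigma> * real (Suc N) powr (\<sigma> - Re s)"
      using assms(2) by (intro mult_left_mono powr_mono2') auto
    finally show ?thesis
      by (simp add: norm_mult norm_nat_powr mult.assoc mult_left_mono del: of_nat_Suc)
  qed
  have "norm (f s - (\<Sum>n<N. a n * of_nat (Suc n) powr - s))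
      \<le> (\<Sum>n. norm (a (n + N)) * real (Suc (n + N)) powr - \<sigma> * real (Suc N) powr (\<sigma> - Re s))"
    unfolding eq by (rule norm_suminf_le[OF le]) (intro summable_mult2 sm')
  also have "\<dots> = (\<Sum>n. norm (a (n + N)) * real (Suc (n + N)) powr - \<sigma>) * real (Suc N) powr (\<sigma> - Re s)"
    by (rule suminf_mult2[symmetric, OF sm'])
  also have "\<dots> \<le> A * real (Suc N) powr (\<sigma> - Re s)"
  proof (rule mult_right_mono)
    have "A = (\<Sum>n. norm (a (n + N)) * real (Suc (n + N)) powr - \<sigma>) + (\<Sum>n<N. norm (a n) * real (Suc n) powr - \<sigma>)"
      unfolding A_def by (rule suminf_split_initial_segment[OF sm])
    then show "(\<Sum>n. norm (a (n + N)) * real (Suc (n + N)) powr - \<sigma>) \<le> A"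
      by (simp add: sum_nonneg)
  qed auto
  finally show ?thesis by (simp add: A_def)
qed

text \<open>Mean value inequality for \<open>x powr - w\<close> on the segment from \<open>n\<close>
  to \<open>n + 1\<close>. The bound is summable over \<open>n\<close> as soon as
  \<open>Re w > 0\<close>, as Abel summation requires.\<close>

lemma nat_powr_diff_bound:
  assumes "n \<ge> 1" "Re w \<ge> 0"
  shows "norm (of_nat (Suc n) powr - w - (of_nat n powr - w :: complex)) \<le> norm w * real n powr (- Re w - 1)"
proof -
  have mem: "\<exists>t\<ge>real n. x = of_real t" if x: "x \<in> closed_segment (of_nat n) (of_nat (Suc n))" for x :: complex
  proof -
    obtain u where u: "0 \<le> u" "x = (1 - u) *\<^sub>R of_nat n + u *\<^sub>R of_nat (Suc n)"
      using x by (auto simp: in_segment)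
    then have "x = of_real (real n + u)" by (simp add: scaleR_conv_of_real algebra_simps)
    then show ?thesis using u(1) by (intro exI[of _ "real n + u"]) auto
  qed
  have "norm (of_nat (Suc n) powr - w - (of_nat n powr - w :: complex))
      \<le> norm w * real n powr (- Re w - 1) * norm (of_nat (Suc n) - of_nat n :: complex)"
  proof (rule field_differentiable_bound[where S = "closed_segment (of_nat n) (of_nat (Suc n))"
        and f = "\<lambda>x. x powr - w" and f' = "\<lambda>x. - w * x powr (- w - 1)"])
    fix x :: complex assume "x \<in> closed_segment (of_nat n) (of_nat (Suc n))"
    then obtain t where t: "t \<ge> real n" "x = of_real t" using mem by blast
    then have x: "x \<notin> \<real>\<^sub>\<le>\<^sub>0" "Re x > 0" using assms(1) by (auto simp: complex_nonpos_Reals_iff)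
    show "((\<lambda>x. x powr - w) has_field_derivative - w * x powr (- w - 1))
        (at x within closed_segment (of_nat n) (of_nat (Suc n)))"
      by (rule has_field_derivative_at_within[OF has_field_derivative_powr[OF x(1)]])
    have "norm (x powr (- w - 1)) = t powr (- Re w - 1)"
      using t assms(1) by (subst norm_powr_real_powr) auto
    also have "\<dots> \<le> real n powr (- Re w - 1)"
      using t assms by (intro powr_mono2') auto
    finally show "norm (- w * x powr (- w - 1)) \<le> norm w * real n powr (- Re w - 1)"
      by (simp add: norm_mult mult_left_mono)
  qed auto
  then show ?thesis by simp
qed

text \<open>Abel summation bounds the partial sums locally uniformly to the right of a point of
  convergence, so Montel's theorem applies to them.\<close>

lemma dirichlet_sums_on_holomorphic:
  assumes f: "dirichlet_sums_on a f (half_plane \<theta>)"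
  shows "f holomorphic_on half_plane \<theta>"
proof -
  have "f holomorphic_on half_plane r" if r: "r > \<theta>" for r
  proof -
    define c where "c = (\<lambda>n. a (Suc n) * of_nat (Suc n) powr - of_real r)"
    define C where "C = (\<lambda>n. \<Sum>k<n. c k)"
    define S where "S = (\<lambda>N s. \<Sum>n<N. a (Suc n) * of_nat (Suc n) powr - s)"
    have "c sums f (of_real r)"
      using f r unfolding dirichlet_sums_on_def c_def by (auto simp del: of_nat_Suc)
    then have "Bseq C"
      unfolding C_def sums_def by (intro convergent_imp_Bseq) (auto simp: convergent_def)
    then obtain K where K: "\<And>n. norm (C n) \<le> K" and "K > 0"
      unfolding Bseq_def by blast
    have bound: "norm (S N s) \<le> K + K * norm w * (\<Sum>n. real (Suc n) powr (- \<rho> - 1))"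
      if w: "w = s - of_real r" and \<rho>: "\<rho> > 0" "Re w \<ge> \<rho>" for N s w \<rho>
    proof -
      define u where "u = (\<lambda>n. of_nat (Suc n) powr - w :: complex)"
      have "S N s = (\<Sum>n<N. c n * u n)"
        unfolding S_def c_def u_def w
        by (intro sum.cong refl) (simp add: mult.assoc powr_add[symmetric] del: of_nat_Suc)
      \<comment> \<open>Summation by parts: only the bounded partial sums \<open>C n\<close> and the
        summable differences of \<open>u\<close> remain, so the resulting bound does not depend on
        \<open>N\<close>.\<close>
      also have "\<dots> = C N * u N - (\<Sum>n<N. C (Suc n) * (u (Suc n) - u n))"
        by (induction N) (auto simp: C_def algebra_simps)
      also have "norm \<dots> \<le> norm (C N * u N) + norm (\<Sum>n<N. C (Suc n) * (u (Suc n) - u n))"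
        by (rule norm_triangle_ineq4)
      also have "norm (C N * u N) \<le> K * 1"
        unfolding norm_mult
      proof (intro mult_mono K)
        have "real (Suc N) powr - Re w \<le> real (Suc N) powr 0"
          using \<rho> by (intro powr_mono) auto
        then show "norm (u N) \<le> 1" by (simp add: u_def norm_nat_powr del: of_nat_Suc)
      qed (use \<open>K > 0\<close> in auto)
      also have "norm (\<Sum>n<N. C (Suc n) * (u (Suc n) - u n)) \<le> (\<Sum>n<N. K * (norm w * real (Suc n) powr (- \<rho> - 1)))"
      proof (rule sum_norm_le)
        fix n
        have "norm (u (Suc n) - u n) \<le> norm w * real (Suc n) powr (- Re w - 1)"
          unfolding u_def by (rule nat_powr_diff_bound) (use \<rho> in auto)
        also have "\<dots> \<le> norm w * real (Suc n) powr (- \<rho> - 1)"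
          using \<rho> by (intro mult_left_mono powr_mono) auto
        finally show "norm (C (Suc n) * (u (Suc n) - u n)) \<le> K * (norm w * real (Suc n) powr (- \<rho> - 1))"
          unfolding norm_mult by (intro mult_mono K) (use \<open>K > 0\<close> in auto)
      qed
      also have "\<dots> = K * norm w * (\<Sum>n<N. real (Suc n) powr (- \<rho> - 1))"
        by (simp add: sum_distrib_left mult.assoc)
      also have "\<dots> \<le> K * norm w * (\<Sum>n. real (Suc n) powr (- \<rho> - 1))"
      proof (intro mult_left_mono sum_le_suminf)
        show "summable (\<lambda>n. real (Suc n) powr (- \<rho> - 1))"
          by (subst summable_Suc_iff) (subst summable_real_powr_iff, use \<rho> in simp)
      qed (use \<open>K > 0\<close> in auto)
      finally show ?thesis by simp
    qed
    have holS: "S N holomorphic_on half_plane r" for N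
      unfolding S_def by (intro holomorphic_intros)
    obtain g q where g: "g holomorphic_on half_plane r" "strict_mono q"
        "\<And>x. x \<in> half_plane r \<Longrightarrow> (\<lambda>n. S (q n) x) \<longlonglongrightarrow> g x"
    proof (rule Montel[of "half_plane r" "range S" S])
      show "open (half_plane r)" by simp
      show "h holomorphic_on half_plane r" if "h \<in> range S" for h using that holS by auto
      fix X assume X: "compact X" "X \<subseteq> half_plane r"
      show "\<exists>B. \<forall>h\<in>range S. \<forall>z\<in>X. norm (h z) \<le> B"
      proof (cases "X = {}")
        case False
        obtain z0 where z0: "z0 \<in> X" "\<And>z. z \<in> X \<Longrightarrow> Re z0 \<le> Re z"
          using continuous_attains_inf[OF X(1) False, of Re] continuous_on_Re[OF continuous_on_id] by auto
        obtain D where D: "\<And>z. z \<in> X \<Longrightarrow> norm z \<le> D"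
          using compact_imp_bounded[OF X(1)] by (auto simp: bounded_iff)
        define \<rho> where "\<rho> = Re z0 - r"
        define Z where "Z = (\<Sum>n. real (Suc n) powr (- \<rho> - 1))"
        have \<rho>: "\<rho> > 0" using z0(1) X(2) by (auto simp: \<rho>_def)
        have Z: "Z \<ge> 0" unfolding Z_def
        proof (intro suminf_nonneg)
          show "summable (\<lambda>n. real (Suc n) powr (- \<rho> - 1))"
            by (subst summable_Suc_iff) (subst summable_real_powr_iff, use \<rho> in simp)
        qed auto
        have "norm (S N z) \<le> K + K * (D + \<bar>r\<bar>) * Z" if "z \<in> X" for N z
        proof -
          have "norm (S N z) \<le> K + K * norm (z - of_real r) * Z"
            unfolding Z_def by (rule bound) (use \<rho> z0(2)[OF that] in \<open>auto simp: \<rho>_def\<close>)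
          also have "norm (z - of_real r) \<le> D + \<bar>r\<bar>"
            using norm_triangle_ineq4[of z "of_real r"] D[OF that] by simp
          finally show ?thesis using Z \<open>K > 0\<close> by (simp add: mult_left_mono mult_right_mono)
        qed
        then show ?thesis by blast
      qed auto
    qed auto
    \<comment> \<open>Montel's theorem gives a holomorphic limit of a subsequence only; pointwise
      convergence to \<open>f\<close> identifies it.\<close>
    have "g s = f s" if s: "s \<in> half_plane r" for s
    proof -
      have "(\<lambda>N. S N s) \<longlonglongrightarrow> f s"
        using f s r by (simp add: dirichlet_sums_on_def S_def sums_def)
      then have "(\<lambda>n. S (q n) s) \<longlonglongrightarrow> f s"
        using LIMSEQ_subseq_LIMSEQ[OF _ g(2)] by (auto simp: o_def)
      then show ?thesis using g(3)[OF s] LIMSEQ_unique by blast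
    qed
    then show ?thesis using g(1) holomorphic_cong by metis
  qed
  then have "f holomorphic_on (\<Union>r\<in>{\<theta><..}. half_plane r)"
    by (intro holomorphic_on_UN_open) auto
  moreover have "(\<Union>r\<in>{\<theta><..}. half_plane r) = half_plane \<theta>"
  proof (intro equalityI subsetI)
    fix z assume "z \<in> half_plane \<theta>"
    then obtain r where "\<theta> < r" "r < Re z" using dense[of \<theta> "Re z"] by auto
    then show "z \<in> (\<Union>r\<in>{\<theta><..}. half_plane r)" by auto
  qed auto
  ultimately show ?thesis by simp
qed

section \<open>Composition with \<open>s + \<phi> s\<close>, and failure of injectivity\<close>

lemma nat_powr_eq_exp: "n \<ge> 1 \<Longrightarrow> of_nat n powr z = exp (of_real (ln (real n)) * z :: complex)"
  by (simp add: powr_def Ln_of_nat mult.commute)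

lemma dirichlet_abs_tail_0:
  assumes "dirichlet_abs a \<sigma> f" "Re s \<ge> \<sigma>"
  shows "norm (f s - a 0) \<le> (\<Sum>n. norm (a n) * real (Suc n) powr - \<sigma>) * 2 powr (\<sigma> - Re s)"
  using dirichlet_abs_tail[OF assms, of 1] by simp

text \<open>\<open>b 0\<close> is the limit of \<phi> along the positive real axis.\<close>

lemma dirichlet_abs_limit_nonneg:
  assumes "dirichlet_abs b \<sigma> \<phi>" "\<And>s. Re s \<ge> \<sigma> \<Longrightarrow> Re (\<phi> s) \<ge> 0"
  shows "Re (b 0) \<ge> 0"
proof -
  define B where "B = (\<Sum>n. norm (b n) * real (Suc n) powr - \<sigma>)"
  have lim: "((\<lambda>x. B * 2 powr (\<sigma> - x)) \<longlongrightarrow> 0) at_top" by real_asymp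
  have "((\<lambda>x. - (B * 2 powr (\<sigma> - x))) \<longlongrightarrow> - 0) at_top"
    by (intro tendsto_intros lim)
  then have "- 0 \<le> Re (b 0)"
  proof (rule tendsto_upperbound)
    show "\<forall>\<^sub>F x in at_top. - (B * 2 powr (\<sigma> - x)) \<le> Re (b 0)"
      using eventually_ge_at_top[of \<sigma>]
    proof eventually_elim
      case (elim x)
      have "norm (\<phi> (of_real x) - b 0) \<le> B * 2 powr (\<sigma> - x)"
        using dirichlet_abs_tail_0[OF assms(1), of "of_real x"] elim by (simp add: B_def)
      then have "Re (\<phi> (of_real x)) - Re (b 0) \<le> B * 2 powr (\<sigma> - x)"
        using abs_Re_le_cmod[of "\<phi> (of_real x) - b 0"] by simp
      then show ?case using assms(2)[of "of_real x"] elim by simp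
    qed
  qed auto
  then show ?thesis by simp
qed

text \<open>Write \<open>\<phi> = b\<^sub>0 + \<phi>'\<close>. Far to the right the coefficients of \<open>\<phi>'\<close> have \<open>\<ell>\<^sup>1\<close>-norm at most 1, so
  \<open>n powr - \<phi>' = exp (- ln n * \<phi>')\<close> has \<open>\<ell>\<^sup>1\<close>-norm at most \<open>n\<close>.\<close>

lemma dirichlet_compose:
  assumes f: "dirichlet_abs a \<tau> f" and \<phi>: "dirichlet_abs b \<sigma> \<phi>"
    and pos: "\<And>s. Re s \<ge> \<sigma> \<Longrightarrow> Re (\<phi> s) \<ge> 0"
  obtains a' \<sigma>' where "\<sigma>' \<ge> \<sigma>" "dirichlet_sums_on a' (\<lambda>s. f (s + \<phi> s)) (half_plane \<sigma>')"
proof -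
  define B where "B = (\<Sum>n. norm (b n) * real (Suc n) powr - \<sigma>)"
  have sb: "summable (\<lambda>n. norm (b n) * real (Suc n) powr - \<sigma>)"
    using \<phi> by (simp add: dirichlet_abs_def)
  have b0: "Re (b 0) \<ge> 0" by (rule dirichlet_abs_limit_nonneg[OF \<phi> pos])
  have "((\<lambda>x. B * 2 powr (\<sigma> - x)) \<longlongrightarrow> 0) at_top" by real_asymp
  then have "\<forall>\<^sub>F x in at_top. B * 2 powr (\<sigma> - x) < 1"
    by (rule order_tendstoD(2)) simp
  then have "\<forall>\<^sub>F x in at_top. B * 2 powr (\<sigma> - x) < 1 \<and> x \<ge> max \<sigma> (\<tau> + 1)"
    by (intro eventually_conj eventually_ge_at_top)
  \<comment> \<open>The first condition makes the norm of \<psi> at most 1. The last one,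
    \<open>\<sigma>' \<ge> \<tau> + 1\<close>, pays for the factor \<open>n\<close> that bounds the
    norm of \<open>exp (- ln n * \<psi>)\<close>.\<close>
  then obtain \<sigma>' where \<sigma>': "B * 2 powr (\<sigma> - \<sigma>') < 1" "\<sigma>' \<ge> \<sigma>" "\<sigma>' \<ge> \<tau> + 1"
    by (auto simp: eventually_at_top_linorder)
  define b' where "b' = b(0 := 0)"
  define \<psi> where "\<psi> = (\<lambda>s. \<phi> s - b 0)"
  have le: "norm (b' n) * real (Suc n) powr - \<sigma>' \<le> norm (b n) * real (Suc n) powr - \<sigma> * 2 powr (\<sigma> - \<sigma>')" for n
  proof (cases "n = 0")
    case False
    have "real (Suc n) powr - \<sigma>' = real (Suc n) powr - \<sigma> * real (Suc n) powr (\<sigma> - \<sigma>')"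
      by (simp add: powr_add[symmetric] del: of_nat_Suc)
    also have "real (Suc n) powr (\<sigma> - \<sigma>') \<le> 2 powr (\<sigma> - \<sigma>')"
      using False \<sigma>' by (intro powr_mono2') auto
    finally have "real (Suc n) powr - \<sigma>' \<le> real (Suc n) powr - \<sigma> * 2 powr (\<sigma> - \<sigma>')"
      by (simp add: mult_left_mono)
    then show ?thesis using False by (simp add: b'_def mult.assoc mult_left_mono del: of_nat_Suc)
  qed (simp add: b'_def)
  have sb': "summable (\<lambda>n. norm (b' n) * real (Suc n) powr - \<sigma>')"
    by (rule summable_comparison_test'[OF summable_mult2[OF sb, of "2 powr (\<sigma> - \<sigma>')"], of 0]) (use le in simp)
  have \<psi>: "l1_dirichlet \<sigma>' 1 \<psi>"
  proof (rule dirichlet_abs_imp_l1_dirichlet[of b'])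
    show "dirichlet_abs b' \<sigma>' \<psi>"
      unfolding dirichlet_abs_def
    proof (intro conjI allI impI sb')
      fix s assume "\<sigma>' \<le> Re s"
      then have "(\<lambda>n. b n * of_nat (Suc n) powr - s) sums \<phi> s"
        using \<phi> \<sigma>'(2) by (simp add: dirichlet_abs_def)
      then have "(\<lambda>n. b n * of_nat (Suc n) powr - s - (if n = 0 then b 0 else 0)) sums (\<phi> s - b 0)"
        by (intro sums_diff sums_single)
      moreover have "(\<lambda>n. b n * of_nat (Suc n) powr - s - (if n = 0 then b 0 else 0))
          = (\<lambda>n. b' n * of_nat (Suc n) powr - s)"
        by (auto simp: b'_def fun_eq_iff)
      ultimately show "(\<lambda>n. b' n * of_nat (Suc n) powr - s) sums \<psi> s"
        by (simp add: \<psi>_def)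
    qed
    have "(\<Sum>n. norm (b' n) * real (Suc n) powr - \<sigma>') \<le> (\<Sum>n. norm (b n) * real (Suc n) powr - \<sigma> * 2 powr (\<sigma> - \<sigma>'))"
      by (intro suminf_le le sb' summable_mult2 sb)
    also have "\<dots> = B * 2 powr (\<sigma> - \<sigma>')"
      unfolding B_def by (rule suminf_mult2[symmetric, OF sb])
    finally show "(\<Sum>n. norm (b' n) * real (Suc n) powr - \<sigma>') \<le> 1"
      using \<sigma>'(1) by simp
  qed
  have "l1_dirichlet \<sigma>' (\<Sum>n. norm (a n) * real (Suc n) powr - \<tau>) (\<lambda>s. f (s + \<phi> s))"
  proof (rule l1_dirichlet_infsum)
    fix k
    define n where "n = Suc k"
    have n: "real n > 0" "n \<ge> 1" by (auto simp: n_def)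
    \<comment> \<open>Since \<open>Re (b 0) \<ge> 0\<close>, the constant part of \<phi> can only
      shrink the coefficient: \<open>|c| \<le> |a k|\<close>.\<close>
    define c where "c = a k * of_nat n powr - b 0"
    have "l1_dirichlet \<sigma>' (exp (norm (- of_real (ln (real n)) :: complex) * 1)) (\<lambda>s. exp (- of_real (ln (real n)) * \<psi> s))"
      by (rule l1_dirichlet_exp[OF \<psi>])
    also have "exp (norm (- of_real (ln (real n)) :: complex) * 1) = real n" using n by simp
    finally have "l1_dirichlet \<sigma>' (norm c * real n powr - \<sigma>' * real n)
        (\<lambda>s. c * of_nat n powr - s * exp (- of_real (ln (real n)) * \<psi> s))"
      by (rule l1_dirichlet_monomial_mult) (simp add: n_def)
    then have "l1_dirichlet \<sigma>' (norm (a k) * real n powr - \<tau>)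
        (\<lambda>s. c * of_nat n powr - s * exp (- of_real (ln (real n)) * \<psi> s))"
    proof (rule l1_dirichlet_mono)
      have "norm c = norm (a k) * real n powr - Re (b 0)"
        by (simp add: c_def norm_mult norm_nat_powr)
      also have "\<dots> \<le> norm (a k) * real n powr 0"
        using n b0 by (intro mult_left_mono powr_mono) auto
      finally have c: "norm c \<le> norm (a k)" using n by simp
      have "norm c * real n powr - \<sigma>' * real n = norm c * real n powr (1 - \<sigma>')"
        using n by (simp add: powr_diff powr_minus divide_simps)
      also have "\<dots> \<le> norm (a k) * real n powr - \<tau>"
        using c n \<sigma>' by (intro mult_mono powr_mono) auto
      finally show "norm c * real n powr - \<sigma>' * real n \<le> norm (a k) * real n powr - \<tau>" .
    qed
    moreover have "c * of_nat n powr - s * exp (- of_real (ln (real n)) * \<psi> s) = a k * of_nat n powr - (s + \<phi> s)" for s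
      using n by (simp add: c_def nat_powr_eq_exp \<psi>_def exp_add[symmetric] mult.assoc algebra_simps)
    ultimately show "l1_dirichlet \<sigma>' (norm (a k) * real (Suc k) powr - \<tau>) (\<lambda>s. a k * of_nat (Suc k) powr - (s + \<phi> s))"
      by (simp add: n_def)
  next
    show "((\<lambda>n. norm (a n) * real (Suc n) powr - \<tau>) has_sum (\<Sum>n. norm (a n) * real (Suc n) powr - \<tau>)) UNIV"
      using f by (intro norm_summable_imp_has_sum) (auto simp: dirichlet_abs_def)
    fix s assume "\<sigma>' \<le> Re s"
    then have "Re (s + \<phi> s) \<ge> \<tau>" using pos[of s] \<sigma>' by simp
    then show "f (s + \<phi> s) = (\<Sum>\<^sub>\<infinity>k. a k * of_nat (Suc k) powr - (s + \<phi> s))"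
      using dirichlet_abs_has_sum[OF f] infsumI by metis
  qed
  then show ?thesis
    using l1_dirichlet_imp_sums_on that \<sigma>'(2) by metis
qed

text \<open>A non-constant Dirichlet series behaves like \<open>a\<^sub>0 + a\<^sub>N (N + 1) powr - s\<close> far to the right, and
  the exponential is periodic.\<close>

lemma dirichlet_not_inj:
  assumes f: "dirichlet_abs a \<sigma> f" and hol: "f holomorphic_on half_plane \<sigma>"
  shows "\<not> inj_on f (half_plane \<sigma>)"
proof
  assume inj: "inj_on f (half_plane \<sigma>)"
  show False
  proof (cases "\<exists>n\<ge>1. a n \<noteq> 0")
    case False
    have "f s = a 0" if "Re s \<ge> \<sigma>" for s
    proof -
      have "(\<lambda>n. a n * of_nat (Suc n) powr - s) sums f s"
        using f that by (simp add: dirichlet_abs_def)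
      moreover have "(\<lambda>n. a n * of_nat (Suc n) powr - s) = (\<lambda>n. if n = 0 then a 0 else 0)"
        using False by (auto simp: fun_eq_iff)
      ultimately show ?thesis using sums_single[of 0 "\<lambda>_. a 0"] sums_unique2 by metis
    qed
    then have "f (of_real (\<sigma> + 1)) = f (of_real (\<sigma> + 2))" by simp
    then have "(of_real (\<sigma> + 1) :: complex) = of_real (\<sigma> + 2)"
      by (rule inj_onD[OF inj]) auto
    then show False by (simp only: of_real_eq_iff)
  next
    case True
    define N where "N = (LEAST n. n \<ge> 1 \<and> a n \<noteq> 0)"
    have N: "N \<ge> 1" "a N \<noteq> 0" using LeastI_ex[OF True] by (auto simp: N_def)
    have before: "a n = 0" if "n \<ge> 1" "n < N" for n
      using not_less_Least[of n "\<lambda>n. n \<ge> 1 \<and> a n \<noteq> 0"] that by (auto simp: N_def)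
    define B where "B = (\<Sum>n. norm (a n) * real (Suc n) powr - \<sigma>)"
    have B: "B \<ge> 0" unfolding B_def using f by (intro suminf_nonneg) (auto simp: dirichlet_abs_def)
    define l where "l = ln (real (Suc N))"
    have l: "l > 0" using N by (simp add: l_def)
    define g where "g = (\<lambda>s. a N * of_nat (Suc N) powr - s :: complex)"
    \<comment> \<open>Translates of \<open>f\<close> without the constant term, rescaled so that the
      leading term becomes \<open>g\<close> again; the later frequencies are damped by powers of
      \<open>(N + 1) / (N + 2)\<close>.\<close>
    define F where "F = (\<lambda>j s. (f (s + of_nat j) - a 0) * of_nat (Suc N) powr of_nat j)"
    have g_exp: "g s = a N * exp (- (of_real l * s))" for s
      by (subst g_def, subst nat_powr_eq_exp) (auto simp: l_def)
    have close: "norm (F j s - g s) \<le> B * (real (Suc N) / real (Suc (Suc N))) ^ j" if s: "Re s > \<sigma>" for j s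
    proof -
      have "(\<Sum>n<Suc N. a n * of_nat (Suc n) powr - (s + of_nat j)) = (\<Sum>n\<in>{0, N}. a n * of_nat (Suc n) powr - (s + of_nat j))"
        by (rule sum.mono_neutral_right) (use before in auto)
      also have "\<dots> = a 0 + g (s + of_nat j)" using N by (auto simp: g_def)
      finally have "norm (f (s + of_nat j) - (a 0 + g (s + of_nat j))) \<le> B * real (Suc (Suc N)) powr (\<sigma> - Re (s + of_nat j))"
        using dirichlet_abs_tail[OF f, of "s + of_nat j" "Suc N"] s by (simp add: B_def)
      also have "\<dots> \<le> B * real (Suc (Suc N)) powr - real j"
        using s B by (intro mult_left_mono powr_mono) auto
      also have "\<dots> = B / real (Suc (Suc N)) ^ j" by (simp add: powr_minus powr_realpow divide_inverse)
      finally have 1: "norm (f (s + of_nat j) - (a 0 + g (s + of_nat j))) \<le> B / real (Suc (Suc N)) ^ j" .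
      have "g (s + of_nat j) * of_nat (Suc N) powr of_nat j = g s"
        unfolding g_def mult.assoc powr_add[symmetric] by simp
      then have "F j s - g s = (f (s + of_nat j) - (a 0 + g (s + of_nat j))) * of_nat (Suc N) powr of_nat j"
        by (simp add: F_def algebra_simps)
      then have "norm (F j s - g s) = norm (f (s + of_nat j) - (a 0 + g (s + of_nat j))) * real (Suc N) ^ j"
        by (simp add: norm_mult norm_power norm_nat_powr powr_realpow del: of_nat_Suc)
      also have "\<dots> \<le> B / real (Suc (Suc N)) ^ j * real (Suc N) ^ j"
        by (rule mult_right_mono[OF 1]) simp
      finally show ?thesis by (simp add: power_divide)
    qed
    have "inj_on g (half_plane \<sigma>)"
    \<comment> \<open>A non-constant locally uniform limit of injective holomorphic functions is
      injective, but \<open>g\<close> has the period \<open>2 * pi * \<i> / l\<close>.\<close>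
    proof (rule Hurwitz_injective[where \<F> = F])
      show "F j holomorphic_on half_plane \<sigma>" for j
        unfolding F_def
        by (intro holomorphic_intros holomorphic_on_compose_gen[OF _ hol, unfolded o_def]) auto
      show "g holomorphic_on half_plane \<sigma>"
        unfolding g_def by (intro holomorphic_intros)
      show "connected (half_plane \<sigma>)" by (simp add: convex_connected)
      show "inj_on (F j) (half_plane \<sigma>)" for j
      proof (rule inj_onI)
        fix x y assume xy: "x \<in> half_plane \<sigma>" "y \<in> half_plane \<sigma>" "F j x = F j y"
        then have "f (x + of_nat j) = f (y + of_nat j)" by (simp add: F_def del: of_nat_Suc)
        then have "x + of_nat j = y + of_nat j" by (rule inj_onD[OF inj]) (use xy in auto)
        then show "x = y" by simp
      qed
      show "\<not> g constant_on half_plane \<sigma>"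
      proof
        assume "g constant_on half_plane \<sigma>"
        then have "g (of_real (\<sigma> + 1)) = g (of_real (\<sigma> + 2))"
          unfolding constant_on_def by (metis Re_complex_of_real less_add_same_cancel1 mem_half_plane zero_less_numeral zero_less_one)
        then have "norm (exp (- (of_real l * of_real (\<sigma> + 1))) :: complex) = norm (exp (- (of_real l * of_real (\<sigma> + 2))) :: complex)"
          using N by (simp add: g_exp)
        then show False using l by simp
      qed
      fix K assume K: "compact K" "K \<subseteq> half_plane \<sigma>"
      show "uniform_limit K F g sequentially"
      proof (rule uniform_limitI)
        fix e :: real assume "e > 0"
        have "(\<lambda>j. B * (real (Suc N) / real (Suc (Suc N))) ^ j) \<longlonglongrightarrow> B * 0"
          by (intro tendsto_mult tendsto_const LIMSEQ_power_zero) simp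
        then have "\<forall>\<^sub>F j in sequentially. B * (real (Suc N) / real (Suc (Suc N))) ^ j < e"
          using \<open>e > 0\<close> by (intro order_tendstoD(2)) auto
        then show "\<forall>\<^sub>F j in sequentially. \<forall>x\<in>K. dist (F j x) (g x) < e"
        proof eventually_elim
          case (elim j)
          show ?case
          proof
            fix x assume "x \<in> K"
            then have "Re x > \<sigma>" using K by auto
            from close[OF this, of j] elim show "dist (F j x) (g x) < e" by (simp only: dist_norm)
          qed
        qed
      qed
    qed auto
    moreover have "g (of_real (\<sigma> + 1)) = g (of_real (\<sigma> + 1) + 2 * pi * \<i> / of_real l)"
    proof -
      have "- (of_real l * (of_real (\<sigma> + 1) + 2 * pi * \<i> / of_real l)) = - (of_real l * of_real (\<sigma> + 1)) - 2 * of_real pi * \<i>"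
        using l by (simp add: field_simps)
      then show ?thesis by (simp only: g_exp exp_diff exp_two_pi_i div_by_1)
    qed
    ultimately have "(of_real (\<sigma> + 1) :: complex) = of_real (\<sigma> + 1) + 2 * pi * \<i> / of_real l"
      by (rule inj_onD) auto
    then show False using l by simp
  qed
qed

section \<open>Bohr's theorem on bounded Dirichlet series\<close>

text \<open>Perron's integral cut off at height \<open>T\<close>, without the factor
  \<open>1 / (2 * pi * \<i>)\<close>.\<close>

definition vline_integral :: "(complex \<Rightarrow> complex) \<Rightarrow> real \<Rightarrow> real \<Rightarrow> complex" where
  "vline_integral G T x = contour_integral (linepath (Complex x (- T)) (Complex x T)) (\<lambda>w. G w / w)"

text \<open>The vertical sides of the rectangle differ by the closed contour integral and the two
  horizontal sides, where \<open>|w| \<ge> T\<close>.\<close>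

lemma vline_diff_bound:
  assumes x: "x1 < x2" and T: "T > 0"
    and c: "((\<lambda>w. G w / w) has_contour_integral c) (rectpath (Complex x1 (- T)) (Complex x2 T))"
    and H: "\<And>w. \<bar>Im w\<bar> = T \<Longrightarrow> x1 \<le> Re w \<Longrightarrow> Re w \<le> x2 \<Longrightarrow> norm (G w) \<le> H"
  shows "norm (vline_integral G T x2 - vline_integral G T x1 - c) \<le> 2 * (x2 - x1) * H / T"
proof -
  let ?f = "\<lambda>w. G w / w"
  let ?a1 = "Complex x1 (- T)" and ?a2 = "Complex x2 (- T)" and ?a3 = "Complex x2 T" and ?a4 = "Complex x1 T"
  have rect: "rectpath ?a1 ?a3 = linepath ?a1 ?a2 +++ linepath ?a2 ?a3 +++ linepath ?a3 ?a4 +++ linepath ?a4 ?a1"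
    by (simp add: rectpath_def Let_def)
  have "?f contour_integrable_on (rectpath ?a1 ?a3)" using c by (auto simp: contour_integrable_on_def)
  then have i: "?f contour_integrable_on linepath ?a1 ?a2" "?f contour_integrable_on linepath ?a2 ?a3"
      "?f contour_integrable_on linepath ?a3 ?a4" "?f contour_integrable_on linepath ?a4 ?a1"
    unfolding rect by (auto simp: contour_integrable_join)
  have "c = contour_integral (rectpath ?a1 ?a3) ?f" using c by (simp add: contour_integral_unique)
  also have "\<dots> = contour_integral (linepath ?a1 ?a2) ?f + contour_integral (linepath ?a2 ?a3) ?f
      + contour_integral (linepath ?a3 ?a4) ?f + contour_integral (linepath ?a4 ?a1) ?f"
    unfolding rect using i by (simp add: contour_integrable_join)
  also have "contour_integral (linepath ?a4 ?a1) ?f = - vline_integral G T x1"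
    using contour_integral_reversepath[of "linepath ?a1 ?a4" ?f] by (simp add: vline_integral_def)
  finally have "vline_integral G T x2 - vline_integral G T x1 - c
      = - (contour_integral (linepath ?a1 ?a2) ?f + contour_integral (linepath ?a3 ?a4) ?f)"
    unfolding vline_integral_def by (simp add: algebra_simps)
  then have "norm (vline_integral G T x2 - vline_integral G T x1 - c)
      = norm (contour_integral (linepath ?a1 ?a2) ?f + contour_integral (linepath ?a3 ?a4) ?f)"
    by (simp only: norm_minus_cancel)
  also have "\<dots> \<le> norm (contour_integral (linepath ?a1 ?a2) ?f) + norm (contour_integral (linepath ?a3 ?a4) ?f)"
    by (rule norm_triangle_ineq)
  also have "\<dots> \<le> (H / T * norm (?a2 - ?a1)) + (H / T * norm (?a4 - ?a3))"
  proof -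
    have H0: "H \<ge> 0" using order_trans[OF norm_ge_zero H[of ?a1]] x T by simp
    have b: "norm (?f w) \<le> H / T" if "\<bar>Im w\<bar> = T" "x1 \<le> Re w" "Re w \<le> x2" for w
    proof -
      have "T \<le> norm w" using abs_Im_le_cmod[of w] that by simp
      then show ?thesis unfolding norm_divide using H[OF that] T H0 by (intro frac_le) auto
    qed
    show ?thesis
      by (intro add_mono contour_integral_bound_linepath i b)
         (use x T H0 in \<open>auto simp: closed_segment_same_Im closed_segment_eq_real_ivl\<close>)
  qed
  also have "norm (?a2 - ?a1) = x2 - x1" using x by (simp add: cmod_def)
  also have "norm (?a4 - ?a3) = x2 - x1" using x by (simp add: cmod_def)
  finally show ?thesis by (simp add: algebra_simps)
qed

text \<open>The crude estimate \<open>|w| \<ge> |x|\<close> suffices on remote lines, where the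
  integrands of Bohr's theorem are exponentially small.\<close>

lemma vline_bound:
  assumes "x \<noteq> 0" "T > 0" "H \<ge> 0" and cont: "continuous_on {w. Re w = x} G"
    and H: "\<And>w. Re w = x \<Longrightarrow> norm (G w) \<le> H"
  shows "norm (vline_integral G T x) \<le> H * (2 * T) / \<bar>x\<bar>"
proof -
  have seg: "Re w = x" if "w \<in> closed_segment (Complex x (- T)) (Complex x T)" for w
    using that by (auto simp: closed_segment_same_Re)
  have "norm (vline_integral G T x) \<le> H / \<bar>x\<bar> * norm (Complex x T - Complex x (- T))"
    unfolding vline_integral_def
  proof (rule contour_integral_bound_linepath)
    show "(\<lambda>w. G w / w) contour_integrable_on linepath (Complex x (- T)) (Complex x T)"
      by (intro contour_integrable_continuous_linepath continuous_intros continuous_on_subset[OF cont])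
         (use seg assms(1) in fastforce)+
    show "norm (G w / w) \<le> H / \<bar>x\<bar>" if "w \<in> closed_segment (Complex x (- T)) (Complex x T)" for w
      unfolding norm_divide using abs_Re_le_cmod[of w] seg[OF that] H assms
      by (intro frac_le) auto
  qed (use assms in auto)
  also have "norm (Complex x T - Complex x (- T)) = 2 * T"
    using assms by (simp add: complex_diff complex_norm real_sqrt_mult)
  finally show ?thesis by simp
qed

text \<open>On a fixed line near 0 the crude estimate would cost a factor \<open>T\<close>. Since
  \<open>|w| \<ge> (\<alpha> + |t|) / 2\<close> there, the loss is only logarithmic, and a small
  negative power of \<open>x\<close> in \<open>H\<close> absorbs it although \<open>T\<close> is a
  large power of \<open>x\<close>.\<close>

lemma vline_log_bound:
  assumes \<alpha>: "\<alpha> > 0" "T > 0" "H \<ge> 0" and cont: "continuous_on {w. Re w = - \<alpha>} G"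
    and H: "\<And>w. Re w = - \<alpha> \<Longrightarrow> norm (G w) \<le> H"
  shows "norm (vline_integral G T (- \<alpha>)) \<le> 4 * H * ln (1 + T / \<alpha>)"
proof -
  define h where "h = (\<lambda>t. H * (2 / (\<alpha> + \<bar>t\<bar>)))"
  have p: "((\<lambda>t. 2 / (\<alpha> + \<bar>t\<bar>)) has_integral (2 * ln (\<alpha> + T) - 2 * ln (\<alpha> + 0))) {0..T}"
  proof (rule has_integral_eq[rotated])
    show "((\<lambda>t. 2 / (\<alpha> + t)) has_integral (2 * ln (\<alpha> + T) - 2 * ln (\<alpha> + 0))) {0..T}"
      by (rule fundamental_theorem_of_calculus)
         (use \<alpha> in \<open>auto intro!: derivative_eq_intros simp: has_real_derivative_iff_has_vector_derivative[symmetric]\<close>)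
  qed auto
  have m: "((\<lambda>t. 2 / (\<alpha> + \<bar>t\<bar>)) has_integral (- (2 * ln (\<alpha> - 0)) - - (2 * ln (\<alpha> - - T)))) {-T..0}"
  proof (rule has_integral_eq[rotated])
    show "((\<lambda>t. 2 / (\<alpha> - t)) has_integral (- (2 * ln (\<alpha> - 0)) - - (2 * ln (\<alpha> - - T)))) {-T..0}"
      by (rule fundamental_theorem_of_calculus)
         (use \<alpha> in \<open>auto intro!: derivative_eq_intros simp: has_real_derivative_iff_has_vector_derivative[symmetric]\<close>)
  qed auto
  have "((\<lambda>t. 2 / (\<alpha> + \<bar>t\<bar>)) has_integral (- (2 * ln (\<alpha> - 0)) - - (2 * ln (\<alpha> - - T)) + (2 * ln (\<alpha> + T) - 2 * ln (\<alpha> + 0)))) {-T..T}"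
    by (rule has_integral_combine[OF _ _ m p]) (use \<alpha> in auto)
  also have "- (2 * ln (\<alpha> - 0)) - - (2 * ln (\<alpha> - - T)) + (2 * ln (\<alpha> + T) - 2 * ln (\<alpha> + 0)) = 4 * ln (1 + T / \<alpha>)"
  proof -
    have "ln (1 + T / \<alpha>) = ln ((\<alpha> + T) / \<alpha>)" using \<alpha> by (simp add: field_simps)
    also have "\<dots> = ln (\<alpha> + T) - ln \<alpha>" using \<alpha> by (simp add: ln_div)
    finally show ?thesis by simp
  qed
  finally have h: "(h has_integral (H * (4 * ln (1 + T / \<alpha>)))) {-T..T}"
    unfolding h_def by (rule has_integral_mult_right)
  have seg: "Re w = - \<alpha>" if "w \<in> closed_segment (Complex (- \<alpha>) (- T)) (Complex (- \<alpha>) T)" for w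
    using that by (auto simp: closed_segment_same_Re)
  have "(\<lambda>w. G w / w) contour_integrable_on linepath (Complex (- \<alpha>) (- T)) (Complex (- \<alpha>) T)"
    by (intro contour_integrable_continuous_linepath continuous_intros continuous_on_subset[OF cont])
       (use seg \<alpha> in fastforce)+
  then have "((\<lambda>w. G w / w) has_contour_integral vline_integral G T (- \<alpha>)) (linepath (Complex (- \<alpha>) (- T)) (Complex (- \<alpha>) T))"
    unfolding vline_integral_def by (rule has_contour_integral_integral)
  then have g: "((\<lambda>t. G (Complex (- \<alpha>) t) / Complex (- \<alpha>) t) has_integral (- \<i> * vline_integral G T (- \<alpha>))) {-T..T}"
    by (subst (asm) has_contour_integral_linepath_same_Re_iff) (use \<alpha> in auto)
  have "norm (- \<i> * vline_integral G T (- \<alpha>)) \<le> H * (4 * ln (1 + T / \<alpha>))"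
  proof -
    have "norm (G (Complex (- \<alpha>) t) / Complex (- \<alpha>) t) \<le> h t" for t
    proof -
      have "\<alpha> \<le> norm (Complex (- \<alpha>) t)" "\<bar>t\<bar> \<le> norm (Complex (- \<alpha>) t)"
        using abs_Re_le_cmod[of "Complex (- \<alpha>) t"] abs_Im_le_cmod[of "Complex (- \<alpha>) t"] \<alpha> by auto
      then have "norm (G (Complex (- \<alpha>) t)) / norm (Complex (- \<alpha>) t) \<le> H / ((\<alpha> + \<bar>t\<bar>) / 2)"
        using \<alpha> H by (intro frac_le) auto
      then show ?thesis by (simp add: h_def norm_divide)
    qed
    then show ?thesis
      using has_integral_norm_bound_integral_component[OF g h, of 1] by simp
  qed
  then show ?thesis by (simp add: norm_mult mult_ac)
qed

lemma real_powr_eq_exp: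
  assumes "x > 0"
  shows "norm (exp (of_real (ln x) * w)) = x powr Re w"
  using assms by (simp add: powr_def mult.commute)

lemma has_contour_integral_rectpath_pole:
  assumes "x1 < 0" "0 < x2" "T > 0" "G holomorphic_on half_plane y" "y < x1"
  shows "((\<lambda>w. G w / w) has_contour_integral (2 * pi * \<i> * G 0)) (rectpath (Complex x1 (- T)) (Complex x2 T))"
proof -
  have box: "0 \<in> box (Complex x1 (- T)) (Complex x2 T)"
    using assms by (simp add: in_box_complex_iff)
  have img: "path_image (rectpath (Complex x1 (- T)) (Complex x2 T)) \<subseteq> half_plane y - {0}"
    using assms by (subst path_image_rectpath) auto
  have "((\<lambda>w. G w / (w - 0)) has_contour_integral
      (2 * pi * \<i> * winding_number (rectpath (Complex x1 (- T)) (Complex x2 T)) 0 * G 0))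
      (rectpath (Complex x1 (- T)) (Complex x2 T))"
    by (rule Cauchy_integral_formula_convex_simple[OF _ assms(4)])
       (use assms img in \<open>auto simp: interior_open\<close>)
  then show ?thesis using winding_number_rectpath[OF box] by simp
qed

lemma has_contour_integral_rectpath_no_pole:
  assumes "0 < y" "y < x1" "x1 \<le> x2" "T > 0" "G holomorphic_on half_plane y"
  shows "((\<lambda>w. G w / w) has_contour_integral 0) (rectpath (Complex x1 (- T)) (Complex x2 T))"
proof (rule Cauchy_theorem_convex_simple[of _ "half_plane y"])
  show "(\<lambda>w. G w / w) holomorphic_on half_plane y"
    by (intro holomorphic_intros assms(5)) (use assms(1) in auto)
  show "path_image (rectpath (Complex x1 (- T)) (Complex x2 T)) \<subseteq> half_plane y"
    using assms by (subst path_image_rectpath) auto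
qed auto

text \<open>Perron's formula for \<open>F\<close>, for its partial sum and for the tail on the line \<open>Re w = \<kappa>\<close>; the three
  integrals are moved to the left (\<open>F\<close>), to the far left (partial sum) and to the far right (tail).\<close>

lemma bohr_at_zero:
  assumes e: "e > 0" and hol: "F holomorphic_on half_plane (- e)"
    and B: "\<And>w. Re w \<ge> - e / 2 \<Longrightarrow> norm (F w) \<le> B"
    and \<kappa>: "\<kappa> > 1" and b: "dirichlet_abs b (\<kappa> - 1) F"
  shows "b sums F 0"
proof -
  define \<alpha> where "\<alpha> = e / 2"
  have \<alpha>: "\<alpha> > 0" using e by (simp add: \<alpha>_def)
  have B0: "B \<ge> 0" using order_trans[OF norm_ge_zero B[of 0]] e by simp
  have b\<kappa>: "dirichlet_abs b \<kappa> F" by (rule dirichlet_abs_mono[OF b]) simp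
  define A where "A = (\<Sum>n. norm (b n) * real (Suc n) powr - \<kappa>)"
  have bs: "summable (\<lambda>n. norm (b n) * real (Suc n) powr - \<kappa>)"
    using b\<kappa> by (simp add: dirichlet_abs_def)
  have A0: "A \<ge> 0" unfolding A_def by (intro suminf_nonneg bs) auto
  \<comment> \<open>The six error terms as functions of \<open>y = N\<close>: \<open>t1\<close>,
    \<open>t3\<close>, \<open>t5\<close> come from horizontal sides, \<open>t2\<close>,
    \<open>t4\<close>, \<open>t6\<close> from the shifted vertical lines.\<close>
  define t1 where "t1 = (\<lambda>y::real. (y + 1/2) powr \<kappa> / (y + 1/2) powr (\<kappa> + 3))"
  define t2 where "t2 = (\<lambda>y::real. (y + 1/2) powr - \<alpha> * ln (1 + (y + 1/2) powr (\<kappa> + 3) / \<alpha>))"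
  define t3 where "t3 = (\<lambda>y::real. (\<kappa> + y^2) * ((y + 1/2) powr \<kappa> / (y + 1/2) powr (\<kappa> + 3)))"
  define t4 where "t4 = (\<lambda>y::real. (y + 1/2) powr \<kappa> * ((y + 1/2) / y) powr (- (y^2) - \<kappa>) * (y + 1/2) powr (\<kappa> + 3) / y^2)"
  define t5 where "t5 = (\<lambda>y::real. y^2 * ((y + 1/2) powr \<kappa> / (y + 1/2) powr (\<kappa> + 3)))"
  define t6 where "t6 = (\<lambda>y::real. (y + 1/2) powr \<kappa> * ((y + 1/2) / (y + 1)) powr (y^2) * (y + 1/2) powr (\<kappa> + 3) / (\<kappa> + y^2))"
  define E where "E = (\<lambda>y. 2 * (\<kappa> + \<alpha>) * B * t1 y + 4 * B * t2 y + (2 * A * t3 y + 2 * A * t4 y) + (2 * A * t5 y + 2 * A * t6 y))"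
  have main: "norm (2 * pi * \<i> * ((\<Sum>n<N. b n) - F 0)) \<le> E (real N)" if N: "N \<ge> 1" for N
  proof -
    \<comment> \<open>\<open>x\<close> lies midway between the frequencies \<open>N\<close> and
      \<open>N + 1\<close>, so \<open>x / N\<close> and \<open>x / (N + 1)\<close> differ from 1 by
      about \<open>1 / (2 * N)\<close>, and their powers with exponents near \<open>- X\<close> and
      \<open>X\<close> decay roughly like \<open>exp (- N / 2)\<close>. The exponent
      \<open>\<kappa> + 3\<close> makes \<open>T\<close> outweigh \<open>X * x powr \<kappa>\<close>
      on the horizontal sides.\<close>
    define x where "x = real N + 1 / 2"
    define T where "T = x powr (\<kappa> + 3)"
    define X where "X = (real N)\<^sup>2"
    have x: "x > 1" "x > 0" using N by (auto simp: x_def)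
    have T: "T > 0" using x by (simp add: T_def)
    have X: "X > 0" using N by (simp add: X_def)
    define u where "u = (\<lambda>w::complex. exp (of_real (ln x) * w))"
    have u: "norm (u w) = x powr Re w" for w :: complex unfolding u_def using real_powr_eq_exp[OF x(2)] .
    have [simp]: "u 0 = 1" by (simp add: u_def)
    have holu: "u holomorphic_on Z" for Z unfolding u_def by (intro holomorphic_intros)
    define S where "S = (\<lambda>w::complex. \<Sum>n<N. b n * of_nat (Suc n) powr - w)"
    have holS: "S holomorphic_on Z" for Z unfolding S_def by (intro holomorphic_intros)
    define GF where "GF = (\<lambda>w. F w * u w)"
    define GS where "GS = (\<lambda>w. S w * u w)"
    define Gr where "Gr = (\<lambda>w. (F w - S w) * u w)"
    have hF: "GF holomorphic_on half_plane (- e)" unfolding GF_def by (intro holomorphic_intros hol holu)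
    have hS: "GS holomorphic_on half_plane z" for z unfolding GS_def by (intro holomorphic_intros holS holu)
    have hr: "Gr holomorphic_on half_plane (- e)" unfolding Gr_def by (intro holomorphic_intros hol holS holu)
    \<comment> \<open>The tail is moved to the right only, inside a half-plane that avoids the pole
      at 0.\<close>
    have hr1: "Gr holomorphic_on half_plane (\<kappa> / 2)"
      by (rule holomorphic_on_subset[OF hr half_plane_mono]) (use \<kappa> e in auto)
    have cF: "continuous_on {w. Re w = z} GF" if "z > - e" for z :: real
      by (rule holomorphic_on_imp_continuous_on[OF holomorphic_on_subset[OF hF]]) (use that in auto)
    have cS: "continuous_on Z GS" for Z
      unfolding GS_def by (rule holomorphic_on_imp_continuous_on) (intro holomorphic_intros holS holu)
    have cr: "continuous_on {w. Re w = z} Gr" if "z > - e" for z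
      by (rule holomorphic_on_imp_continuous_on[OF holomorphic_on_subset[OF hr]]) (use that in auto)
    have bF: "norm (GF w) \<le> B * x powr Re w" if "Re w \<ge> - \<alpha>" for w
      using B[of w] that by (simp add: GF_def norm_mult u \<alpha>_def mult_right_mono)
    have bS: "norm (GS w) \<le> A * x powr \<kappa> * (x / real N) powr (Re w - \<kappa>)" if w: "Re w \<le> \<kappa>" for w
    proof -
      have "norm (S w) \<le> (\<Sum>n<N. norm (b n) * real (Suc n) powr - Re w)"
        unfolding S_def by (rule sum_norm_le) (simp add: norm_mult norm_nat_powr del: of_nat_Suc)
      also have "\<dots> \<le> (\<Sum>n<N. norm (b n) * real (Suc n) powr - \<kappa> * real N powr (\<kappa> - Re w))"
      proof (rule sum_mono)
        fix n assume "n \<in> {..<N}"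
        then have "real (Suc n) powr (\<kappa> - Re w) \<le> real N powr (\<kappa> - Re w)"
          using w by (intro powr_mono2) auto
        moreover have "real (Suc n) powr - Re w = real (Suc n) powr - \<kappa> * real (Suc n) powr (\<kappa> - Re w)"
          by (simp add: powr_add[symmetric] del: of_nat_Suc)
        ultimately show "norm (b n) * real (Suc n) powr - Re w \<le> norm (b n) * real (Suc n) powr - \<kappa> * real N powr (\<kappa> - Re w)"
          by (simp add: mult.assoc mult_left_mono del: of_nat_Suc)
      qed
      also have "\<dots> \<le> A * real N powr (\<kappa> - Re w)"
        unfolding A_def sum_distrib_right[symmetric] by (intro mult_right_mono sum_le_suminf bs) auto
      finally have "norm (S w) \<le> A * real N powr (\<kappa> - Re w)" .
      then have "norm (GS w) \<le> A * real N powr (\<kappa> - Re w) * x powr Re w"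
        by (simp add: GS_def norm_mult u mult_right_mono)
      also have "\<dots> = A * x powr \<kappa> * (x / real N) powr (Re w - \<kappa>)"
        using x N by (simp add: powr_divide powr_diff)
      finally show ?thesis .
    qed
    have br: "norm (Gr w) \<le> A * x powr \<kappa> * (x / (real N + 1)) powr (Re w - \<kappa>)" if w: "Re w \<ge> \<kappa>" for w
    proof -
      have "norm (F w - S w) \<le> A * real (Suc N) powr (\<kappa> - Re w)"
        unfolding S_def A_def by (rule dirichlet_abs_tail[OF b\<kappa> w])
      then have "norm (Gr w) \<le> A * real (Suc N) powr (\<kappa> - Re w) * x powr Re w"
        by (simp add: Gr_def norm_mult u mult_right_mono)
      also have "\<dots> = A * x powr \<kappa> * (x / (real N + 1)) powr (Re w - \<kappa>)"
        using x by (simp add: powr_divide powr_diff add.commute)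
      finally show ?thesis .
    qed
    have "norm (vline_integral GF T \<kappa> - vline_integral GF T (- \<alpha>) - 2 * pi * \<i> * GF 0) \<le> 2 * (\<kappa> - (- \<alpha>)) * (B * x powr \<kappa>) / T"
    proof (rule vline_diff_bound)
      show "((\<lambda>w. GF w / w) has_contour_integral (2 * pi * \<i> * GF 0)) (rectpath (Complex (- \<alpha>) (- T)) (Complex \<kappa> T))"
        by (rule has_contour_integral_rectpath_pole[OF _ _ _ hF]) (use \<alpha> \<kappa> T e in \<open>auto simp: \<alpha>_def\<close>)
      show "norm (GF w) \<le> B * x powr \<kappa>" if "- \<alpha> \<le> Re w" "Re w \<le> \<kappa>" for w
        using bF[OF that(1)] mult_left_mono[OF powr_mono[OF that(2), of x] B0] x by linarith
    qed (use \<alpha> \<kappa> T in auto)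
    moreover have "norm (vline_integral GF T (- \<alpha>)) \<le> 4 * (B * x powr - \<alpha>) * ln (1 + T / \<alpha>)"
    proof (rule vline_log_bound[OF \<alpha> T _ cF])
      show "norm (GF w) \<le> B * x powr - \<alpha>" if "Re w = - \<alpha>" for w
        using bF[of w] that by simp
    qed (use e B0 in \<open>auto simp: \<alpha>_def\<close>)
    ultimately have 1: "norm (vline_integral GF T \<kappa> - 2 * pi * \<i> * F 0)
        \<le> 2 * (\<kappa> + \<alpha>) * (B * x powr \<kappa>) / T + 4 * (B * x powr - \<alpha>) * ln (1 + T / \<alpha>)"
      using norm_triangle_ineq[of "vline_integral GF T \<kappa> - vline_integral GF T (- \<alpha>) - 2 * pi * \<i> * GF 0" "vline_integral GF T (- \<alpha>)"]
      by (simp add: GF_def)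
    have "norm (vline_integral GS T \<kappa> - vline_integral GS T (- X) - 2 * pi * \<i> * GS 0) \<le> 2 * (\<kappa> - (- X)) * (A * x powr \<kappa>) / T"
    proof (rule vline_diff_bound)
      show "((\<lambda>w. GS w / w) has_contour_integral (2 * pi * \<i> * GS 0)) (rectpath (Complex (- X) (- T)) (Complex \<kappa> T))"
        by (rule has_contour_integral_rectpath_pole[OF _ _ _ hS[of "- X - 1"]]) (use X \<kappa> T in auto)
      show "norm (GS w) \<le> A * x powr \<kappa>" if "Re w \<le> \<kappa>" for w
      proof -
        have "(x / real N) powr (Re w - \<kappa>) \<le> (x / real N) powr 0"
          using that N by (intro powr_mono) (auto simp: x_def)
        then have "A * x powr \<kappa> * (x / real N) powr (Re w - \<kappa>) \<le> A * x powr \<kappa> * 1"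
          using A0 x N by (intro mult_left_mono) auto
        then show ?thesis using bS[OF that] by simp
      qed
    qed (use X \<kappa> T in auto)
    moreover have "norm (vline_integral GS T (- X)) \<le> A * x powr \<kappa> * (x / real N) powr (- X - \<kappa>) * (2 * T) / \<bar>- X\<bar>"
    proof (rule vline_bound[OF _ T _ cS])
      show "norm (GS w) \<le> A * x powr \<kappa> * (x / real N) powr (- X - \<kappa>)" if "Re w = - X" for w
        using bS[of w] that X \<kappa> by simp
    qed (use X A0 in auto)
    ultimately have 2: "norm (vline_integral GS T \<kappa> - 2 * pi * \<i> * S 0)
        \<le> 2 * (\<kappa> + X) * (A * x powr \<kappa>) / T + A * x powr \<kappa> * (x / real N) powr (- X - \<kappa>) * (2 * T) / X"
      using X norm_triangle_ineq[of "vline_integral GS T \<kappa> - vline_integral GS T (- X) - 2 * pi * \<i> * GS 0" "vline_integral GS T (- X)"]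
      by (simp add: GS_def)
    have "norm (vline_integral Gr T (\<kappa> + X) - vline_integral Gr T \<kappa> - 0) \<le> 2 * (\<kappa> + X - \<kappa>) * (A * x powr \<kappa>) / T"
    proof (rule vline_diff_bound)
      show "((\<lambda>w. Gr w / w) has_contour_integral 0) (rectpath (Complex \<kappa> (- T)) (Complex (\<kappa> + X) T))"
        by (rule has_contour_integral_rectpath_no_pole[OF _ _ _ _ hr1]) (use X \<kappa> T in auto)
      show "norm (Gr w) \<le> A * x powr \<kappa>" if "\<kappa> \<le> Re w" for w
      proof -
        have "(x / (real N + 1)) powr (Re w - \<kappa>) \<le> 1"
          using that x by (intro powr_le1) (auto simp: x_def)
        then have "A * x powr \<kappa> * (x / (real N + 1)) powr (Re w - \<kappa>) \<le> A * x powr \<kappa> * 1"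
          using A0 x by (intro mult_left_mono) auto
        then show ?thesis using br[OF that] by simp
      qed
    qed (use X \<kappa> T in auto)
    moreover have "norm (vline_integral Gr T (\<kappa> + X)) \<le> A * x powr \<kappa> * (x / (real N + 1)) powr X * (2 * T) / \<bar>\<kappa> + X\<bar>"
    proof (rule vline_bound[OF _ T _ cr])
      show "norm (Gr w) \<le> A * x powr \<kappa> * (x / (real N + 1)) powr X" if "Re w = \<kappa> + X" for w
        using br[of w] that X \<kappa> by simp
    qed (use X A0 \<kappa> e in auto)
    ultimately have 3: "norm (vline_integral Gr T \<kappa>)
        \<le> 2 * X * (A * x powr \<kappa>) / T + A * x powr \<kappa> * (x / (real N + 1)) powr X * (2 * T) / (\<kappa> + X)"
      using X \<kappa> norm_triangle_ineq4[of "vline_integral Gr T (\<kappa> + X)" "vline_integral Gr T (\<kappa> + X) - vline_integral Gr T \<kappa>"]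
      by simp
    have "vline_integral GF T \<kappa> = vline_integral GS T \<kappa> + vline_integral Gr T \<kappa>"
    proof -
      have seg: "closed_segment (Complex \<kappa> (- T)) (Complex \<kappa> T) \<subseteq> {w. Re w = \<kappa>} - {0}"
        using \<kappa> by (auto simp: closed_segment_same_Re)
      have "vline_integral (\<lambda>w. GS w + Gr w) T \<kappa> = vline_integral GS T \<kappa> + vline_integral Gr T \<kappa>"
        unfolding vline_integral_def add_divide_distrib
        by (intro contour_integral_add contour_integrable_continuous_linepath continuous_intros
            continuous_on_subset[OF cS] continuous_on_subset[OF cr[of \<kappa>]]) (use seg \<kappa> e in auto)
      moreover have "(\<lambda>w. GS w + Gr w) = GF" by (simp add: GS_def Gr_def GF_def fun_eq_iff algebra_simps)
      ultimately show ?thesis by simp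
    qed
    then have "2 * pi * \<i> * (S 0 - F 0) = (vline_integral GF T \<kappa> - 2 * pi * \<i> * F 0) - (vline_integral GS T \<kappa> - 2 * pi * \<i> * S 0) - vline_integral Gr T \<kappa>"
      by (simp add: algebra_simps)
    then have "norm (2 * pi * \<i> * (S 0 - F 0)) \<le> norm (vline_integral GF T \<kappa> - 2 * pi * \<i> * F 0)
        + norm (vline_integral GS T \<kappa> - 2 * pi * \<i> * S 0) + norm (vline_integral Gr T \<kappa>)"
      by (smt (verit) norm_triangle_ineq4)
    also have "\<dots> \<le> E (real N)"
    proof -
      have "E (real N) = 2 * (\<kappa> + \<alpha>) * (B * x powr \<kappa>) / T + 4 * (B * x powr - \<alpha>) * ln (1 + T / \<alpha>)
        + (2 * (\<kappa> + X) * (A * x powr \<kappa>) / T + A * x powr \<kappa> * (x / real N) powr (- X - \<kappa>) * (2 * T) / X)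
        + (2 * X * (A * x powr \<kappa>) / T + A * x powr \<kappa> * (x / (real N + 1)) powr X * (2 * T) / (\<kappa> + X))"
        unfolding E_def t1_def t2_def t3_def t4_def t5_def t6_def T_def X_def x_def
        by (simp only: times_divide_eq_right mult_ac)
      then show ?thesis using 1 2 3 by linarith
    qed
    also have "S 0 = (\<Sum>n<N. b n)" by (simp add: S_def del: of_nat_Suc)
    finally show ?thesis .
  qed
  have "(t1 \<longlongrightarrow> 0) at_top" "(t2 \<longlongrightarrow> 0) at_top" "(t3 \<longlongrightarrow> 0) at_top"
      "(t4 \<longlongrightarrow> 0) at_top" "(t5 \<longlongrightarrow> 0) at_top" "(t6 \<longlongrightarrow> 0) at_top"
    unfolding t1_def t2_def t3_def t4_def t5_def t6_def using \<alpha> \<kappa> by real_asymp+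
  then have "(E \<longlongrightarrow> 0) at_top"
    unfolding E_def by (intro tendsto_add_zero tendsto_mult_right_zero)
  then have "(\<lambda>N. E (real N)) \<longlonglongrightarrow> 0"
    by (rule filterlim_compose) (rule filterlim_real_sequentially)
  then have "(\<lambda>N. 2 * pi * \<i> * ((\<Sum>n<N. b n) - F 0)) \<longlonglongrightarrow> 0"
    by (rule Lim_null_comparison[rotated]) (use main in \<open>auto simp: eventually_sequentially\<close>)
  then have "(\<lambda>N. (2 * pi * \<i> * ((\<Sum>n<N. b n) - F 0)) / (2 * pi * \<i>) + F 0) \<longlonglongrightarrow> 0 / (2 * pi * \<i>) + F 0"
    by (intro tendsto_intros) auto
  then show ?thesis by (simp add: sums_def)
qed

text \<open>Convergence at \<open>s\<close> is convergence at 0 of the translated series with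
  coefficients \<open>a n * n powr - s\<close>; for each \<open>s\<close> the bound is taken on
  \<open>Re w \<ge> Re s / 2\<close>.\<close>

theorem bohr:
  assumes hol: "f holomorphic_on \<complex>\<^sub>+"
    and bdd: "\<And>\<delta>. \<delta> > 0 \<Longrightarrow> \<exists>B. \<forall>s. Re s \<ge> \<delta> \<longrightarrow> norm (f s) \<le> B"
    and a: "dirichlet_sums_on a f (half_plane \<theta>)"
  shows "dirichlet_sums_on a f \<complex>\<^sub>+"
  unfolding dirichlet_sums_on_def
proof
  fix s assume s: "s \<in> \<complex>\<^sub>+"
  define e where "e = Re s"
  have e: "e > 0" using s by (simp add: e_def)
  \<comment> \<open>Absolute convergence is known at \<open>\<theta> + 3\<close>, while
    \<open>bohr_at_zero\<close> asks for it at \<open>\<kappa> - 1\<close>.\<close>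
  define \<kappa> where "\<kappa> = max 0 \<theta> + 4"
  define b where "b = (\<lambda>n. a (Suc n) * of_nat (Suc n) powr - s)"
  obtain B where B: "\<And>w. Re w \<ge> e / 2 \<Longrightarrow> norm (f w) \<le> B" using bdd[of "e / 2"] e by auto
  have "b sums f (s + 0)"
  proof (rule bohr_at_zero[OF e])
    show "(\<lambda>w. f (s + w)) holomorphic_on half_plane (- e)"
      by (intro holomorphic_on_compose_gen[OF _ hol, unfolded o_def] holomorphic_intros) (auto simp: e_def)
    show "norm (f (s + w)) \<le> B" if "Re w \<ge> - e / 2" for w
      using that by (intro B) (simp add: e_def)
    show "\<kappa> > 1" by (simp add: \<kappa>_def)
    have abs: "dirichlet_abs (\<lambda>n. a (Suc n)) (\<kappa> - 1) f"
      by (rule dirichlet_abs_mono[OF dirichlet_sums_on_imp_abs[OF a]]) (simp add: \<kappa>_def)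
    show "dirichlet_abs b (\<kappa> - 1) (\<lambda>w. f (s + w))"
      unfolding dirichlet_abs_def
    proof (intro conjI allI impI)
      have "summable (\<lambda>n. norm (a (Suc n)) * real (Suc n) powr - (\<kappa> - 1 + e))"
        by (rule dirichlet_abs_summable_mono[OF abs]) (use e in auto)
      moreover have "norm (a (Suc n)) * real (Suc n) powr - (\<kappa> - 1 + e) = norm (b n) * real (Suc n) powr - (\<kappa> - 1)" for n
        by (simp add: b_def norm_mult norm_nat_powr mult.assoc powr_add[symmetric] e_def algebra_simps del: of_nat_Suc)
      ultimately show "summable (\<lambda>n. norm (b n) * real (Suc n) powr - (\<kappa> - 1))" by (simp only:)
      fix w assume "\<kappa> - 1 \<le> Re w"
      then have "(\<lambda>n. a (Suc n) * of_nat (Suc n) powr - (s + w)) sums f (s + w)"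
        using abs s unfolding dirichlet_abs_def by (elim conjE allE[of _ "s + w"]) simp
      moreover have "a (Suc n) * of_nat (Suc n) powr - (s + w) = b n * of_nat (Suc n) powr - w" for n
        by (simp add: b_def mult.assoc powr_add[symmetric] del: of_nat_Suc)
      ultimately show "(\<lambda>n. b n * of_nat (Suc n) powr - w) sums f (s + w)" by (simp only:)
    qed
  qed
  then show "(\<lambda>n. a (Suc n) * of_nat (Suc n) powr - s) sums f s" by (simp add: b_def)
qed

section \<open>Continuous semigroups in the class \<open>\<G>\<^sub>\<infinity>\<close>\<close>

lemma dirichlet_abs_bounded:
  assumes "dirichlet_abs a \<sigma> f" "Re s \<ge> \<sigma>"
  shows "norm (f s) \<le> (\<Sum>n. norm (a n) * real (Suc n) powr - \<sigma>)"
  using dirichlet_abs_tail[OF assms, of 0] by simp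

text \<open>Phragmen--Lindelof for \<open>exp (- \<phi>)\<close>: on the line
  \<open>Re z = \<delta>\<close> the positivity of \<open>Re \<Phi>\<close> gives the bound
  \<open>exp (c * \<delta>)\<close>, and \<delta> tends to 0.\<close>

lemma Re_dirichlet_part_nonneg:
  assumes \<Phi>: "self_map \<Phi>" and \<phi>: "in_D \<phi>"
    and eq: "\<And>s. s \<in> \<complex>\<^sub>+ \<Longrightarrow> \<Phi> s = of_nat c * s + \<phi> s" and s: "Re s > 0"
  shows "Re (\<phi> s) \<ge> 0"
proof -
  obtain a \<sigma> where \<sigma>: "\<sigma> > 0" "dirichlet_abs a \<sigma> \<phi>" using in_D_imp_abs[OF \<phi>] .
  define K where "K = (\<Sum>n. norm (a n) * real (Suc n) powr - \<sigma>)"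
  have hol: "\<phi> holomorphic_on \<complex>\<^sub>+" using \<phi> by (simp add: in_D_def)
  have Re_eq: "Re (\<phi> z) > - (real c * Re z)" if "Re z > 0" for z
  proof -
    have "Re (\<Phi> z) > 0" using \<Phi> that image_subset_iff[of \<Phi> "\<complex>\<^sub>+" "\<complex>\<^sub>+"] by (auto simp: self_map_def)
    then show ?thesis using eq[of z] that by simp
  qed
  have bound: "- Re (\<phi> s) \<le> real c * \<delta>" if \<delta>: "\<delta> > 0" "\<delta> \<le> Re s" for \<delta>
  proof -
    have "norm (exp (- \<phi> s)) \<le> exp (real c * \<delta>)"
    \<comment> \<open>A crude global bound: beyond \<sigma> the function \<phi> is bounded by
      \<open>K\<close>, and in the strip before \<sigma> the positivity of \<open>Re \<Phi>\<close>
      bounds \<open>- Re \<phi>\<close> by \<open>c * \<sigma>\<close>.\<close>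
    proof (rule bounded_half_plane_max_modulus[of "\<lambda>s. exp (- \<phi> s)" \<delta> "exp (max K (real c * \<sigma>))"])
      show "(\<lambda>s. exp (- \<phi> s)) holomorphic_on \<complex>\<^sub>+" by (intro holomorphic_intros hol)
      show "norm (exp (- \<phi> z)) \<le> exp (max K (real c * \<sigma>))" if z: "\<delta> \<le> Re z" for z
      proof (cases "Re z \<ge> \<sigma>")
        case True
        have "- Re (\<phi> z) \<le> K"
          using dirichlet_abs_bounded[OF \<sigma>(2) True] abs_Re_le_cmod[of "\<phi> z"] by (simp add: K_def)
        then show ?thesis by simp
      next
        case False
        then have "- Re (\<phi> z) \<le> real c * Re z" "real c * Re z \<le> real c * \<sigma>"
          using Re_eq[of z] z \<delta> by (auto intro: mult_left_mono)
        then show ?thesis by simp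
      qed
      show "norm (exp (- \<phi> z)) \<le> exp (real c * \<delta>)" if "Re z = \<delta>" for z
        using Re_eq[of z] that \<delta> by simp
    qed (use \<delta> in auto)
    then show ?thesis by simp
  qed
  have "- Re (\<phi> s) \<le> 0 + e" if "e > 0" for e
  proof -
    define \<delta> where "\<delta> = min (Re s) (e / (real c + 1))"
    have "- Re (\<phi> s) \<le> real c * \<delta>" by (rule bound) (use s that in \<open>auto simp: \<delta>_def\<close>)
    also have "\<dots> \<le> (real c + 1) * (e / (real c + 1))"
      using s that by (intro mult_mono) (auto simp: \<delta>_def)
    also have "\<dots> = e" by simp
    finally show ?thesis by simp
  qed
  then have "- Re (\<phi> s) \<le> 0" by (rule field_le_epsilon)
  then show ?thesis by simp
qed

lemma in_D_cong:
  assumes "in_D f" "\<And>s. s \<in> \<complex>\<^sub>+ \<Longrightarrow> f s = g s"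
  shows "in_D g"
proof -
  obtain a \<theta> where "f holomorphic_on \<complex>\<^sub>+" "\<theta> \<ge> 0" "dirichlet_sums_on a f (half_plane \<theta>)"
    using assms(1) by (auto simp: in_D_def)
  then show ?thesis
    unfolding in_D_def dirichlet_sums_on_def using assms(2)
    using holomorphic_cong[of "\<complex>\<^sub>+" "\<complex>\<^sub>+" f g] by (intro conjI exI[of _ a] exI[of _ \<theta>]) auto
qed

section \<open>Injectivity of the maps and their linear coefficient\<close>

locale G_semigroup =
  fixes \<Phi> :: "real \<Rightarrow> complex \<Rightarrow> complex"
  assumes cont: "continuous_semigroup \<Phi>" and G: "t \<ge> 0 \<Longrightarrow> G_infinity (\<Phi> t)"
begin

definition \<phi> :: "real \<Rightarrow> complex \<Rightarrow> complex" where "\<phi> t s = \<Phi> t s - s"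

lemma self: "t \<ge> 0 \<Longrightarrow> self_map (\<Phi> t)"
  and zero [simp]: "Re s > 0 \<Longrightarrow> \<Phi> 0 s = s"
  and semigroup: "t \<ge> 0 \<Longrightarrow> u \<ge> 0 \<Longrightarrow> Re s > 0 \<Longrightarrow> \<Phi> t (\<Phi> u s) = \<Phi> (t + u) s"
  using cont by (auto simp: continuous_semigroup_def analytic_semigroup_def)

lemma hol: "t \<ge> 0 \<Longrightarrow> \<Phi> t holomorphic_on \<complex>\<^sub>+"
  using self by (simp add: self_map_def)

lemma Re_pos: "t \<ge> 0 \<Longrightarrow> Re s > 0 \<Longrightarrow> Re (\<Phi> t s) > 0"
  using self[of t] image_subset_iff[of "\<Phi> t" "\<complex>\<^sub>+" "\<complex>\<^sub>+"] by (auto simp: self_map_def)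

lemma near_identity:
  assumes K: "compact K" "K \<subseteq> \<complex>\<^sub>+" and e: "e > 0"
  shows "\<exists>r>0. \<forall>u s. 0 \<le> u \<longrightarrow> u \<le> r \<longrightarrow> s \<in> K \<longrightarrow> norm (\<Phi> u s - s) < e"
proof -
  have "uniform_limit K \<Phi> (\<Phi> 0) (at_right 0)"
    using cont K by (simp add: continuous_semigroup_def)
  then have "\<forall>\<^sub>F u in at_right 0. \<forall>s\<in>K. dist (\<Phi> u s) (\<Phi> 0 s) < e"
    using e by (rule uniform_limitD)
  then obtain b where b: "b > 0" "\<And>u s. 0 < u \<Longrightarrow> u < b \<Longrightarrow> s \<in> K \<Longrightarrow> dist (\<Phi> u s) (\<Phi> 0 s) < e"
    by (auto simp: eventually_at_right[of 0 1])
  show ?thesis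
  proof (intro exI[of _ "b / 2"] conjI allI impI)
    fix u s assume "0 \<le> u" "u \<le> b / 2" "s \<in> K"
    then show "norm (\<Phi> u s - s) < e"
      using b(2)[of u s] b(1) K(2) e by (cases "u = 0") (auto simp: dist_norm)
  qed (use b in auto)
qed

lemma near_identity_at:
  assumes "Re s > 0" "e > 0"
  shows "\<exists>r>0. \<forall>u. 0 \<le> u \<longrightarrow> u \<le> r \<longrightarrow> norm (\<Phi> u s - s) < e"
  using near_identity[of "{s}" e] assms by simp

text \<open>Contractivity in the hyperbolic metric makes orbits continuous from the left as well.\<close>

lemma left_continuous:
  assumes z: "Re z > 0" and \<tau>: "\<tau> > 0"
  obtains r where "r > 0" "r \<le> \<tau>" "\<And>h. 0 \<le> h \<Longrightarrow> h \<le> r \<Longrightarrow> norm (\<Phi> (\<tau> - h) z - \<Phi> \<tau> z) \<le> Re (\<Phi> \<tau> z) / 8"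
proof -
  obtain r where r: "r > 0" "\<And>u. 0 \<le> u \<Longrightarrow> u \<le> r \<Longrightarrow> norm (\<Phi> u z - z) < Re z / 16"
    using near_identity_at[of z "Re z / 16"] z by auto
  show ?thesis
  proof (rule that[of "min r \<tau>"])
    fix h assume h: "0 \<le> h" "h \<le> min r \<tau>"
    define w where "w = \<Phi> h z"
    have d: "norm (z - w) \<le> Re z / 16" using r(2)[of h] h by (simp add: w_def norm_minus_commute)
    then have Rw: "Re w \<ge> Re z / 2" using abs_Re_le_cmod[of "z - w"] z by simp
    have "norm (\<Phi> (\<tau> - h) z - \<Phi> (\<tau> - h) w) \<le> norm (z - w) / Re z * (1 + norm (z - w) / Re w) * Re (\<Phi> (\<tau> - h) w)"
      by (rule Harnack_half_plane) (use h z Rw hol Re_pos in \<open>auto intro: less_imp_le\<close>)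
    also have "\<Phi> (\<tau> - h) w = \<Phi> \<tau> z" using semigroup[of "\<tau> - h" h z] h z by (simp add: w_def)
    also have "norm (z - w) / Re z * (1 + norm (z - w) / Re w) * Re (\<Phi> \<tau> z) \<le> 1 / 16 * (1 + 1) * Re (\<Phi> \<tau> z)"
    proof (intro mult_right_mono mult_mono add_mono)
      show "norm (z - w) / Re z \<le> 1 / 16" using d z by (simp add: divide_le_eq)
      show "norm (z - w) / Re w \<le> 1" using d z Rw by (simp add: divide_le_eq)
      show "0 \<le> Re (\<Phi> \<tau> z)" using Re_pos[of \<tau> z] \<tau> z by simp
    qed (use z Rw in auto)
    finally show "norm (\<Phi> (\<tau> - h) z - \<Phi> \<tau> z) \<le> Re (\<Phi> \<tau> z) / 8" by simp
  qed (use r \<tau> in auto)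
qed

text \<open>On a fixed ball \<open>\<Phi> h - id\<close> is uniformly small for small
  \<open>h\<close>; Cauchy's inequality makes its derivative at most 1/4, and the identity plus a
  contraction is injective.\<close>

lemma locally_injective:
  assumes p: "Re p > 0"
  obtains r where "r > 0"
    "\<And>h s s'. 0 \<le> h \<Longrightarrow> h \<le> r \<Longrightarrow> norm (s - p) \<le> Re p / 8 \<Longrightarrow> norm (s' - p) \<le> Re p / 8 \<Longrightarrow>
       \<Phi> h s = \<Phi> h s' \<Longrightarrow> s = s'"
proof -
  define \<rho> where "\<rho> = Re p / 8"
  have \<rho>: "\<rho> > 0" using p by (simp add: \<rho>_def)
  have in_hp: "Re s > 0" if "norm (s - p) \<le> 2 * \<rho>" for s
    using abs_Re_le_cmod[of "s - p"] that p by (simp add: \<rho>_def)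
  have sub: "cball p (2 * \<rho>) \<subseteq> \<complex>\<^sub>+"
    using in_hp by (auto simp: dist_norm norm_minus_commute)
  obtain r where r: "r > 0" "\<And>u s. 0 \<le> u \<Longrightarrow> u \<le> r \<Longrightarrow> s \<in> cball p (2 * \<rho>) \<Longrightarrow> norm (\<Phi> u s - s) < \<rho> / 4"
    using near_identity[of "cball p (2 * \<rho>)" "\<rho> / 4"] \<rho> sub by auto
  show ?thesis
  proof (rule that[OF r(1)])
    fix h s s' assume h: "0 \<le> h" "h \<le> r" and s: "norm (s - p) \<le> Re p / 8" "norm (s' - p) \<le> Re p / 8"
      and eq: "\<Phi> h s = \<Phi> h s'"
    define g where "g = (\<lambda>z. \<Phi> h z - z)"
    have holg: "g holomorphic_on \<complex>\<^sub>+" unfolding g_def by (intro holomorphic_intros hol h)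
    have bg: "norm (deriv g z) \<le> 1 / 4" if z: "norm (z - p) \<le> \<rho>" for z
    proof -
      have sub': "cball z \<rho> \<subseteq> cball p (2 * \<rho>)"
      proof
        fix x assume "x \<in> cball z \<rho>"
        then show "x \<in> cball p (2 * \<rho>)"
          using z norm_triangle_ineq[of "x - z" "z - p"] by (simp add: dist_norm norm_minus_commute)
      qed
      have "norm ((deriv ^^ 1) g z) \<le> fact 1 * (\<rho> / 4) / \<rho> ^ 1"
      proof (rule Cauchy_inequality)
        show "g holomorphic_on ball z \<rho>"
          using holg by (rule holomorphic_on_subset) (use sub' sub ball_subset_cball in blast)
        show "continuous_on (cball z \<rho>) g"
          by (rule holomorphic_on_imp_continuous_on, rule holomorphic_on_subset[OF holg]) (use sub' sub in blast)
        show "norm (g x) \<le> \<rho> / 4" if "norm (z - x) = \<rho>" for x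
          unfolding g_def using r(2)[OF h, of x] sub' that by (force simp: dist_norm)
      qed (use \<rho> in auto)
      then show ?thesis using \<rho> by simp
    qed
    have "norm (g s - g s') \<le> 1 / 4 * norm (s - s')"
    proof (rule field_differentiable_bound[where S = "cball p \<rho>" and f' = "deriv g"])
      show "(g has_field_derivative deriv g z) (at z within cball p \<rho>)" if "z \<in> cball p \<rho>" for z
        by (rule has_field_derivative_at_within, rule holomorphic_derivI[OF holg])
           (use that in_hp \<rho> in \<open>auto simp: dist_norm norm_minus_commute\<close>)
      show "norm (deriv g z) \<le> 1 / 4" if "z \<in> cball p \<rho>" for z
        using bg that by (simp add: dist_norm norm_minus_commute)
    qed (use s in \<open>auto simp: dist_norm norm_minus_commute \<rho>_def\<close>)
    moreover have "g s - g s' = s' - s" using eq by (simp add: g_def)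
    ultimately show "s = s'" by (simp add: norm_minus_commute)
  qed
qed

text \<open>If two orbits meet, let \<tau> be the first time they do. Shortly before \<tau> both are
  near the common point \<open>p\<close>, where \<open>\<Phi> h\<close> is injective for small
  \<open>h\<close>, so they have already met.\<close>

lemma injective:
  assumes t: "t \<ge> 0"
  shows "inj_on (\<Phi> t) \<complex>\<^sub>+"
proof (rule inj_onI, rule ccontr)
  fix z w assume zw: "z \<in> \<complex>\<^sub>+" "w \<in> \<complex>\<^sub>+" "\<Phi> t z = \<Phi> t w" "z \<noteq> w"
  define I where "I = {u. 0 \<le> u \<and> \<Phi> u z = \<Phi> u w}"
  define \<tau> where "\<tau> = Inf I"
  have tI: "t \<in> I" using zw t by (simp add: I_def)
  have bdd: "bdd_below I" by (rule bdd_belowI[of _ 0]) (simp add: I_def)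
  have \<tau>0: "\<tau> \<ge> 0" unfolding \<tau>_def using tI by (intro cInf_greatest) (auto simp: I_def)
  \<comment> \<open>The infimum is attained: meeting times come arbitrarily close to \<tau> from
    above, and orbits are right-continuous.\<close>
  have eq: "\<Phi> \<tau> z = \<Phi> \<tau> w"
  proof -
    have "norm (\<Phi> \<tau> z - \<Phi> \<tau> w) \<le> 0 + e" if "e > 0" for e
    proof -
      obtain r where r: "r > 0" "\<And>u. 0 \<le> u \<Longrightarrow> u \<le> r \<Longrightarrow> norm (\<Phi> u (\<Phi> \<tau> z) - \<Phi> \<tau> z) < e / 2"
        using near_identity_at[of "\<Phi> \<tau> z" "e / 2"] \<open>e > 0\<close> Re_pos[OF \<tau>0] zw by auto
      obtain r' where r': "r' > 0" "\<And>u. 0 \<le> u \<Longrightarrow> u \<le> r' \<Longrightarrow> norm (\<Phi> u (\<Phi> \<tau> w) - \<Phi> \<tau> w) < e / 2"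
        using near_identity_at[of "\<Phi> \<tau> w" "e / 2"] \<open>e > 0\<close> Re_pos[OF \<tau>0] zw by auto
      obtain u where u: "u \<in> I" "u < \<tau> + min r r'"
        using cInf_lessD[of I "\<tau> + min r r'"] tI r(1) r'(1) by (auto simp: \<tau>_def)
      define h where "h = u - \<tau>"
      have h: "h \<ge> 0" "h \<le> r" "h \<le> r'"
        using cInf_lower[OF u(1) bdd] u(2) by (auto simp: h_def \<tau>_def)
      have "\<Phi> h (\<Phi> \<tau> z) = \<Phi> u z" "\<Phi> h (\<Phi> \<tau> w) = \<Phi> u w"
        using semigroup[of h \<tau>] h \<tau>0 zw by (auto simp: h_def)
      then have "\<Phi> \<tau> z - \<Phi> \<tau> w = (\<Phi> h (\<Phi> \<tau> w) - \<Phi> \<tau> w) - (\<Phi> h (\<Phi> \<tau> z) - \<Phi> \<tau> z)"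
        using u(1) by (simp add: I_def)
      then show ?thesis
        using norm_triangle_ineq4[of "\<Phi> h (\<Phi> \<tau> w) - \<Phi> \<tau> w" "\<Phi> h (\<Phi> \<tau> z) - \<Phi> \<tau> z"] r(2)[of h] r'(2)[of h] h by simp
    qed
    then have "norm (\<Phi> \<tau> z - \<Phi> \<tau> w) \<le> 0" by (rule field_le_epsilon)
    then show ?thesis by simp
  qed
  have \<tau>: "\<tau> > 0" using eq zw \<tau>0 by (cases "\<tau> = 0") auto
  define p where "p = \<Phi> \<tau> z"
  have p: "Re p > 0" using Re_pos \<tau> zw by (simp add: p_def)
  obtain r1 where r1: "r1 > 0" "r1 \<le> \<tau>" "\<And>h. 0 \<le> h \<Longrightarrow> h \<le> r1 \<Longrightarrow> norm (\<Phi> (\<tau> - h) z - p) \<le> Re p / 8"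
    using left_continuous[OF _ \<tau>, of z] zw by (auto simp: p_def)
  obtain r2 where r2: "r2 > 0" "r2 \<le> \<tau>" "\<And>h. 0 \<le> h \<Longrightarrow> h \<le> r2 \<Longrightarrow> norm (\<Phi> (\<tau> - h) w - p) \<le> Re p / 8"
    using left_continuous[OF _ \<tau>, of w] zw eq by (auto simp: p_def)
  obtain r3 where r3: "r3 > 0" "\<And>h s s'. 0 \<le> h \<Longrightarrow> h \<le> r3 \<Longrightarrow> norm (s - p) \<le> Re p / 8 \<Longrightarrow> norm (s' - p) \<le> Re p / 8 \<Longrightarrow>
       \<Phi> h s = \<Phi> h s' \<Longrightarrow> s = s'"
    using locally_injective[OF p] by blast
  define h where "h = min r1 (min r2 r3)"
  have h: "h > 0" "h \<le> r1" "h \<le> r2" "h \<le> r3" using r1 r2 r3 by (auto simp: h_def)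
  have "\<Phi> (\<tau> - h) z = \<Phi> (\<tau> - h) w"
  proof (rule r3(2)[of h])
    show "\<Phi> h (\<Phi> (\<tau> - h) z) = \<Phi> h (\<Phi> (\<tau> - h) w)"
      using semigroup[of h "\<tau> - h"] h r1 zw eq by simp
  qed (use h r1 r2 in auto)
  then have "\<tau> - h \<in> I" using h r1 by (simp add: I_def)
  then have "\<tau> \<le> \<tau> - h" unfolding \<tau>_def by (rule cInf_lower[OF _ bdd])
  then show False using h by simp
qed

lemma representation:
  assumes t: "t \<ge> 0"
  obtains c :: nat and \<psi> where "c \<ge> 1" "in_D \<psi>" "\<And>s. Re s > 0 \<Longrightarrow> \<Phi> t s = of_nat c * s + \<psi> s"
    "\<And>s. Re s > 0 \<Longrightarrow> Re (\<psi> s) \<ge> 0"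
proof -
  obtain c :: nat and \<psi> where \<psi>: "in_D \<psi>" "\<And>s. s \<in> \<complex>\<^sub>+ \<Longrightarrow> \<Phi> t s = of_nat c * s + \<psi> s"
    using G[OF t] unfolding G_infinity_def by blast
  have "c \<noteq> 0"
  proof
    assume "c = 0"
    then have "in_D (\<Phi> t)" using in_D_cong[OF \<psi>(1)] \<psi>(2) by simp
    then obtain a \<sigma> where \<sigma>: "\<sigma> > 0" "dirichlet_abs a \<sigma> (\<Phi> t)" by (rule in_D_imp_abs)
    have sub: "half_plane \<sigma> \<subseteq> \<complex>\<^sub>+" by (rule half_plane_mono) (use \<sigma> in auto)
    have "\<not> inj_on (\<Phi> t) (half_plane \<sigma>)"
      by (rule dirichlet_not_inj[OF \<sigma>(2) holomorphic_on_subset[OF hol[OF t] sub]])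
    then show False using inj_on_subset[OF injective[OF t] sub] by blast
  qed
  then show ?thesis
    using that[of c \<psi>] \<psi> Re_dirichlet_part_nonneg[OF self[OF t] \<psi>] by auto
qed

text \<open>Every half-plane \<open>Re s \<ge> \<epsilon>\<close> is mapped into itself, which
  allows estimates there to be iterated along orbits.\<close>

lemma Re_mono:
  assumes "t \<ge> 0" "Re s > 0"
  shows "Re s \<le> Re (\<Phi> t s)"
proof -
  obtain c :: nat and \<psi> where c: "c \<ge> 1" "\<And>s. Re s > 0 \<Longrightarrow> \<Phi> t s = of_nat c * s + \<psi> s"
    "\<And>s. Re s > 0 \<Longrightarrow> Re (\<psi> s) \<ge> 0"
    using representation[OF assms(1)] by metis
  have "1 * Re s \<le> real c * Re s" using c assms by (intro mult_right_mono) auto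
  then show ?thesis using c(2,3)[OF assms(2)] by simp
qed

text \<open>The real part of \<open>\<Phi> t 1\<close> is at least \<open>c\<close>, while for small
  \<open>t\<close> it stays below 2.\<close>

lemma representation_near_zero:
  "\<exists>r>0. \<forall>t. 0 \<le> t \<longrightarrow> t \<le> r \<longrightarrow> in_D (\<phi> t)"
proof -
  obtain r where r: "r > 0" "\<And>u. 0 \<le> u \<Longrightarrow> u \<le> r \<Longrightarrow> norm (\<Phi> u 1 - 1) < 1"
    using near_identity_at[of 1 1] by auto
  show ?thesis
  proof (intro exI[of _ r] conjI r(1) allI impI)
    fix t assume t: "0 \<le> t" "t \<le> r"
    obtain c :: nat and \<psi> where c: "c \<ge> 1" "in_D \<psi>" "\<And>s. Re s > 0 \<Longrightarrow> \<Phi> t s = of_nat c * s + \<psi> s"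
      "\<And>s. Re s > 0 \<Longrightarrow> Re (\<psi> s) \<ge> 0"
      using representation[OF t(1)] by metis
    have "Re (\<Phi> t 1 - 1) < 1" using r(2)[OF t] abs_Re_le_cmod[of "\<Phi> t 1 - 1"] by simp
    then have "c = 1" using c(1) c(3)[of 1] c(4)[of 1] by simp
    then show "in_D (\<phi> t)"
      by (intro in_D_cong[OF c(2)]) (simp add: \<phi>_def c(3))
  qed
qed

text \<open>Iterating \<open>\<Phi> (t / n)\<close> gives a bounded \<open>\<phi> t\<close> far to the right, which excludes \<open>c \<noteq> 1\<close>.\<close>

lemma in_D_\<phi>:
  assumes t: "t \<ge> 0"
  shows "in_D (\<phi> t)"
proof -
  obtain c :: nat and \<psi> where c: "c \<ge> 1" "in_D \<psi>" "\<And>s. Re s > 0 \<Longrightarrow> \<Phi> t s = of_nat c * s + \<psi> s"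
    "\<And>s. Re s > 0 \<Longrightarrow> Re (\<psi> s) \<ge> 0"
    using representation[OF t(1)] by metis
  obtain r where r: "r > 0" "\<And>t. 0 \<le> t \<Longrightarrow> t \<le> r \<Longrightarrow> in_D (\<phi> t)"
    using representation_near_zero by blast
  obtain n where n: "t / r < real n" using reals_Archimedean2 by blast
  have n0: "real n > 0" using n t r(1) by (smt (verit) divide_nonneg_pos)
  define h where "h = t / real n"
  have h: "0 \<le> h" "h \<le> r" "real n * h = t" using n n0 r(1) t by (auto simp: h_def field_simps)
  obtain a \<sigma> where a: "\<sigma> > 0" "dirichlet_abs a \<sigma> (\<phi> h)" using in_D_imp_abs[OF r(2)[OF h(1,2)]] .
  obtain K where K: "\<And>s. Re s \<ge> \<sigma> \<Longrightarrow> norm (\<phi> h s) \<le> K" using dirichlet_abs_bounded[OF a(2)] by blast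
  obtain a' \<sigma>' where a': "\<sigma>' > 0" "dirichlet_abs a' \<sigma>' \<psi>" using in_D_imp_abs[OF c(2)] .
  obtain K' where K': "\<And>s. Re s \<ge> \<sigma>' \<Longrightarrow> norm (\<psi> s) \<le> K'" using dirichlet_abs_bounded[OF a'(2)] by blast
  have iter: "norm (\<Phi> (real k * h) s - s) \<le> real k * K" if s: "Re s \<ge> \<sigma>" for k s
  proof (induction k)
    case 0
    then show ?case using s a by simp
  next
    case (Suc k)
    have kh: "real k * h \<ge> 0" using h by simp
    have "Re (\<Phi> (real k * h) s) \<ge> \<sigma>" using Re_mono[OF kh, of s] s a by simp
    then have "norm (\<phi> h (\<Phi> (real k * h) s)) \<le> K" by (rule K)
    moreover have "\<Phi> (real (Suc k) * h) s - s = \<phi> h (\<Phi> (real k * h) s) + (\<Phi> (real k * h) s - s)"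
      using semigroup[OF h(1) kh, of s] s a by (simp add: \<phi>_def algebra_simps)
    ultimately show ?case
      using Suc norm_triangle_ineq[of "\<phi> h (\<Phi> (real k * h) s)" "\<Phi> (real k * h) s - s"] by (simp add: algebra_simps)
  qed
  have "c = 1"
  proof (rule ccontr)
    assume "c \<noteq> 1"
    then have c2: "real c - 1 \<ge> 1" using c(1) by simp
    \<comment> \<open>A point far enough to the right that \<open>x\<close> exceeds
      \<open>n * K + K'\<close>, the bound about to be derived for
      \<open>(c - 1) * x\<close>.\<close>
    define x where "x = max \<sigma> \<sigma>' + \<bar>real n * K + K'\<bar>"
    have x: "x \<ge> \<sigma>" "x \<ge> \<sigma>'" "x > real n * K + K'" "x > 0" using a(1) a'(1) by (auto simp: x_def)
    have "of_real ((real c - 1) * x) = (\<Phi> t (of_real x) - of_real x) - \<psi> (of_real x)"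
      using c(3)[of "of_real x"] x by (simp add: algebra_simps)
    then have "norm (of_real ((real c - 1) * x) :: complex) \<le> norm (\<Phi> t (of_real x) - of_real x) + norm (\<psi> (of_real x))"
      by (simp only: norm_triangle_ineq4)
    also have "\<dots> \<le> real n * K + K'"
      using iter[of "of_real x" n] K'[of "of_real x"] x h by simp
    finally have "(real c - 1) * x \<le> real n * K + K'" using c2 x by (simp only: norm_of_real)
    moreover have "1 * x \<le> (real c - 1) * x" using c2 x by (intro mult_right_mono) auto
    ultimately show False using x by simp
  qed
  then show ?thesis
    by (intro in_D_cong[OF c(2)]) (simp add: \<phi>_def c(3))
qed

end

section \<open>Uniform smallness of the displacement\<close>

text \<open>Far to the right the series converges absolutely; other points are compared with their
  translates by \<sigma> through Harnack's inequality.\<close>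

lemma in_D_bounded:
  assumes \<phi>: "in_D \<phi>" and pos: "\<And>s. Re s > 0 \<Longrightarrow> Re (\<phi> s) \<ge> 0" and \<epsilon>: "\<epsilon> > 0"
  shows "\<exists>K. \<forall>s. Re s \<ge> \<epsilon> \<longrightarrow> norm (\<phi> s) \<le> K"
proof -
  obtain a \<sigma> where a: "\<sigma> > 0" "dirichlet_abs a \<sigma> \<phi>" using in_D_imp_abs[OF \<phi>] .
  define A where "A = (\<Sum>n. norm (a n) * real (Suc n) powr - \<sigma>)"
  have A: "norm (\<phi> s) \<le> A" if "Re s \<ge> \<sigma>" for s
    unfolding A_def by (rule dirichlet_abs_bounded[OF a(2) that])
  have hol: "\<phi> holomorphic_on \<complex>\<^sub>+" using \<phi> by (simp add: in_D_def)
  have "norm (\<phi> s) \<le> \<sigma> / \<epsilon> * (1 + \<sigma> / \<epsilon>) * A + A" if s: "Re s \<ge> \<epsilon>" for s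
  proof -
    have "norm (\<phi> s - \<phi> (s + of_real \<sigma>)) \<le> \<sigma> / \<epsilon> * (1 + \<sigma> / \<epsilon>) * Re (\<phi> (s + of_real \<sigma>))"
      by (rule Harnack_half_plane_bounded) (use hol pos \<epsilon> s a in auto)
    also have "\<dots> \<le> \<sigma> / \<epsilon> * (1 + \<sigma> / \<epsilon>) * A"
      using A[of "s + of_real \<sigma>"] complex_Re_le_cmod[of "\<phi> (s + of_real \<sigma>)"] s \<epsilon> a(1)
      by (intro mult_left_mono) auto
    finally show ?thesis
      using A[of "s + of_real \<sigma>"] norm_triangle_ineq[of "\<phi> s - \<phi> (s + of_real \<sigma>)" "\<phi> (s + of_real \<sigma>)"] s \<epsilon> by simp
  qed
  then show ?thesis by blast
qed

text \<open>With \<open>b\<close> the limit of \<open>\<phi>\<close> at \<open>+\<infinity>\<close> and \<open>B\<close> the supremum of \<open>|\<phi> - b|\<close> on \<open>Re s \<ge> \<epsilon>\<close>,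
  Phragmen--Lindelof for \<open>(\<phi> - b) 2 powr s\<close> gives \<open>|\<phi> - b| \<le> B / 4\<close> two units further to the right,
  and Harnack's inequality brings this back: \<open>B \<le> B / 4 + D\<close>.\<close>

lemma in_D_oscillation:
  assumes \<phi>: "in_D \<phi>" and pos: "\<And>s. Re s > 0 \<Longrightarrow> Re (\<phi> s) \<ge> 0" and \<epsilon>: "\<epsilon> > 0"
    and K: "\<And>s. Re s \<ge> \<epsilon> \<Longrightarrow> Re (\<phi> s) \<le> K" and zw: "Re z \<ge> \<epsilon>" "Re w \<ge> \<epsilon>"
  shows "norm (\<phi> z - \<phi> w) \<le> 3 * (2 / \<epsilon>) * (1 + 2 / \<epsilon>) * K"
proof -
  obtain a \<sigma> where a: "\<sigma> > 0" "dirichlet_abs a \<sigma> \<phi>" using in_D_imp_abs[OF \<phi>] .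
  define A where "A = (\<Sum>n. norm (a n) * real (Suc n) powr - \<sigma>)"
  define b where "b = a 0"
  have hol: "\<phi> holomorphic_on \<complex>\<^sub>+" using \<phi> by (simp add: in_D_def)
  have A: "norm (\<phi> s - b) \<le> A * 2 powr (\<sigma> - Re s)" if "Re s \<ge> \<sigma>" for s
    unfolding A_def b_def by (rule dirichlet_abs_tail_0[OF a(2) that])
  have A0: "A \<ge> 0" using order_trans[OF norm_ge_zero A[of "of_real \<sigma>"]] by simp
  obtain B0 where B0: "\<And>s. Re s \<ge> \<epsilon> \<Longrightarrow> norm (\<phi> s) \<le> B0" using in_D_bounded[OF \<phi> pos \<epsilon>] by blast
  define S where "S = {s. Re s \<ge> \<epsilon>}"
  define B where "B = (SUP s\<in>S. norm (\<phi> s - b))"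
  have B1: "norm (\<phi> s - b) \<le> B0 + norm b" if "Re s \<ge> \<epsilon>" for s
    using B0[OF that] norm_triangle_ineq4[of "\<phi> s" b] by simp
  then have bdd: "bdd_above ((\<lambda>s. norm (\<phi> s - b)) ` S)" by (auto simp: S_def intro!: bdd_aboveI)
  have B: "norm (\<phi> s - b) \<le> B" if "Re s \<ge> \<epsilon>" for s
    unfolding B_def by (rule cSUP_upper[OF _ bdd]) (simp add: S_def that)
  have B_pos: "B \<ge> 0" using order_trans[OF norm_ge_zero B[OF zw(1)]] .
  have pl: "norm ((\<phi> s - b) * 2 powr s) \<le> B * 2 powr \<epsilon>" if s: "Re s \<ge> \<epsilon>" for s
  proof (rule bounded_half_plane_max_modulus[OF _ \<epsilon> _ _ s, of "\<lambda>s. (\<phi> s - b) * 2 powr s" "max (A * 2 powr \<sigma>) (B * 2 powr \<sigma>)"])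
    show "(\<lambda>s. (\<phi> s - b) * 2 powr s) holomorphic_on \<complex>\<^sub>+" by (intro holomorphic_intros hol)
    have n2: "norm (2 powr s :: complex) = 2 powr Re s" for s using norm_nat_powr[of 2 s] by simp
    show "norm ((\<phi> s - b) * 2 powr s) \<le> max (A * 2 powr \<sigma>) (B * 2 powr \<sigma>)" if "Re s \<ge> \<epsilon>" for s
    proof (cases "Re s \<ge> \<sigma>")
      case True
      have "norm ((\<phi> s - b) * 2 powr s) \<le> (A * 2 powr (\<sigma> - Re s)) * 2 powr Re s"
        unfolding norm_mult n2 by (intro mult_right_mono A True) auto
      also have "\<dots> = A * 2 powr \<sigma>" by (simp add: mult.assoc powr_add[symmetric])
      finally show ?thesis by simp
    next
      case False
      have "norm ((\<phi> s - b) * 2 powr s) \<le> B * 2 powr \<sigma>"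
        unfolding norm_mult n2 using B[OF that] False B_pos by (intro mult_mono powr_mono) auto
      then show ?thesis by simp
    qed
    show "norm ((\<phi> s - b) * 2 powr s) \<le> B * 2 powr \<epsilon>" if "Re s = \<epsilon>" for s
      unfolding norm_mult n2 using B[of s] that by (simp add: mult_right_mono)
  qed
  \<comment> \<open>Harnack's constant for two points at distance 2, times the bound for the real
    part.\<close>
  define D where "D = 2 / \<epsilon> * (1 + 2 / \<epsilon>) * K"
  have step: "norm (\<phi> s - b) \<le> B / 4 + D" if s: "Re s \<ge> \<epsilon>" for s
  proof -
    have "norm (\<phi> s - \<phi> (s + 2)) \<le> 2 / \<epsilon> * (1 + 2 / \<epsilon>) * Re (\<phi> (s + 2))"
      by (rule Harnack_half_plane_bounded) (use hol pos \<epsilon> s in auto)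
    also have "\<dots> \<le> D"
      unfolding D_def using K[of "s + 2"] s \<epsilon> by (intro mult_left_mono) auto
    finally have 1: "norm (\<phi> s - \<phi> (s + 2)) \<le> D" .
    have "norm (\<phi> (s + 2) - b) * 2 powr (Re s + 2) \<le> B * 2 powr \<epsilon>"
      using pl[of "s + 2"] s norm_nat_powr[of 2 "s + 2"] by (simp add: norm_mult)
    also have "\<dots> \<le> B * 2 powr Re s" using s B_pos by (intro mult_left_mono powr_mono) auto
    also have "\<dots> = B / 4 * 2 powr (Re s + 2)" by (simp add: powr_add)
    finally have "norm (\<phi> (s + 2) - b) \<le> B / 4" by (simp only: mult_le_cancel_right_pos powr_gt_zero)
    then show ?thesis
      using 1 norm_triangle_ineq[of "\<phi> s - \<phi> (s + 2)" "\<phi> (s + 2) - b"] by simp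
  qed
  have "B \<le> B / 4 + D"
    unfolding B_def by (rule cSUP_least) (use step zw in \<open>auto simp: S_def B_def\<close>)
  \<comment> \<open>The absorption needs \<open>B\<close> finite, which \<open>in_D_bounded\<close>
    provides. It gives \<open>B \<le> 4 / 3 * D\<close>, and 3 rounds up twice 4/3.\<close>
  then have "2 * B \<le> 3 * D" using B_pos by linarith
  then show ?thesis
    using B[OF zw(1)] B[OF zw(2)] norm_triangle_ineq4[of "\<phi> z - b" "\<phi> w - b"]
    unfolding mult.assoc D_def[unfolded mult.assoc, symmetric] by simp
qed

section \<open>The displacement away from the boundary\<close>

context G_semigroup
begin

lemma hol_\<phi>: "t \<ge> 0 \<Longrightarrow> \<phi> t holomorphic_on \<complex>\<^sub>+"
  using in_D_\<phi> by (simp add: in_D_def)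

lemma Re_\<phi>_nonneg: "t \<ge> 0 \<Longrightarrow> Re s > 0 \<Longrightarrow> Re (\<phi> t s) \<ge> 0"
  using Re_mono by (simp add: \<phi>_def)

lemma \<phi>_add: "t \<ge> 0 \<Longrightarrow> u \<ge> 0 \<Longrightarrow> Re s > 0 \<Longrightarrow> \<phi> (u + t) s = \<phi> u s + \<phi> t (\<Phi> u s)"
  using semigroup[of t u s] by (simp add: \<phi>_def add.commute)

lemma Re_\<phi>_mono:
  assumes "0 \<le> u" "u \<le> t" "Re s > 0"
  shows "Re (\<phi> u s) \<le> Re (\<phi> t s)"
  using \<phi>_add[of "t - u" u s] Re_\<phi>_nonneg[of "t - u" "\<Phi> u s"] Re_pos[of u s] assms by simp

text \<open>By Harnack's inequality the summands of
  \<open>Re (\<phi> r s) = (\<Sum>k<n. Re (\<phi> (r / n) (\<Phi> (k * r / n) s)))\<close> are all comparable with \<open>Re (\<phi> (r / n) s)\<close>,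
  which is therefore \<open>O(1 / n)\<close>.\<close>

lemma \<phi>_small_right:
  assumes \<epsilon>: "\<epsilon> > 0" and \<eta>: "\<eta> > 0"
  shows "\<exists>r>0. \<forall>u s. 0 \<le> u \<longrightarrow> u \<le> r \<longrightarrow> Re s \<ge> \<epsilon> \<longrightarrow> norm (\<phi> u s) \<le> \<eta>"
proof -
  define c where "c = 3 * (2 / \<epsilon>) * (1 + 2 / \<epsilon>)"
  have c: "c > 0" unfolding c_def using \<epsilon> by (intro mult_pos_pos add_pos_pos divide_pos_pos) auto
  \<comment> \<open>A bound for the real part on \<open>Re s \<ge> \<epsilon>\<close> together with
    one value controls \<open>\<phi> u\<close> there; the value at \<epsilon> is small by continuity
    of the semigroup.\<close>
  have osc: "norm (\<phi> u s) \<le> norm (\<phi> u (of_real \<epsilon>)) + c * K"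
    if "u \<ge> 0" "Re s \<ge> \<epsilon>" "\<And>s. Re s \<ge> \<epsilon> \<Longrightarrow> Re (\<phi> u s) \<le> K" for u s K
  proof -
    have "norm (\<phi> u s - \<phi> u (of_real \<epsilon>)) \<le> c * K"
      unfolding c_def by (rule in_D_oscillation) (use that in_D_\<phi> Re_\<phi>_nonneg \<epsilon> in auto)
    then show ?thesis
      using norm_triangle_ineq[of "\<phi> u s - \<phi> u (of_real \<epsilon>)" "\<phi> u (of_real \<epsilon>)"] by simp
  qed
  obtain r1 where r1: "r1 > 0" "\<And>u. 0 \<le> u \<Longrightarrow> u \<le> r1 \<Longrightarrow> norm (\<phi> u (of_real \<epsilon>)) < 1"
    using near_identity_at[of "of_real \<epsilon>" 1] \<epsilon> by (auto simp: \<phi>_def)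
  obtain K where K: "\<And>s. Re s \<ge> \<epsilon> \<Longrightarrow> norm (\<phi> r1 s) \<le> K"
    using in_D_bounded[OF in_D_\<phi> Re_\<phi>_nonneg \<epsilon>] r1(1) by (meson less_imp_le)
  have K0: "K \<ge> 0" using order_trans[OF norm_ge_zero K[of "of_real \<epsilon>"]] by simp
  have Re_K: "Re (\<phi> u s) \<le> K" if "0 \<le> u" "u \<le> r1" "Re s \<ge> \<epsilon>" for u s
    using Re_\<phi>_mono[of u r1 s] complex_Re_le_cmod[of "\<phi> r1 s"] K[of s] that \<epsilon> by simp
  define R where "R = 1 + c * K"
  have R: "norm (\<phi> u s) \<le> R" if "0 \<le> u" "u \<le> r1" "Re s \<ge> \<epsilon>" for u s
    using osc[of u s K] Re_K r1(2)[of u] that by (simp add: R_def)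
  have R0: "R > 0" using c K0 by (auto simp: R_def intro: add_pos_nonneg)
  \<comment> \<open>Harnack's constant for points at distance at most \<open>R\<close>, which bounds
    the displacement up to time \<open>r1\<close>; the summand 1 accounts for
    \<open>Re (\<phi> h w)\<close> itself.\<close>
  define C where "C = 1 + R / \<epsilon> * (1 + R / \<epsilon>)"
  have C: "C > 0" using R0 \<epsilon> by (auto simp: C_def intro!: add_pos_pos mult_pos_pos divide_pos_pos)
  have small: "real n * Re (\<phi> (r1 / real n) s) \<le> C * K" if n: "n \<ge> 1" and s: "Re s \<ge> \<epsilon>" for n s
  proof -
    define h where "h = r1 / real n"
    have h: "h > 0" "real n * h = r1" using n r1(1) by (auto simp: h_def)
    have "real k * Re (\<phi> h s) \<le> C * Re (\<phi> (real k * h) s)" if "k \<le> n" for k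
      using that
    proof (induction k)
      case 0
      then show ?case using s \<epsilon> by (simp add: \<phi>_def)
    next
      case (Suc k)
      have kh: "0 \<le> real k * h" "real k * h \<le> r1"
        using h Suc.prems mult_right_mono[of "real k" "real n" h] by auto
      define w where "w = \<Phi> (real k * h) s"
      have w: "Re w \<ge> \<epsilon>" using Re_mono[OF kh(1), of s] s \<epsilon> by (simp add: w_def)
      have "norm (s - w) \<le> R" using R[OF kh s] by (simp add: \<phi>_def w_def norm_minus_commute)
      then have "norm (\<phi> h s - \<phi> h w) \<le> R / \<epsilon> * (1 + R / \<epsilon>) * Re (\<phi> h w)"
        by (intro Harnack_half_plane_bounded) (use h hol_\<phi> Re_\<phi>_nonneg \<epsilon> s w in auto)
      then have "Re (\<phi> h s) \<le> C * Re (\<phi> h w)"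
        using complex_Re_le_cmod[of "\<phi> h s - \<phi> h w"] by (simp add: C_def algebra_simps)
      moreover have "\<phi> (real (Suc k) * h) s = \<phi> (real k * h) s + \<phi> h w"
        using \<phi>_add[of h "real k * h" s] h kh s \<epsilon> by (simp add: w_def algebra_simps)
      ultimately show ?case using Suc by (simp add: algebra_simps)
    qed
    from this[of n] have "real n * Re (\<phi> h s) \<le> C * Re (\<phi> r1 s)" using h by simp
    also have "\<dots> \<le> C * K" using Re_K[of r1 s] r1 s C by (intro mult_left_mono) auto
    finally show ?thesis by (simp add: h_def)
  qed
  obtain n where n: "c * (C * K) / (\<eta> / 2) < real n" using reals_Archimedean2 by blast
  have "0 \<le> c * (C * K) / (\<eta> / 2)" using c C K0 \<eta> by simp
  then have n0: "real n > 0" "n \<ge> 1" using n by auto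
  obtain r2 where r2: "r2 > 0" "\<And>u. 0 \<le> u \<Longrightarrow> u \<le> r2 \<Longrightarrow> norm (\<phi> u (of_real \<epsilon>)) < \<eta> / 2"
    using near_identity_at[of "of_real \<epsilon>" "\<eta> / 2"] \<epsilon> \<eta> by (auto simp: \<phi>_def)
  show ?thesis
  proof (intro exI[of _ "min r2 (r1 / real n)"] conjI allI impI)
    show "0 < min r2 (r1 / real n)" using r1 r2 n0 by simp
    fix u s assume u: "0 \<le> u" "u \<le> min r2 (r1 / real n)" and s: "\<epsilon> \<le> Re s"
    have "Re (\<phi> u z) \<le> C * K / real n" if "Re z \<ge> \<epsilon>" for z
    proof -
      have "Re (\<phi> u z) \<le> Re (\<phi> (r1 / real n) z)" using Re_\<phi>_mono[of u "r1 / real n" z] u that \<epsilon> by simp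
      also have "\<dots> \<le> C * K / real n" using small[OF n0(2) that] n0 by (simp add: pos_le_divide_eq mult.commute)
      finally show ?thesis .
    qed
    then have "norm (\<phi> u s) \<le> norm (\<phi> u (of_real \<epsilon>)) + c * (C * K / real n)"
      by (rule osc[OF u(1) s])
    also have "c * (C * K / real n) \<le> \<eta> / 2"
      using n n0 \<eta> by (simp add: divide_less_eq divide_le_eq mult_ac)
    also have "norm (\<phi> u (of_real \<epsilon>)) \<le> \<eta> / 2" using r2(2)[of u] u by simp
    finally show "norm (\<phi> u s) \<le> \<eta>" by simp
  qed
qed

text \<open>The cocycle identity \<open>\<phi>_add\<close> is applied in steps of length
  \<open>r\<close>: the orbit stays in \<open>Re s \<ge> \<epsilon>\<close>, so each step costs at
  most \<eta>.\<close>

lemma \<phi>_linear_growth: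
  assumes r: "r > 0" and \<eta>: "\<And>u s. 0 \<le> u \<Longrightarrow> u \<le> r \<Longrightarrow> Re s \<ge> \<epsilon> \<Longrightarrow> norm (\<phi> u s) \<le> \<eta>"
    and \<epsilon>: "\<epsilon> > 0" and s: "Re s \<ge> \<epsilon>" and u: "u \<ge> 0"
  shows "norm (\<phi> u s) \<le> \<eta> + \<eta> / r * u"
proof -
  have \<eta>0: "\<eta> \<ge> 0" using order_trans[OF norm_ge_zero \<eta>[of 0 s]] r s by simp
  have iter: "norm (\<phi> u s) \<le> real k * \<eta>" if "0 \<le> u" "u \<le> real k * r" "Re s \<ge> \<epsilon>" for k u s
    using that
  proof (induction k arbitrary: u s)
    case 0
    then show ?case using \<epsilon> by (simp add: \<phi>_def)
  next
    case (Suc k)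
    show ?case
    proof (cases "u \<le> r")
      case True
      have "norm (\<phi> u s) \<le> 1 * \<eta>" using \<eta>[of u s] Suc.prems True by simp
      also have "\<dots> \<le> real (Suc k) * \<eta>" using \<eta>0 by (intro mult_right_mono) auto
      finally show ?thesis .
    next
      case False
      have "\<phi> (r + (u - r)) s = \<phi> r s + \<phi> (u - r) (\<Phi> r s)"
        by (rule \<phi>_add) (use False r Suc.prems \<epsilon> in auto)
      moreover have "norm (\<phi> (u - r) (\<Phi> r s)) \<le> real k * \<eta>"
        by (rule Suc.IH) (use False Suc.prems Re_mono[of r s] r \<epsilon> in \<open>auto simp: algebra_simps\<close>)
      moreover have "norm (\<phi> r s) \<le> \<eta>" using \<eta>[of r s] r Suc.prems by simp
      ultimately show ?thesis
        using norm_triangle_ineq[of "\<phi> r s" "\<phi> (u - r) (\<Phi> r s)"] by (simp add: algebra_simps)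
    qed
  qed
  define k where "k = nat \<lceil>u / r\<rceil>"
  have k: "u / r \<le> real k" "real k \<le> u / r + 1"
    using u r ceiling_correct[of "u / r"] by (auto simp: k_def)
  have "norm (\<phi> u s) \<le> real k * \<eta>" by (rule iter) (use k(1) u r s in \<open>auto simp: pos_divide_le_eq\<close>)
  also have "\<dots> \<le> (u / r + 1) * \<eta>" using k(2) \<eta>0 by (rule mult_right_mono)
  finally show ?thesis by (simp add: algebra_simps)
qed

end

section \<open>The resolvent of the displacement\<close>

lemma arith_geometric_sums:
  fixes q :: real
  assumes "0 \<le> q" "q < 1"
  shows "(\<lambda>k. q ^ k * (A + D * real k)) sums (A / (1 - q) + D * q / (1 - q)\<^sup>2)"
proof -
  have "(\<lambda>k. of_nat (Suc k) * q ^ k) sums (1 / (1 - q)\<^sup>2)"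
    by (rule geometric_deriv_sums) (use assms in auto)
  moreover have g: "(\<lambda>k. q ^ k) sums (1 / (1 - q))" by (rule geometric_sums) (use assms in auto)
  ultimately have "(\<lambda>k. (A - D) * q ^ k + D * (of_nat (Suc k) * q ^ k)) sums ((A - D) * (1 / (1 - q)) + D * (1 / (1 - q)\<^sup>2))"
    by (intro sums_add sums_mult)
  moreover have "(A - D) * (1 / (1 - q)) + D * (1 / (1 - q)\<^sup>2) = A / (1 - q) + D * q / (1 - q)\<^sup>2"
  proof -
    define p where "p = 1 - q"
    have p: "p \<noteq> 0" "q = 1 - p" using assms by (auto simp: p_def)
    then show ?thesis unfolding p_def[symmetric] unfolding p(2) by (simp add: field_simps power2_eq_square)
  qed
  moreover have "(\<lambda>k. (A - D) * q ^ k + D * (of_nat (Suc k) * q ^ k)) = (\<lambda>k. q ^ k * (A + D * real k))"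
    by (auto simp: fun_eq_iff algebra_simps)
  ultimately show ?thesis by simp
qed

context G_semigroup
begin

text \<open>Riemann sums for the integral defining \<open>\<rho>\<close>. Below, \<open>\<rho>\<close> is obtained from them by Montel's
  theorem, so nothing has to be integrated in \<open>u\<close>.\<close>

definition discrete_resolvent :: "real \<Rightarrow> real \<Rightarrow> complex \<Rightarrow> complex" where
  "discrete_resolvent \<mu> h s = of_real (1 - exp (- \<mu> * h)) * (\<Sum>k. of_real (exp (- \<mu> * h)) ^ k * \<phi> (real k * h) s)"

lemma \<phi>_growth_right:
  assumes "\<epsilon> > 0"
  obtains C where "C \<ge> 0" "\<And>u s. 0 \<le> u \<Longrightarrow> Re s \<ge> \<epsilon> \<Longrightarrow> norm (\<phi> u s) \<le> C + C * u"
proof -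
  obtain r where r: "r > 0" "\<And>u s. 0 \<le> u \<Longrightarrow> u \<le> r \<Longrightarrow> Re s \<ge> \<epsilon> \<Longrightarrow> norm (\<phi> u s) \<le> 1"
    using \<phi>_small_right[OF assms, of 1] by auto
  define C where "C = max 1 (1 / r)"
  show ?thesis
  proof (rule that[of C])
    fix u s assume us: "(0::real) \<le> u" "Re s \<ge> \<epsilon>"
    have "norm (\<phi> u s) \<le> 1 + 1 / r * u" using \<phi>_linear_growth[OF r assms us(2,1)] .
    also have "\<dots> \<le> C + C * u" using us by (intro add_mono mult_right_mono) (auto simp: C_def)
    finally show "norm (\<phi> u s) \<le> C + C * u" .
  qed (simp add: C_def)
qed

lemma discrete_resolvent_term_bound:
  assumes "h > 0" "Re s > 0" "\<And>u. u \<ge> 0 \<Longrightarrow> norm (\<phi> u s) \<le> A + D * u"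
  shows "norm (of_real (exp (- \<mu> * h)) ^ k * \<phi> (real k * h) s) \<le> exp (- \<mu> * h) ^ k * (A + (D * h) * real k)"
proof -
  have "norm (of_real (exp (- \<mu> * h)) ^ k * \<phi> (real k * h) s) = exp (- \<mu> * h) ^ k * norm (\<phi> (real k * h) s)"
    by (simp add: norm_mult norm_power del: of_real_exp)
  also have "\<dots> \<le> exp (- \<mu> * h) ^ k * (A + D * (real k * h))"
    using assms by (intro mult_left_mono assms) auto
  finally show ?thesis by (simp add: mult_ac)
qed

lemma exp_neg_less_1: "\<mu> > 0 \<Longrightarrow> h > 0 \<Longrightarrow> exp (- \<mu> * h :: real) < 1"
  by simp

lemma discrete_resolvent_summable:
  assumes "\<mu> > 0" "h > 0" "Re s > 0"
  shows "summable (\<lambda>k. of_real (exp (- \<mu> * h)) ^ k * \<phi> (real k * h) s)"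
proof -
  obtain C where "C \<ge> 0" and C: "\<And>u z. 0 \<le> u \<Longrightarrow> Re z \<ge> Re s \<Longrightarrow> norm (\<phi> u z) \<le> C + C * u"
    using \<phi>_growth_right[OF assms(3)] by blast
  show ?thesis
  proof (rule summable_comparison_test'[where N = 0])
    show "summable (\<lambda>k. exp (- \<mu> * h) ^ k * (C + (C * h) * real k))"
      by (rule sums_summable[OF arith_geometric_sums]) (use exp_neg_less_1 assms in auto)
    show "norm (of_real (exp (- \<mu> * h)) ^ k * \<phi> (real k * h) s) \<le> exp (- \<mu> * h) ^ k * (C + (C * h) * real k)" for k
      by (rule discrete_resolvent_term_bound) (use assms C in auto)
  qed
qed

text \<open>Discrete form of \<open>\<mu> \<integral> exp (- \<mu> u) (A + D u) du = A + D /
  \<mu>\<close>; the mesh does not spoil the constant since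
  \<open>h * q / (1 - q) \<le> 1 / \<mu>\<close>.\<close>

lemma discrete_resolvent_bound:
  assumes \<mu>: "\<mu> > 0" and h: "h > 0" and s: "Re s > 0"
    and b: "\<And>u. u \<ge> 0 \<Longrightarrow> norm (\<phi> u s) \<le> A + D * u" and D: "D \<ge> 0"
  shows "norm (discrete_resolvent \<mu> h s) \<le> A + D / \<mu>"
proof -
  define q where "q = exp (- \<mu> * h)"
  have q: "0 < q" "q < 1" using exp_neg_less_1 \<mu> h by (auto simp: q_def)
  have "norm (\<Sum>k. of_real (exp (- \<mu> * h)) ^ k * \<phi> (real k * h) s) \<le> (\<Sum>k. q ^ k * (A + (D * h) * real k))"
    by (rule norm_suminf_le)
       (use discrete_resolvent_term_bound[OF h s b] sums_summable[OF arith_geometric_sums[of q]] q in \<open>auto simp: q_def simp del: of_real_exp\<close>)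
  also have "\<dots> = A / (1 - q) + (D * h) * q / (1 - q)\<^sup>2"
    by (rule sums_unique[symmetric, OF arith_geometric_sums]) (use q in auto)
  finally have "norm (discrete_resolvent \<mu> h s) \<le> (1 - q) * (A / (1 - q) + (D * h) * q / (1 - q)\<^sup>2)"
  proof -
    assume *: "norm (\<Sum>k. of_real (exp (- \<mu> * h)) ^ k * \<phi> (real k * h) s) \<le> A / (1 - q) + (D * h) * q / (1 - q)\<^sup>2"
    have "norm (of_real (1 - exp (- \<mu> * h)) :: complex) = 1 - q" using q by (simp only: norm_of_real q_def[symmetric])
    then show ?thesis
      unfolding discrete_resolvent_def norm_mult using * q by (simp add: mult_left_mono)
  qed
  also have "\<dots> = A + D * (h * q / (1 - q))"
  proof -
    have "p * (A / p + x / p\<^sup>2) = A + x / p" if "p \<noteq> 0" for p x :: real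
      using that by (simp add: field_simps power2_eq_square)
    from this[of "1 - q" "(D * h) * q"] show ?thesis using q by (simp add: mult_ac)
  qed
  also have "h * q / (1 - q) \<le> 1 / \<mu>"
  proof -
    have "1 + \<mu> * h \<le> exp (\<mu> * h)" by (rule exp_ge_add_one_self)
    then have "(1 + \<mu> * h) * q \<le> exp (\<mu> * h) * q" using q by (intro mult_right_mono) auto
    also have "\<dots> = 1" by (simp add: q_def exp_minus)
    finally show ?thesis using \<mu> q by (simp add: field_simps)
  qed
  finally show ?thesis using D by (simp add: mult_left_mono)
qed

lemma discrete_resolvent_holomorphic:
  assumes \<mu>: "\<mu> > 0" and h: "h > 0"
  shows "discrete_resolvent \<mu> h holomorphic_on \<complex>\<^sub>+"
proof -
  define f where "f = (\<lambda>k s. of_real (exp (- \<mu> * h)) ^ k * \<phi> (real k * h) s)"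
  have "(\<lambda>s. \<Sum>k. f k s) holomorphic_on \<complex>\<^sub>+"
  proof (rule holomorphic_uniform_sequence[of _ "\<lambda>n s. \<Sum>k<n. f k s"])
    show "(\<lambda>s. \<Sum>k<n. f k s) holomorphic_on \<complex>\<^sub>+" for n
      unfolding f_def by (intro holomorphic_intros hol_\<phi>) (use h in auto)
    fix s assume s: "s \<in> \<complex>\<^sub>+"
    define d where "d = Re s / 2"
    have d: "d > 0" using s by (simp add: d_def)
    have Re: "Re z \<ge> d" if "z \<in> cball s d" for z
      using abs_Re_le_cmod[of "s - z"] that by (simp add: dist_norm d_def)
    obtain C where C: "C \<ge> 0" "\<And>u z. 0 \<le> u \<Longrightarrow> Re z \<ge> d \<Longrightarrow> norm (\<phi> u z) \<le> C + C * u"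
      using \<phi>_growth_right[OF d] by blast
    have "uniform_limit (cball s d) (\<lambda>n s. \<Sum>k<n. f k s) (\<lambda>s. \<Sum>k. f k s) sequentially"
    proof (rule Weierstrass_m_test)
      show "norm (f k z) \<le> exp (- \<mu> * h) ^ k * (C + (C * h) * real k)" if "z \<in> cball s d" for k z
        unfolding f_def by (rule discrete_resolvent_term_bound[OF h]) (use C(2) Re[OF that] d in auto)
      show "summable (\<lambda>k. exp (- \<mu> * h) ^ k * (C + (C * h) * real k))"
        by (rule sums_summable[OF arith_geometric_sums]) (use exp_neg_less_1 \<mu> h in auto)
    qed
    moreover have "cball s d \<subseteq> \<complex>\<^sub>+" using Re d by force
    ultimately show "\<exists>d>0. cball s d \<subseteq> \<complex>\<^sub>+ \<and> uniform_limit (cball s d) (\<lambda>n s. \<Sum>k<n. f k s) (\<lambda>s. \<Sum>k. f k s) sequentially"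
      using d by blast
  qed simp
  then have "(\<lambda>s. of_real (1 - exp (- \<mu> * h)) * (\<Sum>k. f k s)) holomorphic_on \<complex>\<^sub>+"
    by (intro holomorphic_intros)
  then show ?thesis unfolding discrete_resolvent_def[abs_def] f_def .
qed

text \<open>The sum is split at time \<open>t\<close>, a multiple of the mesh. In the later part
  \<open>\<phi> (t + v) s = \<phi> t s + \<phi> v (\<Phi> t s)\<close> reproduces the resolvent at
  \<open>\<Phi> t s\<close>; the earlier part is a weighted sum of values bounded by
  \<open>M\<close>, with total weight \<open>1 - exp (- \<mu> * t)\<close>.\<close>

lemma discrete_resolvent_shift:
  assumes \<mu>: "\<mu> > 0" and h: "h > 0" and s: "Re s > 0" and t: "t = real m * h"
    and M: "\<And>u. 0 \<le> u \<Longrightarrow> u \<le> t \<Longrightarrow> norm (\<phi> u s) \<le> M"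
  shows "norm (discrete_resolvent \<mu> h s - of_real (exp (- \<mu> * t)) * (discrete_resolvent \<mu> h (\<Phi> t s) + \<phi> t s))
    \<le> (1 - exp (- \<mu> * t)) * M"
proof -
  define q where "q = exp (- \<mu> * h)"
  have q: "0 < q" "q < 1" using exp_neg_less_1 \<mu> h by (auto simp: q_def)
  have qm: "q ^ m = exp (- \<mu> * t)" unfolding q_def t by (simp add: exp_of_nat_mult[symmetric] mult_ac)
  have cqm: "(of_real (exp (- \<mu> * t)) :: complex) = of_real q ^ m"
    unfolding of_real_power[symmetric] qm ..
  have t0: "t \<ge> 0" using t h by simp
  define f where "f = (\<lambda>k. of_real q ^ k * \<phi> (real k * h) s)"
  have sf: "summable f" unfolding f_def using discrete_resolvent_summable[OF \<mu> h s] by (simp only: q_def)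
  define g where "g = (\<lambda>k. of_real q ^ k * \<phi> (real k * h) (\<Phi> t s))"
  have sg: "summable g"
    unfolding g_def using discrete_resolvent_summable[OF \<mu> h Re_pos[OF t0 s]] by (simp only: q_def)
  have geo: "(\<lambda>k. of_real q ^ k :: complex) sums (1 / (1 - of_real q))"
    by (rule geometric_sums) (use q in auto)
  have q1: "1 - of_real q \<noteq> (0::complex)" using q by (metis eq_iff_diff_eq_0 less_irrefl of_real_1 of_real_eq_iff)
  have shift: "f (k + m) = of_real q ^ m * (g k + \<phi> t s * of_real q ^ k)" for k
  proof -
    have "\<phi> (t + real k * h) s = \<phi> t s + \<phi> (real k * h) (\<Phi> t s)"
      by (rule \<phi>_add) (use h t0 s in auto)
    then show ?thesis by (simp add: f_def g_def t algebra_simps power_add)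
  qed
  have "(\<Sum>k. f (k + m)) = of_real q ^ m * ((\<Sum>k. g k) + \<phi> t s * (1 / (1 - of_real q)))"
    unfolding shift
    by (rule sums_unique[symmetric]) (intro sums_mult sums_add summable_sums sg geo)
  moreover have "(\<Sum>k. f k) = (\<Sum>k. f (k + m)) + (\<Sum>k<m. f k)"
    by (rule suminf_split_initial_segment[OF sf])
  ultimately have "(1 - of_real q) * (\<Sum>k. f k) - of_real q ^ m * ((1 - of_real q) * (\<Sum>k. g k) + \<phi> t s) = (1 - of_real q) * (\<Sum>k<m. f k)"
    using q1 by (simp add: algebra_simps divide_simps)
  then have "discrete_resolvent \<mu> h s - of_real (exp (- \<mu> * t)) * (discrete_resolvent \<mu> h (\<Phi> t s) + \<phi> t s) = (1 - of_real q) * (\<Sum>k<m. f k)"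
    unfolding discrete_resolvent_def cqm f_def g_def q_def[symmetric] by simp
  also have "norm \<dots> \<le> (1 - q) * (\<Sum>k<m. q ^ k * M)"
  proof -
    have "norm (1 - of_real q :: complex) = 1 - q"
      using q norm_of_real[of "1 - q", where 'a = complex] by simp
    moreover have "norm (\<Sum>k<m. f k) \<le> (\<Sum>k<m. q ^ k * M)"
    proof (rule sum_norm_le)
      fix k assume "k \<in> {..<m}"
      then have "norm (\<phi> (real k * h) s) \<le> M" using h by (intro M) (auto simp: t)
      then show "norm (f k) \<le> q ^ k * M" using q by (simp add: f_def norm_mult norm_power mult_left_mono)
    qed
    ultimately show ?thesis using q by (simp add: norm_mult mult_left_mono)
  qed
  also have "\<dots> = (1 - q ^ m) * M"
    using q by (simp add: sum_distrib_right[symmetric] sum_gp_strict)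
  finally show ?thesis by (simp add: qm)
qed

text \<open>The meshes \<open>T / 2 ^ n\<close> are dyadic so that each time
  \<open>T / 2 ^ j\<close> is a multiple of all later ones; the inequalities then pass to the limit
  of Montel's subsequence.\<close>

lemma resolvent:
  assumes \<mu>: "\<mu> > 0" and T: "T > 0"
  obtains \<rho> where "\<rho> holomorphic_on \<complex>\<^sub>+"
    "\<And>s A D. Re s > 0 \<Longrightarrow> (\<And>u. u \<ge> 0 \<Longrightarrow> norm (\<phi> u s) \<le> A + D * u) \<Longrightarrow> D \<ge> 0 \<Longrightarrow> norm (\<rho> s) \<le> A + D / \<mu>"
    "\<And>s j t M. Re s > 0 \<Longrightarrow> t = T / 2 ^ j \<Longrightarrow> (\<And>u. 0 \<le> u \<Longrightarrow> u \<le> t \<Longrightarrow> norm (\<phi> u s) \<le> M) \<Longrightarrow>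
       norm (\<rho> s - of_real (exp (- \<mu> * t)) * (\<rho> (\<Phi> t s) + \<phi> t s)) \<le> (1 - exp (- \<mu> * t)) * M"
proof -
  define R where "R = (\<lambda>n. discrete_resolvent \<mu> (T / 2 ^ n))"
  have h: "T / 2 ^ n > 0" for n using T by simp
  obtain \<rho> r where \<rho>: "\<rho> holomorphic_on \<complex>\<^sub>+" "strict_mono r"
      "\<And>x. x \<in> \<complex>\<^sub>+ \<Longrightarrow> (\<lambda>n. R (r n) x) \<longlonglongrightarrow> \<rho> x"
  proof (rule Montel[of "\<complex>\<^sub>+" "range R" R])
    show "f holomorphic_on \<complex>\<^sub>+" if "f \<in> range R" for f
      using that discrete_resolvent_holomorphic[OF \<mu> h] by (auto simp: R_def)
    fix X assume X: "compact X" "X \<subseteq> \<complex>\<^sub>+"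
    show "\<exists>B. \<forall>f\<in>range R. \<forall>z\<in>X. norm (f z) \<le> B"
    proof (cases "X = {}")
      case False
      obtain z0 where z0: "z0 \<in> X" "\<And>z. z \<in> X \<Longrightarrow> Re z0 \<le> Re z"
        using continuous_attains_inf[OF X(1) False, of Re] continuous_on_Re[OF continuous_on_id] by auto
      have "Re z0 > 0" using z0(1) X(2) by auto
      then obtain C where C: "C \<ge> 0" "\<And>u z. 0 \<le> u \<Longrightarrow> Re z \<ge> Re z0 \<Longrightarrow> norm (\<phi> u z) \<le> C + C * u"
        using \<phi>_growth_right by blast
      have "norm (R n z) \<le> C + C / \<mu>" if "z \<in> X" for n z
        unfolding R_def by (rule discrete_resolvent_bound[OF \<mu> h]) (use C z0(2)[OF that] \<open>Re z0 > 0\<close> in auto)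
      then show ?thesis by blast
    qed auto
  qed auto
  show ?thesis
  proof (rule that[OF \<rho>(1)])
    fix s A D assume s: "Re s > 0" and b: "\<And>u. u \<ge> 0 \<Longrightarrow> norm (\<phi> u s) \<le> A + D * u" "(D::real) \<ge> 0"
    have "norm (R n s) \<le> A + D / \<mu>" for n
      unfolding R_def by (rule discrete_resolvent_bound[OF \<mu> h s b])
    moreover have "(\<lambda>n. norm (R (r n) s)) \<longlonglongrightarrow> norm (\<rho> s)"
      using \<rho>(3)[of s] s by (intro tendsto_norm) auto
    ultimately show "norm (\<rho> s) \<le> A + D / \<mu>" by (intro LIMSEQ_le_const2) auto
  next
    fix s j t M assume s: "Re s > 0" and t: "t = T / 2 ^ j"
      and M: "\<And>u. 0 \<le> u \<Longrightarrow> u \<le> t \<Longrightarrow> norm (\<phi> u s) \<le> M"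
    have t0: "t \<ge> 0" using t T by simp
    have "norm (R n s - of_real (exp (- \<mu> * t)) * (R n (\<Phi> t s) + \<phi> t s)) \<le> (1 - exp (- \<mu> * t)) * M" if "n \<ge> j" for n
      unfolding R_def
    proof (rule discrete_resolvent_shift[OF \<mu> h s _ M])
      show "t = real (2 ^ (n - j)) * (T / 2 ^ n)"
      proof -
        have "(2::real) ^ n = 2 ^ (n - j) * 2 ^ j" using that by (simp add: power_add[symmetric])
        then show ?thesis by (simp add: t)
      qed
    qed auto
    moreover have "r n \<ge> n" for n using seq_suble[OF \<rho>(2)] .
    ultimately have "\<exists>N. \<forall>n\<ge>N. norm (R (r n) s - of_real (exp (- \<mu> * t)) * (R (r n) (\<Phi> t s) + \<phi> t s)) \<le> (1 - exp (- \<mu> * t)) * M"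
      using order_trans by blast
    moreover have "(\<lambda>n. norm (R (r n) s - of_real (exp (- \<mu> * t)) * (R (r n) (\<Phi> t s) + \<phi> t s))) \<longlonglongrightarrow>
        norm (\<rho> s - of_real (exp (- \<mu> * t)) * (\<rho> (\<Phi> t s) + \<phi> t s))"
      using \<rho>(3)[of s] \<rho>(3)[of "\<Phi> t s"] Re_pos[OF t0 s] s by (intro tendsto_intros) auto
    ultimately show "norm (\<rho> s - of_real (exp (- \<mu> * t)) * (\<rho> (\<Phi> t s) + \<phi> t s)) \<le> (1 - exp (- \<mu> * t)) * M"
      by (intro LIMSEQ_le_const2)
  qed
qed

end

text \<open>Where \<rho> does not vanish, \<open>|\<rho>|\<close> has the derivative
  \<open>Re (cnj \<rho> * \<rho>') / |\<rho>|\<close> in the real direction, and \<open>ang\<close>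
  bounds it below by \<open>- Re \<rho> / |\<rho>| \<ge> - 1\<close>.\<close>

lemma norm_horizontal_bound:
  assumes hol: "\<rho> holomorphic_on \<complex>\<^sub>+"
    and ang: "\<And>s. Re s > 0 \<Longrightarrow> Re (cnj (1 + deriv \<rho> s) * \<rho> s) \<ge> 0"
    and x: "0 < x" "x \<le> e"
  shows "norm (\<rho> (Complex x y)) \<le> norm (\<rho> (Complex e y)) + (e - x)"
proof (rule field_le_epsilon)
  fix \<delta> :: real assume \<delta>: "\<delta> > 0"
  \<comment> \<open>\<open>|\<rho>|\<close> need not be differentiable at zeros of \<rho>; the
    square root of \<open>|\<rho>|\<^sup>2 + \<delta>\<^sup>2\<close> is, and it exceeds
    \<open>|\<rho>|\<close> by at most \<delta>.\<close>
  define N where "N = (\<lambda>x. (Re (\<rho> (Complex x y)))\<^sup>2 + (Im (\<rho> (Complex x y)))\<^sup>2 + \<delta>\<^sup>2)"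
  have N: "N x = (norm (\<rho> (Complex x y)))\<^sup>2 + \<delta>\<^sup>2" for x by (simp add: N_def cmod_power2)
  have Npos: "N x > 0" for x using \<delta> by (simp add: N add_nonneg_pos)
  have le_sqrt: "norm (\<rho> (Complex x y)) \<le> sqrt (N x)" for x
    unfolding N by (rule real_le_rsqrt) simp
  have "sqrt (N x) + x \<le> sqrt (N e) + e"
  proof (rule DERIV_nonneg_imp_nondecreasing[OF x(2)])
    fix u assume "x \<le> u" "u \<le> e"
    then have u: "u > 0" using x by simp
    define d where "d = deriv \<rho> (Complex u y)"
    define v where "v = \<rho> (Complex u y)"
    have "(\<rho> has_field_derivative d) (at (Complex u y))"
      unfolding d_def by (rule holomorphic_derivI[OF hol]) (use u in auto)
    then have "(\<rho> has_field_derivative d) (at (of_real u + \<i> * of_real y))"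
      by (simp add: Complex_eq)
    then have "((\<rho> \<circ> (\<lambda>x. of_real x + \<i> * of_real y)) has_vector_derivative 1 * d) (at u)"
      by (intro field_vector_diff_chain_at) (auto intro!: derivative_eq_intros)
    then have vd: "((\<lambda>x. \<rho> (Complex x y)) has_vector_derivative d) (at u)"
      by (simp add: o_def Complex_eq)
    have 1: "((\<lambda>x. Re (\<rho> (Complex x y))) has_real_derivative Re d) (at u)"
      unfolding has_real_derivative_iff_has_vector_derivative
      using bounded_linear.has_vector_derivative[OF bounded_linear_Re vd] .
    have 2: "((\<lambda>x. Im (\<rho> (Complex x y))) has_real_derivative Im d) (at u)"
      unfolding has_real_derivative_iff_has_vector_derivative
      using bounded_linear.has_vector_derivative[OF bounded_linear_Im vd] .
    have "(N has_real_derivative (2 * (Re v * Re d + Im v * Im d))) (at u)"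
      unfolding N_def v_def by (rule derivative_eq_intros 1 2 refl | simp)+
    then have "((\<lambda>x. sqrt (N x) + x) has_real_derivative (2 * (Re v * Re d + Im v * Im d)) / (2 * sqrt (N u)) + 1) (at u)"
      using Npos[of u] by (auto intro!: derivative_eq_intros simp: field_simps)
    moreover have "(2 * (Re v * Re d + Im v * Im d)) / (2 * sqrt (N u)) + 1 \<ge> 0"
    proof -
      have "Re (cnj (1 + d) * v) \<ge> 0" using ang[of "Complex u y"] u by (simp add: d_def v_def)
      then have "Re v * Re d + Im v * Im d \<ge> - Re v" by (simp add: algebra_simps)
      moreover have "Re v \<le> sqrt (N u)" using complex_Re_le_cmod[of v] le_sqrt[of u] by (simp add: v_def)
      ultimately have "Re v * Re d + Im v * Im d \<ge> - sqrt (N u)" by simp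
      then show ?thesis using Npos[of u] by (simp add: field_simps)
    qed
    ultimately show "\<exists>D. ((\<lambda>x. sqrt (N x) + x) has_real_derivative D) (at u) \<and> 0 \<le> D" by blast
  qed
  moreover have "sqrt (N e) \<le> norm (\<rho> (Complex e y)) + \<delta>"
    unfolding N by (rule real_le_lsqrt) (use \<delta> in \<open>auto simp: power2_eq_square algebra_simps\<close>)
  ultimately show "norm (\<rho> (Complex x y)) \<le> norm (\<rho> (Complex e y)) + (e - x) + \<delta>"
    using le_sqrt[of x] by simp
qed

section \<open>The displacement up to the boundary\<close>

context G_semigroup
begin

text \<open>Formally \<open>(1 + \<rho>') H = \<mu> \<rho>\<close> with \<open>H\<close> the generator of the semigroup, and \<open>Re H \<ge> 0\<close>.\<close>

lemma resolvent_angle: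
  assumes \<mu>: "\<mu> > 0" and T: "T > 0" and hol: "\<rho> holomorphic_on \<complex>\<^sub>+"
    and res: "\<And>s j t M. Re s > 0 \<Longrightarrow> t = T / 2 ^ j \<Longrightarrow> (\<And>u. 0 \<le> u \<Longrightarrow> u \<le> t \<Longrightarrow> norm (\<phi> u s) \<le> M) \<Longrightarrow>
       norm (\<rho> s - of_real (exp (- \<mu> * t)) * (\<rho> (\<Phi> t s) + \<phi> t s)) \<le> (1 - exp (- \<mu> * t)) * M"
    and s: "Re s > 0"
  shows "Re (cnj (1 + deriv \<rho> s) * \<rho> s) \<ge> 0"
proof -
  define t where "t = (\<lambda>n. T / 2 ^ n)"
  have t: "t n > 0" for n using T by (simp add: t_def)
  have t0: "t \<longlonglongrightarrow> 0" unfolding t_def by real_asymp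
  define w where "w = (\<lambda>n. \<phi> (t n) s)"
  define E where "E = (\<lambda>n. exp (\<mu> * t n))"
  have E: "E n > 1" for n using \<mu> t by (simp add: E_def)
  \<comment> \<open>The defect in \<open>\<rho> (\<Phi> t s) - \<rho> s + w = (E - 1) * (\<rho> s +
    \<theta>)\<close>, a finite-difference form of
    \<open>(1 + \<rho>') H = \<mu> \<rho>\<close>.\<close>
  define \<theta> where "\<theta> = (\<lambda>n. (\<rho> (\<Phi> (t n) s) + w n - of_real (E n) * \<rho> s) / of_real (E n - 1))"
  have small: "\<forall>\<^sub>F n in sequentially. \<forall>u. 0 \<le> u \<longrightarrow> u \<le> t n \<longrightarrow> norm (\<phi> u s) \<le> \<delta>" if \<delta>: "\<delta> > 0" for \<delta>
  proof -
    obtain r where r: "r > 0" "\<And>u. 0 \<le> u \<Longrightarrow> u \<le> r \<Longrightarrow> norm (\<Phi> u s - s) < \<delta>"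
      using near_identity_at[OF s \<delta>] by blast
    have "\<forall>\<^sub>F n in sequentially. t n < r" using order_tendstoD(2)[OF t0 r(1)] .
    then show ?thesis by eventually_elim (use r(2) in \<open>force simp: \<phi>_def\<close>)
  qed
  have w0: "w \<longlonglongrightarrow> 0"
  proof (rule tendstoI)
    fix e :: real assume "e > 0"
    then have "\<forall>\<^sub>F n in sequentially. \<forall>u. 0 \<le> u \<longrightarrow> u \<le> t n \<longrightarrow> norm (\<phi> u s) \<le> e / 2" by (intro small) simp
    then show "\<forall>\<^sub>F n in sequentially. dist (w n) 0 < e"
    proof eventually_elim
      case (elim n)
      then have "norm (w n) \<le> e / 2" using t[of n] by (simp add: w_def)
      then show ?case using \<open>e > 0\<close> by simp
    qed
  qed
  have \<theta>0: "\<theta> \<longlonglongrightarrow> 0"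
  proof (rule tendstoI)
    fix e :: real assume e: "e > 0"
    then have "\<forall>\<^sub>F n in sequentially. \<forall>u. 0 \<le> u \<longrightarrow> u \<le> t n \<longrightarrow> norm (\<phi> u s) \<le> e / 2" by (intro small) simp
    then show "\<forall>\<^sub>F n in sequentially. dist (\<theta> n) 0 < e"
    proof eventually_elim
      case (elim n)
      have inv: "exp (- \<mu> * t n) = 1 / E n" by (simp add: E_def exp_minus field_simps)
      have "norm (\<rho> s - of_real (exp (- \<mu> * t n)) * (\<rho> (\<Phi> (t n) s) + \<phi> (t n) s)) \<le> (1 - exp (- \<mu> * t n)) * (e / 2)"
        by (rule res[OF s]) (use elim in \<open>auto simp: t_def\<close>)
      also have "\<rho> s - of_real (exp (- \<mu> * t n)) * (\<rho> (\<Phi> (t n) s) + \<phi> (t n) s)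
          = - (\<theta> n * of_real ((E n - 1) / E n))"
        unfolding inv using E[of n] by (simp add: \<theta>_def w_def field_simps)
      also have "norm \<dots> = norm (\<theta> n) * ((E n - 1) / E n)"
        using E[of n] unfolding norm_minus_cancel norm_mult norm_of_real by simp
      also have "(1 - exp (- \<mu> * t n)) * (e / 2) = e / 2 * ((E n - 1) / E n)"
        unfolding inv using E[of n] by (simp add: field_simps)
      finally have "norm (\<theta> n) \<le> e / 2" 
        by (rule mult_right_le_imp_le) (use E[of n] in simp)
      then show ?case using e by simp
    qed
  qed
  have "(\<rho> has_field_derivative deriv \<rho> s) (at s)"
    by (rule holomorphic_derivI[OF hol]) (use s in auto)
  \<comment> \<open>Caratheodory's form of the derivative avoids dividing by \<open>w n\<close>,
    which may be 0.\<close>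
  then obtain g where g: "\<And>z. \<rho> z - \<rho> s = g z * (z - s)" "isCont g s" "g s = deriv \<rho> s"
    using CARAT_DERIV by metis
  have "(\<lambda>n. s + w n) \<longlonglongrightarrow> s + 0" by (intro tendsto_intros w0)
  then have gl: "(\<lambda>n. g (s + w n)) \<longlonglongrightarrow> deriv \<rho> s"
    using isCont_tendsto_compose[OF g(2)] g(3) by simp
  have "(\<lambda>n. Re (cnj (1 + g (s + w n)) * (\<rho> s + \<theta> n))) \<longlonglongrightarrow> Re (cnj (1 + deriv \<rho> s) * (\<rho> s + 0))"
    by (intro tendsto_intros gl \<theta>0)
  moreover have "Re (cnj (1 + g (s + w n)) * (\<rho> s + \<theta> n)) \<ge> 0" for n
  proof -
    have "\<rho> (\<Phi> (t n) s) - \<rho> s = g (s + w n) * w n"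
      using g(1)[of "s + w n"] by (simp add: w_def \<phi>_def)
    then have "(1 + g (s + w n)) * w n = of_real (E n - 1) * (\<rho> s + \<theta> n)"
      using E[of n] by (simp add: \<theta>_def field_simps)
    then have "\<rho> s + \<theta> n = (1 + g (s + w n)) * w n / of_real (E n - 1)"
      using E[of n] by (simp add: field_simps)
    \<comment> \<open>After multiplication by the conjugate, the right-hand side is a nonnegative
      multiple of \<open>w n\<close>, whose real part is nonnegative.\<close>
    then have "cnj (1 + g (s + w n)) * (\<rho> s + \<theta> n)
        = of_real ((norm (1 + g (s + w n)))\<^sup>2) * w n / of_real (E n - 1)"
      unfolding complex_norm_square by (simp only: times_divide_eq_right mult_ac)
    also have "\<dots> = of_real ((norm (1 + g (s + w n)))\<^sup>2 / (E n - 1)) * w n" by simp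
    finally have "Re (cnj (1 + g (s + w n)) * (\<rho> s + \<theta> n)) = (norm (1 + g (s + w n)))\<^sup>2 / (E n - 1) * Re (w n)"
      by (simp only: times_complex.sel Re_complex_of_real Im_complex_of_real mult_zero_left diff_zero)
    also have "\<dots> \<ge> 0"
      using E[of n] Re_\<phi>_nonneg[of "t n" s] t[of n] s by (intro mult_nonneg_nonneg divide_nonneg_pos) (auto simp: w_def)
    finally show ?thesis .
  qed
  ultimately show ?thesis using LIMSEQ_le_const by fastforce
qed

text \<open>At a fixed \<open>s\<close> the supremum \<open>m\<close> of \<open>|\<phi> u s|\<close>
  over \<open>u \<le> r\<close> satisfies \<open>m \<le> 15 / 2 * e + m / 2\<close>. It is finite,
  so the last term can be absorbed, and neither \<open>r\<close> nor \<open>e\<close> depends on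
  \<open>s\<close>.\<close>

theorem \<phi>_small:
  assumes \<eta>: "\<eta> > 0"
  shows "\<exists>r>0. \<forall>u s. 0 \<le> u \<longrightarrow> u \<le> r \<longrightarrow> Re s > 0 \<longrightarrow> norm (\<phi> u s) \<le> \<eta>"
proof -
  \<comment> \<open>The two values of \<rho> contribute
    \<open>3 / 2 * (3 * e) + 3 * e = 15 / 2 * e\<close>, which the absorption doubles.\<close>
  define e where "e = \<eta> / 15"
  have e: "e > 0" using \<eta> by (simp add: e_def)
  obtain r0 where r0: "r0 > 0" "\<And>u s. 0 \<le> u \<Longrightarrow> u \<le> r0 \<Longrightarrow> Re s \<ge> e \<Longrightarrow> norm (\<phi> u s) \<le> e"
    using \<phi>_small_right[OF e e] by blast
  \<comment> \<open>With this rate the linear growth of \<phi> at speed \<open>e / r0\<close> adds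
    exactly \<open>e\<close> to the bound for \<rho>.\<close>
  define \<mu> where "\<mu> = 1 / r0"
  have \<mu>: "\<mu> > 0" using r0 by (simp add: \<mu>_def)
  \<comment> \<open>Up to this time \<open>exp (\<mu> * t) \<le> 3 / 2\<close>, so the error in the
    resolvent identity is at most \<open>m / 2\<close>.\<close>
  define r where "r = r0 * ln (3 / 2)"
  have r: "r > 0" using r0 by (simp add: r_def)
  have E_le: "exp (\<mu> * t) \<le> 3 / 2" if "t \<le> r" for t
  proof -
    have "\<mu> * t \<le> ln (3 / 2)" using that r0 by (simp add: \<mu>_def r_def divide_le_eq mult.commute)
    then have "exp (\<mu> * t) \<le> exp (ln (3 / 2 :: real))" by (simp only: exp_le_cancel_iff)
    then show ?thesis by simp
  qed
  show ?thesis
  proof (intro exI[of _ r] conjI r allI impI)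
    fix u s assume u: "0 \<le> u" "u \<le> r" and s: "0 < Re s"
    obtain C where C: "C \<ge> 0" "\<And>u z. 0 \<le> u \<Longrightarrow> Re z \<ge> Re s \<Longrightarrow> norm (\<phi> u z) \<le> C + C * u"
      using \<phi>_growth_right[OF s] by blast
    define m where "m = (SUP u\<in>{0..r}. norm (\<phi> u s))"
    have bdd: "bdd_above ((\<lambda>u. norm (\<phi> u s)) ` {0..r})"
    proof (rule bdd_aboveI2)
      fix u assume "u \<in> {0..r}"
      then show "norm (\<phi> u s) \<le> C + C * r"
        using C(2)[of u s] C(1) mult_left_mono[of u r C] by simp
    qed
    have m: "norm (\<phi> u s) \<le> m" if "0 \<le> u" "u \<le> r" for u
      unfolding m_def by (rule cSUP_upper[OF _ bdd]) (use that in simp)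
    have m0: "m \<ge> 0" using order_trans[OF norm_ge_zero m[OF u]] .
    have "norm (\<phi> t s) \<le> 15 / 2 * e + m / 2" if t: "t > 0" "t \<le> r" for t
    proof -
      obtain \<rho> where \<rho>: "\<rho> holomorphic_on \<complex>\<^sub>+"
        and b: "\<And>s A D. Re s > 0 \<Longrightarrow> (\<And>u. u \<ge> 0 \<Longrightarrow> norm (\<phi> u s) \<le> A + D * u) \<Longrightarrow> D \<ge> 0 \<Longrightarrow> norm (\<rho> s) \<le> A + D / \<mu>"
        and res: "\<And>s j t' M. Re s > 0 \<Longrightarrow> t' = t / 2 ^ j \<Longrightarrow> (\<And>u. 0 \<le> u \<Longrightarrow> u \<le> t' \<Longrightarrow> norm (\<phi> u s) \<le> M) \<Longrightarrow>
          norm (\<rho> s - of_real (exp (- \<mu> * t')) * (\<rho> (\<Phi> t' s) + \<phi> t' s)) \<le> (1 - exp (- \<mu> * t')) * M"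
        using resolvent[OF \<mu> t(1)] by metis
      have right: "norm (\<rho> z) \<le> 2 * e" if z: "Re z \<ge> e" for z
      proof -
        have "norm (\<rho> z) \<le> e + e / r0 / \<mu>"
          by (rule b) (use z e r0 \<phi>_linear_growth[OF r0 e z] in auto)
        also have "e / r0 / \<mu> = e" using r0 by (simp add: \<mu>_def)
        finally show ?thesis by simp
      qed
      \<comment> \<open>Moving from \<open>Re z = e\<close> towards the boundary adds at most the
        distance \<open>e\<close> to the bound \<open>2 * e\<close>.\<close>
      have \<rho>3: "norm (\<rho> z) \<le> 3 * e" if z: "Re z > 0" for z
      proof (cases "Re z \<ge> e")
        case True
        then show ?thesis using right[OF True] e by simp
      next
        case False
        have "norm (\<rho> (Complex (Re z) (Im z))) \<le> norm (\<rho> (Complex e (Im z))) + (e - Re z)"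
          by (rule norm_horizontal_bound[OF \<rho> resolvent_angle[OF \<mu> t(1) \<rho> res]]) (use z False in auto)
        then show ?thesis using right[of "Complex e (Im z)"] z by simp
      qed
      define E where "E = exp (\<mu> * t)"
      have E: "1 \<le> E" "E \<le> 3 / 2" using E_le[OF t(2)] \<mu> t by (auto simp: E_def)
      have inv: "exp (- \<mu> * t) = 1 / E" by (simp add: E_def exp_minus field_simps)
      have "norm (\<rho> s - of_real (exp (- \<mu> * t)) * (\<rho> (\<Phi> t s) + \<phi> t s)) \<le> (1 - exp (- \<mu> * t)) * m"
        by (rule res[OF s, of t 0]) (use m t in auto)
      then have "E * norm (\<rho> s - of_real (1 / E) * (\<rho> (\<Phi> t s) + \<phi> t s)) \<le> E * ((1 - 1 / E) * m)"
        unfolding inv using E by (intro mult_left_mono) auto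
      also have "E * ((1 - 1 / E) * m) = (E - 1) * m" using E by (simp add: field_simps)
      also have "E * norm (\<rho> s - of_real (1 / E) * (\<rho> (\<Phi> t s) + \<phi> t s)) = norm (of_real E * \<rho> s - \<rho> (\<Phi> t s) - \<phi> t s)"
      proof -
        have "of_real E * \<rho> s - \<rho> (\<Phi> t s) - \<phi> t s = of_real E * (\<rho> s - of_real (1 / E) * (\<rho> (\<Phi> t s) + \<phi> t s))"
          using E by (simp add: field_simps)
        then show ?thesis using E by (simp only: norm_mult norm_of_real)
      qed
      finally have 1: "norm (of_real E * \<rho> s - \<rho> (\<Phi> t s) - \<phi> t s) \<le> (E - 1) * m" .
      have "\<phi> t s = of_real E * \<rho> s - \<rho> (\<Phi> t s) - (of_real E * \<rho> s - \<rho> (\<Phi> t s) - \<phi> t s)" by simp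
      then have "norm (\<phi> t s) \<le> norm (of_real E * \<rho> s) + norm (\<rho> (\<Phi> t s)) + norm (of_real E * \<rho> s - \<rho> (\<Phi> t s) - \<phi> t s)"
        by (smt (verit) norm_triangle_ineq4)
      also have "norm (of_real E * \<rho> s) \<le> 3 / 2 * (3 * e)"
        unfolding norm_mult using E \<rho>3[OF s] by (intro mult_mono) auto
      also have "norm (\<rho> (\<Phi> t s)) \<le> 3 * e" by (rule \<rho>3) (use Re_pos[of t s] t s in auto)
      also have "norm (of_real E * \<rho> s - \<rho> (\<Phi> t s) - \<phi> t s) \<le> 1 / 2 * m"
        using 1 mult_right_mono[of "E - 1" "1 / 2" m] E m0 by simp
      finally show ?thesis by simp
    qed
    moreover have "norm (\<phi> 0 s) \<le> 15 / 2 * e + m / 2" using s e m0 by (simp add: \<phi>_def)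
    ultimately have *: "norm (\<phi> t s) \<le> 15 / 2 * e + m / 2" if "t \<in> {0..r}" for t
      using that by (cases "t = 0") auto
    have "m \<le> 15 / 2 * e + m / 2"
      unfolding m_def by (rule cSUP_least) (use * r in \<open>auto simp: m_def\<close>)
    then have "m \<le> \<eta>" by (simp add: e_def)
    then show "norm (\<phi> u s) \<le> \<eta>" using m[OF u] by simp
  qed
qed

lemma \<phi>_bounded:
  assumes t: "t \<ge> 0"
  shows "\<exists>K. \<forall>s. Re s > 0 \<longrightarrow> norm (\<phi> t s) \<le> K"
proof -
  obtain r where r: "r > 0" "\<And>u s. 0 \<le> u \<Longrightarrow> u \<le> r \<Longrightarrow> Re s > 0 \<Longrightarrow> norm (\<phi> u s) \<le> 1"
    using \<phi>_small[of 1] by auto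
  have "norm (\<phi> t s) \<le> 1 + 1 / r * t" if s: "Re s > 0" for s
    \<comment> \<open>The growth bound is taken with \<open>\<epsilon> = Re s\<close>; its constants
      are the same for every \<open>s\<close>.\<close>
    by (rule \<phi>_linear_growth[OF r(1) _ s order_refl t]) (use r(2) s in auto)
  then show ?thesis by blast
qed

end

section \<open>The algebra \<open>\<A>\<close> and the theorem\<close>

lemma uniformly_continuous_on_subset:
  fixes f :: "'a::metric_space \<Rightarrow> 'b::metric_space"
  shows "uniformly_continuous_on S f \<Longrightarrow> U \<subseteq> S \<Longrightarrow> uniformly_continuous_on U f"
  unfolding uniformly_continuous_on_def by (meson subsetD)

lemma in_A_cong:
  assumes "in_A f" "\<And>s. s \<in> \<complex>\<^sub>+ \<Longrightarrow> f s = g s"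
  shows "in_A g"
proof -
  have "uniformly_continuous_on \<complex>\<^sub>+ g"
    using assms unfolding in_A_def uniformly_continuous_on_def by auto
  then show ?thesis
    using assms unfolding in_A_def dirichlet_sums_on_def by auto
qed

lemma in_A_holomorphic: "in_A f \<Longrightarrow> f holomorphic_on \<complex>\<^sub>+"
  using dirichlet_sums_on_holomorphic by (auto simp: in_A_def)

text \<open>From a point of the strip \<open>0 < Re s < 3\<close> one reaches \<open>Re s \<ge> 3\<close> in boundedly many steps of
  size less than the modulus of uniform continuity for \<open>1\<close>.\<close>

lemma in_A_bounded:
  assumes "in_A f"
  obtains B where "\<And>s. Re s > 0 \<Longrightarrow> norm (f s) \<le> B"
proof -
  obtain a where a: "dirichlet_sums_on a f \<complex>\<^sub>+" using assms by (auto simp: in_A_def)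
  obtain A where A: "\<And>s. Re s \<ge> 3 \<Longrightarrow> norm (f s) \<le> A"
    using dirichlet_abs_bounded[OF dirichlet_sums_on_imp_abs[OF a]] by auto
  obtain d where d: "d > 0" "\<And>s s'. Re s > 0 \<Longrightarrow> Re s' > 0 \<Longrightarrow> dist s' s < d \<Longrightarrow> dist (f s') (f s) < 1"
    using assms unfolding in_A_def uniformly_continuous_on_def by (metis mem_half_plane zero_less_one)
  obtain n where n: "3 / d < real n" using reals_Archimedean2 by blast
  have n0: "real n > 0" using n d(1) by (smt (verit) divide_pos_pos)
  define h where "h = 3 / real n"
  have h: "h > 0" "h < d" "real n * h = 3" using n n0 d(1) by (auto simp: h_def field_simps)
  have iter: "norm (f s - f (s + of_real (real k * h))) \<le> real k" if s: "Re s > 0" for s k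
  proof (induction k)
    case (Suc k)
    define z where "z = s + of_real (real k * h)"
    have "z + of_real h = s + of_real (real (Suc k) * h)" by (simp add: z_def algebra_simps)
    moreover have "dist (f z) (f (z + of_real h)) < 1"
      by (rule d(2)) (use s h in \<open>auto simp: z_def dist_norm intro!: add_pos_nonneg\<close>)
    ultimately have "norm (f z - f (s + of_real (real (Suc k) * h))) < 1" by (simp add: dist_norm)
    then show ?case
      using Suc norm_triangle_ineq[of "f s - f z" "f z - f (s + of_real (real (Suc k) * h))"] by (simp add: z_def)
  qed simp
  show ?thesis
  proof (rule that[of "real n + A"])
    fix s assume s: "Re s > 0"
    have "norm (f s - f (s + of_real 3)) \<le> real n" using iter[OF s, of n] by (simp only: h)
    moreover have "norm (f (s + of_real 3)) \<le> A" by (rule A) (use s in simp)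
    ultimately show "norm (f s) \<le> real n + A"
      using norm_triangle_ineq[of "f s - f (s + of_real 3)" "f (s + of_real 3)"] by simp
  qed
qed

text \<open>The test function from which \<open>\<Phi> t\<close> is recovered; its derivative is
  bounded by \<open>ln 2\<close> on the half-plane.\<close>

lemma in_A_two_powr: "in_A (\<lambda>s. 2 powr - s)"
proof -
  have "(\<lambda>n. (if Suc n = 2 then 1 else 0) * of_nat (Suc n) powr - s) sums (2 powr - s)" for s :: complex
  proof -
    have "(\<lambda>n. (if Suc n = 2 then 1 else 0) * of_nat (Suc n) powr - s) = (\<lambda>n. if n = 1 then 2 powr - s else 0)"
      by (auto simp: fun_eq_iff)
    then show ?thesis using sums_single[of 1 "\<lambda>_. 2 powr - s"] by simp
  qed
  then have "dirichlet_sums_on (\<lambda>n. if n = 2 then 1 else 0) (\<lambda>s. 2 powr - s) \<complex>\<^sub>+"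
    unfolding dirichlet_sums_on_def by blast
  moreover have "uniformly_continuous_on \<complex>\<^sub>+ (\<lambda>s::complex. 2 powr - s)"
    unfolding uniformly_continuous_on_def
  proof (intro allI impI)
    fix e :: real assume e: "e > 0"
    have lip: "norm (2 powr - z - 2 powr - w :: complex) \<le> ln 2 * norm (z - w)" if "z \<in> \<complex>\<^sub>+" "w \<in> \<complex>\<^sub>+" for z w
    proof (rule field_differentiable_bound[OF convex_half_plane, where f' = "\<lambda>s. - (of_real (ln 2) * 2 powr - s)"])
      fix s assume s: "s \<in> \<complex>\<^sub>+"
      have "((\<lambda>s::complex. exp (- (of_real (ln 2) * s))) has_field_derivative - (of_real (ln 2) * exp (- (of_real (ln 2) * s)))) (at s within \<complex>\<^sub>+)"
        by (auto intro!: derivative_eq_intros)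
      moreover have "2 powr - s = exp (- (of_real (ln 2) * s))" for s :: complex
        using nat_powr_eq_exp[of 2 "- s"] by simp
      ultimately show "((\<lambda>s::complex. 2 powr - s) has_field_derivative - (of_real (ln 2) * 2 powr - s)) (at s within \<complex>\<^sub>+)"
        by presburger
      have "norm (2 powr - s :: complex) = 2 powr - Re s" using norm_nat_powr[of 2 "- s"] by simp
      also have "\<dots> \<le> 2 powr 0" using s by (intro powr_mono) auto
      finally show "norm (- (of_real (ln 2) * 2 powr - s) :: complex) \<le> ln 2" by (simp add: norm_mult)
    qed (use that in auto)
    show "\<exists>d>0. \<forall>x\<in>\<complex>\<^sub>+. \<forall>x'\<in>\<complex>\<^sub>+. dist x' x < d \<longrightarrow> dist (2 powr - x' :: complex) (2 powr - x) < e"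
    proof (intro exI[of _ "e / ln 2"] conjI ballI impI)
      fix x x' assume x: "x \<in> \<complex>\<^sub>+" "x' \<in> \<complex>\<^sub>+" "dist x' x < e / ln 2"
      have "ln 2 * norm (x' - x) < e" using x(3) by (simp add: dist_norm pos_less_divide_eq mult.commute)
      then show "dist (2 powr - x' :: complex) (2 powr - x) < e"
        using lip[OF x(2,1)] by (simp add: dist_norm)
    qed (use e in simp)
  qed
  ultimately show ?thesis by (auto simp: in_A_def)
qed

text \<open>\<open>2 powr - \<Phi>\<close> determines \<open>\<Phi>\<close> up to multiples of \<open>2 \<pi> i / ln 2\<close>; along the segment from \<open>s\<close> to \<open>s'\<close> the
  multiple cannot change.\<close>

lemma uniformly_continuous_on_strip_of_two_powr:
  assumes \<Phi>: "continuous_on \<complex>\<^sub>+ \<Phi>"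
    and g: "uniformly_continuous_on \<complex>\<^sub>+ (\<lambda>s. 2 powr - \<Phi> s)"
  shows "uniformly_continuous_on {s\<in>\<complex>\<^sub>+. Re (\<Phi> s) < M} \<Phi>"
  unfolding uniformly_continuous_on_def
proof (intro allI impI)
  fix e :: real assume e: "e > 0"
  have "isCont Ln 1" by (rule continuous_at_Ln) auto
  then obtain \<eta>0 where \<eta>0: "\<eta>0 > 0" "\<And>z. dist z 1 < \<eta>0 \<Longrightarrow> dist (Ln z) (Ln 1) < e * ln 2"
    unfolding continuous_at_eps_delta using e by (metis mult_pos_pos ln_gt_zero one_less_numeral_iff semiring_norm(76))
  define \<eta> where "\<eta> = min \<eta>0 (1 / 2)"
  have \<eta>: "\<eta> > 0" "\<eta> \<le> \<eta>0" "\<eta> \<le> 1 / 2" using \<eta>0 by (auto simp: \<eta>_def)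
  have two: "2 powr z = exp (of_real (ln 2) * z)" for z :: complex
    using nat_powr_eq_exp[of 2 z] by simp
  \<comment> \<open>Where \<open>Re \<Phi> < M\<close>, the modulus of
    \<open>2 powr - \<Phi>\<close> exceeds \<open>2 powr - M\<close>, so this absolute bound becomes
    a relative error below \<eta>.\<close>
  obtain d where d: "d > 0" "\<And>s s'. s \<in> \<complex>\<^sub>+ \<Longrightarrow> s' \<in> \<complex>\<^sub>+ \<Longrightarrow> dist s' s < d \<Longrightarrow>
      dist (2 powr - \<Phi> s') (2 powr - \<Phi> s) < \<eta> * 2 powr - M"
    using g \<eta>(1) unfolding uniformly_continuous_on_def by (metis mult_pos_pos powr_gt_zero zero_neq_numeral)
  show "\<exists>d>0. \<forall>s\<in>{s\<in>\<complex>\<^sub>+. Re (\<Phi> s) < M}. \<forall>s'\<in>{s\<in>\<complex>\<^sub>+. Re (\<Phi> s) < M}. dist s' s < d \<longrightarrow> dist (\<Phi> s') (\<Phi> s) < e"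
  proof (intro exI[of _ d] conjI d(1) ballI impI)
    fix s s' assume s: "s \<in> {s\<in>\<complex>\<^sub>+. Re (\<Phi> s) < M}" and s': "s' \<in> {s\<in>\<complex>\<^sub>+. Re (\<Phi> s) < M}" and ds: "dist s' s < d"
    define S where "S = closed_segment s s'"
    have S: "S \<subseteq> \<complex>\<^sub>+" unfolding S_def by (rule closed_segment_subset) (use s s' in auto)
    \<comment> \<open>Dividing by the value at \<open>s\<close> uses the bound \<open>M\<close> at
      this end point only; intermediate points of the segment may leave the region
      \<open>Re \<Phi> < M\<close>.\<close>
    define q where "q = (\<lambda>z. 2 powr - (\<Phi> z - \<Phi> s) :: complex)"
    have q1: "dist (q z) 1 < \<eta>" if z: "z \<in> S" for z
    proof -
      have "dist z s \<le> dist s' s"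
        using z segment_bound1[of z s s'] by (simp add: S_def dist_norm)
      then have "dist (2 powr - \<Phi> z) (2 powr - \<Phi> s) < \<eta> * 2 powr - M"
        using d(2)[of s z] z S s ds by auto
      also have "\<dots> \<le> \<eta> * 2 powr - Re (\<Phi> s)"
        using s \<eta>(1) by (intro mult_left_mono powr_mono) auto
      finally have "norm (2 powr - \<Phi> z - 2 powr - \<Phi> s) < \<eta> * 2 powr - Re (\<Phi> s)" by (simp add: dist_norm)
      moreover have "2 powr - \<Phi> z - 2 powr - \<Phi> s = (q z - 1) * 2 powr - \<Phi> s"
        by (simp add: q_def two exp_add[symmetric] algebra_simps)
      moreover have "norm (2 powr - \<Phi> s) = 2 powr - Re (\<Phi> s)"
        using norm_nat_powr[of 2 "- \<Phi> s"] by simp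
      ultimately show ?thesis by (simp add: norm_mult dist_norm)
    qed
    have q_nonneg: "q z \<notin> \<real>\<^sub>\<le>\<^sub>0" if "z \<in> S" for z
    proof -
      have "Re (1 - q z) < 1"
        using q1[OF that] complex_Re_le_cmod[of "1 - q z"] \<eta> by (simp add: dist_norm norm_minus_commute)
      then show ?thesis by (auto simp: complex_nonpos_Reals_iff)
    qed
    \<comment> \<open>\<open>L\<close> takes values in the integer multiples of
      \<open>2 * pi * \<i>\<close> and is continuous on the segment, so it is constantly
      \<open>L s = 0\<close>; hence the principal logarithm of \<open>q\<close> determines
      \<open>\<Phi> z - \<Phi> s\<close>.\<close>
    define L where "L = (\<lambda>z. of_real (ln 2) * (\<Phi> z - \<Phi> s) + Ln (q z))"
    have contq: "continuous_on S q"
      unfolding q_def two by (intro continuous_intros continuous_on_subset[OF \<Phi> S])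
    have expL: "exp (L z) = 1" if "z \<in> S" for z
    proof -
      have "q z \<noteq> 0" using q_nonneg[OF that] by auto
      then have "exp (L z) = exp (of_real (ln 2) * (\<Phi> z - \<Phi> s)) * q z" by (simp add: L_def exp_add)
      also have "\<dots> = 1" by (simp add: q_def two exp_add[symmetric] algebra_simps)
      finally show ?thesis .
    qed
    have "L constant_on S"
    proof (rule continuous_discrete_range_constant)
      show "connected S" by (simp add: S_def)
      show "continuous_on S L"
        unfolding L_def by (intro continuous_intros continuous_on_subset[OF \<Phi> S] contq) (use q_nonneg in auto)
      fix x assume x: "x \<in> S"
      show "\<exists>e>0. \<forall>y. y \<in> S \<and> L y \<noteq> L x \<longrightarrow> e \<le> norm (L y - L x)"
      proof (intro exI[of _ "2 * pi"] conjI allI impI)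
        fix y assume y: "y \<in> S \<and> L y \<noteq> L x"
        then have "exp (L y) = exp (L x)" using expL x by simp
        then obtain n :: int where n: "L y = L x + (of_int (2 * n) * pi) * \<i>" unfolding exp_eq by blast
        then have "n \<noteq> 0" using y by auto
        then have "1 \<le> \<bar>real_of_int n\<bar>" by linarith
        have "norm (L y - L x) = \<bar>real_of_int n\<bar> * (2 * pi)" unfolding n by (simp add: norm_mult)
        also have "\<dots> \<ge> 1 * (2 * pi)" by (intro mult_right_mono \<open>1 \<le> \<bar>real_of_int n\<bar>\<close>) simp
        finally show "2 * pi \<le> norm (L y - L x)" by simp
      qed simp
    qed
    moreover have "L s = 0" by (simp add: L_def q_def two)
    ultimately have "L s' = 0"
      unfolding constant_on_def by (metis S_def ends_in_segment)
    then have "of_real (ln 2) * (\<Phi> s' - \<Phi> s) = - Ln (q s')" by (simp add: L_def eq_neg_iff_add_eq_0)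
    then have "norm (of_real (ln 2) * (\<Phi> s' - \<Phi> s)) = norm (Ln (q s'))" by simp
    moreover have "norm (Ln (q s')) < e * ln 2"
      using \<eta>0(2)[of "q s'"] q1[of s'] \<eta>(2) by (simp add: S_def)
    ultimately have "norm (\<Phi> s' - \<Phi> s) * ln 2 < e * ln 2" by (simp add: norm_mult mult.commute)
    then show "dist (\<Phi> s') (\<Phi> s) < e"
      unfolding dist_norm by (rule mult_right_less_imp_less) simp
  qed
qed

section \<open>The implications between the three statements\<close>

context G_semigroup
begin

lemma bounded_strip_subset:
  assumes "t \<ge> 0"
  obtains M where "M > 0" "{s. 0 < Re s \<and> Re s < 1} \<subseteq> {s\<in>\<complex>\<^sub>+. 0 < Re (\<Phi> t s) \<and> Re (\<Phi> t s) < M}"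
proof -
  obtain K where K: "\<And>s. Re s > 0 \<Longrightarrow> norm (\<phi> t s) \<le> K" using \<phi>_bounded[OF assms] by blast
  have K0: "K \<ge> 0" using order_trans[OF norm_ge_zero K[of 1]] by simp
  show ?thesis
  proof (rule that[of "1 + K"])
    show "{s. 0 < Re s \<and> Re s < 1} \<subseteq> {s\<in>\<complex>\<^sub>+. 0 < Re (\<Phi> t s) \<and> Re (\<Phi> t s) < 1 + K}"
    proof
      fix s assume s: "s \<in> {s. 0 < Re s \<and> Re s < 1}"
      then have "Re (\<Phi> t s) < 1 + K"
        using K[of s] complex_Re_le_cmod[of "\<phi> t s"] by (simp add: \<phi>_def)
      then show "s \<in> {s\<in>\<complex>\<^sub>+. 0 < Re (\<Phi> t s) \<and> Re (\<Phi> t s) < 1 + K}"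
        using s Re_pos[OF assms, of s] by simp
    qed
  qed (use K0 in simp)
qed

text \<open>Uniform continuity is glued from two overlapping regions: the strip
  \<open>Re s < 1\<close>, where the hypothesis applies, and \<open>Re s \<ge> 1 / 2\<close>, where
  Harnack's inequality makes the bounded function \<open>\<phi> t\<close> Lipschitz at short
  distances.\<close>

lemma G_A_imp_in_A_\<phi>:
  assumes t: "t \<ge> 0" and GA: "G_A (\<Phi> t)"
  shows "in_A (\<phi> t)"
proof -
  obtain a \<theta> where "dirichlet_sums_on a (\<phi> t) (half_plane \<theta>)"
    using in_D_\<phi>[OF t] by (auto simp: in_D_def)
  then have "dirichlet_sums_on a (\<phi> t) \<complex>\<^sub>+"
  proof (rule bohr[OF hol_\<phi>[OF t], rotated])
    show "\<exists>B. \<forall>s. \<delta> \<le> Re s \<longrightarrow> norm (\<phi> t s) \<le> B" if "\<delta> > 0" for \<delta>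
      using \<phi>_bounded[OF t] that by (meson less_le_trans)
  qed
  moreover have "uniformly_continuous_on \<complex>\<^sub>+ (\<phi> t)"
    unfolding uniformly_continuous_on_def
  proof (intro allI impI)
    fix e :: real assume e: "e > 0"
    obtain M where M: "M > 0" "{s. 0 < Re s \<and> Re s < 1} \<subseteq> {s\<in>\<complex>\<^sub>+. 0 < Re (\<Phi> t s) \<and> Re (\<Phi> t s) < M}"
      by (rule bounded_strip_subset[OF t])
    have "uniformly_continuous_on {s. 0 < Re s \<and> Re s < 1} (\<Phi> t)"
      using GA M unfolding G_A_def by (meson uniformly_continuous_on_subset)
    then have "uniformly_continuous_on {s. 0 < Re s \<and> Re s < 1} (\<phi> t)"
      unfolding \<phi>_def[abs_def] by (intro uniformly_continuous_on_diff uniformly_continuous_on_id)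
    then obtain d where d: "d > 0" "\<And>s s'. 0 < Re s \<Longrightarrow> Re s < 1 \<Longrightarrow> 0 < Re s' \<Longrightarrow> Re s' < 1 \<Longrightarrow> dist s' s < d \<Longrightarrow> dist (\<phi> t s') (\<phi> t s) < e"
      unfolding uniformly_continuous_on_def using e by (metis (mono_tags, lifting) mem_Collect_eq)
    obtain K where K: "\<And>s. Re s > 0 \<Longrightarrow> norm (\<phi> t s) \<le> K" using \<phi>_bounded[OF t] by blast
    have K0: "K \<ge> 0" using order_trans[OF norm_ge_zero K[of 1]] by simp
    \<comment> \<open>Points closer than 1/2 lie together in one of the two regions;
      \<open>4 * K\<close> is the Lipschitz constant on the right one, and adding 1 keeps the
      divisor positive.\<close>
    define d' where "d' = min d (min (1 / 2) (e / (4 * K + 1)))"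
    have d': "d' > 0" using d(1) e K0 by (auto simp: d'_def)
    have d'_le: "d' \<le> d" "d' \<le> 1 / 2" "d' \<le> e / (4 * K + 1)"
      unfolding d'_def by (meson min.cobounded1 min.cobounded2 order_trans)+
    show "\<exists>d>0. \<forall>s\<in>\<complex>\<^sub>+. \<forall>s'\<in>\<complex>\<^sub>+. dist s' s < d \<longrightarrow> dist (\<phi> t s') (\<phi> t s) < e"
    proof (intro exI[of _ d'] conjI d' ballI impI)
      fix s s' assume s: "s \<in> \<complex>\<^sub>+" "s' \<in> \<complex>\<^sub>+" and ds: "dist s' s < d'"
      have close: "\<bar>Re s' - Re s\<bar> < 1 / 2"
        using abs_Re_le_cmod[of "s' - s"] ds d'_le(2) by (simp add: dist_norm)
      show "dist (\<phi> t s') (\<phi> t s) < e"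
      proof (cases "Re s < 1 \<and> Re s' < 1")
        case True
        then show ?thesis using d(2)[of s s'] s ds d'_le(1) by simp
      next
        case False
        moreover have "Re s' - Re s < 1 / 2" "Re s - Re s' < 1 / 2" using close unfolding abs_less_iff by linarith+
        ultimately have "Re s \<ge> 1 / 2" "Re s' \<ge> 1 / 2" by argo+
        then have "norm (\<phi> t s' - \<phi> t s) \<le> norm (s' - s) / (1 / 2) * (1 + norm (s' - s) / (1 / 2)) * Re (\<phi> t s)"
          by (intro Harnack_half_plane_bounded) (use hol_\<phi> Re_\<phi>_nonneg t in auto)
        also have "\<dots> \<le> norm (s' - s) / (1 / 2) * (1 + 1) * K"
          using ds d'_le(2) K[of s] complex_Re_le_cmod[of "\<phi> t s"] s Re_\<phi>_nonneg[OF t, of s]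
          by (intro mult_mono) (auto simp: dist_norm)
        also have "\<dots> \<le> norm (s' - s) * (4 * K + 1)" by (simp add: algebra_simps)
        also have "\<dots> < e / (4 * K + 1) * (4 * K + 1)"
          using ds d'_le(3) K0 by (intro mult_strict_right_mono) (auto simp: dist_norm)
        also have "\<dots> = e" using K0 by simp
        finally show ?thesis by (simp add: dist_norm)
      qed
    qed
  qed
  ultimately show ?thesis by (auto simp: in_A_def)
qed

lemma in_A_imp_uniformly_continuous:
  assumes "t \<ge> 0" "in_A (\<phi> t)"
  shows "uniformly_continuous_on \<complex>\<^sub>+ (\<Phi> t)"
proof -
  have "uniformly_continuous_on \<complex>\<^sub>+ (\<lambda>s. \<phi> t s + s)"
    using assms by (intro uniformly_continuous_on_add uniformly_continuous_on_id) (simp add: in_A_def)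
  then show ?thesis by (simp add: \<phi>_def)
qed

lemma in_A_\<phi>_imp_G_A:
  assumes "t \<ge> 0" "in_A (\<phi> t)"
  shows "G_A (\<Phi> t)"
  unfolding G_A_def
proof (intro conjI allI impI G assms(1))
  show "uniformly_continuous_on {s \<in> \<complex>\<^sub>+. 0 < Re (\<Phi> t s) \<and> Re (\<Phi> t s) < M} (\<Phi> t)" for M
    by (rule uniformly_continuous_on_subset[OF in_A_imp_uniformly_continuous[OF assms]]) auto
qed

text \<open>\<open>dirichlet_compose\<close> yields a Dirichlet series far to the right only; since
  \<open>f\<close>, hence \<open>f \<circ> \<Phi> t\<close>, is bounded, Bohr's theorem extends its
  convergence to the whole half-plane.\<close>

lemma in_A_compose:
  assumes t: "t \<ge> 0" and \<Phi>: "uniformly_continuous_on \<complex>\<^sub>+ (\<Phi> t)" and f: "in_A f"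
  shows "in_A (f \<circ> \<Phi> t)"
proof -
  obtain B where B: "\<And>s. Re s > 0 \<Longrightarrow> norm (f s) \<le> B" using in_A_bounded[OF f] by blast
  obtain a where a: "dirichlet_sums_on a f \<complex>\<^sub>+" using f by (auto simp: in_A_def)
  obtain b \<sigma> where b: "\<sigma> > 0" "dirichlet_abs b \<sigma> (\<phi> t)" using in_D_imp_abs[OF in_D_\<phi>[OF t]] .
  obtain a' \<sigma>' where "dirichlet_sums_on a' (\<lambda>s. f (s + \<phi> t s)) (half_plane \<sigma>')"
    using dirichlet_compose[OF dirichlet_sums_on_imp_abs[OF a] b(2)] Re_\<phi>_nonneg[OF t] b(1)
    by (metis less_le_trans)
  moreover have eq: "(\<lambda>s. f (s + \<phi> t s)) = f \<circ> \<Phi> t" by (simp add: \<phi>_def fun_eq_iff)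
  ultimately have D: "dirichlet_sums_on a' (f \<circ> \<Phi> t) (half_plane \<sigma>')" by simp
  have img: "\<Phi> t ` \<complex>\<^sub>+ \<subseteq> \<complex>\<^sub>+" using self[OF t] by (simp add: self_map_def)
  have "dirichlet_sums_on a' (f \<circ> \<Phi> t) \<complex>\<^sub>+"
  proof (rule bohr[OF _ _ D])
    show "f \<circ> \<Phi> t holomorphic_on \<complex>\<^sub>+"
      by (rule holomorphic_on_compose_gen[OF hol[OF t] in_A_holomorphic[OF f] img])
    show "\<exists>B. \<forall>s. \<delta> \<le> Re s \<longrightarrow> norm ((f \<circ> \<Phi> t) s) \<le> B" if "\<delta> > 0" for \<delta>
      using B Re_pos[OF t] that by (intro exI[of _ B]) auto
  qed
  moreover have "uniformly_continuous_on \<complex>\<^sub>+ (f \<circ> \<Phi> t)"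
    unfolding o_def using f img
    by (intro uniformly_continuous_on_compose[OF \<Phi>]) (auto simp: in_A_def intro: uniformly_continuous_on_subset)
  ultimately show ?thesis by (auto simp: in_A_def)
qed

lemma in_A_bdd_above: "in_A f \<Longrightarrow> bdd_above ((\<lambda>s. norm (f s)) ` \<complex>\<^sub>+)"
  by (rule in_A_bounded[of f]) (auto intro!: bdd_aboveI2)

lemma supnorm_compose_le:
  assumes t: "t \<ge> 0" and f: "in_A f"
  shows "supnorm (f \<circ> \<Phi> t) \<le> supnorm f"
  unfolding supnorm_def
proof (rule cSUP_least)
  show "\<complex>\<^sub>+ \<noteq> {}" using mem_half_plane[of 1 0] by fastforce
  show "norm ((f \<circ> \<Phi> t) s) \<le> (SUP s\<in>\<complex>\<^sub>+. norm (f s))" if "s \<in> \<complex>\<^sub>+" for s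
    using cSUP_upper[OF _ in_A_bdd_above[OF f], of "\<Phi> t s"] Re_pos[OF t, of s] that by simp
qed

lemma bounded_operator_compose:
  assumes "t \<ge> 0" "uniformly_continuous_on \<complex>\<^sub>+ (\<Phi> t)"
  shows "bounded_operator_A (composition_operator (\<Phi> t))"
  unfolding bounded_operator_A_def composition_operator_def
proof (intro conjI allI impI)
  show "\<exists>K. \<forall>f. in_A f \<longrightarrow> supnorm (f \<circ> \<Phi> t) \<le> K * supnorm f"
    using supnorm_compose_le[OF assms(1)] by (intro exI[of _ 1]) simp
qed (use in_A_compose[OF assms] Re_pos[OF assms(1)] in auto)

text \<open>By \<open>\<phi>_small\<close> the points \<open>\<Phi> t s\<close> and \<open>s\<close>
  are close uniformly in \<open>s\<close>, up to the boundary, so the modulus of uniform continuity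
  of \<open>f\<close> applies to all of them at once.\<close>

lemma supnorm_compose_tendsto:
  assumes f: "in_A f"
  shows "((\<lambda>t. supnorm (\<lambda>s. f (\<Phi> t s) - f s)) \<longlongrightarrow> 0) (at_right 0)"
proof (rule tendstoI)
  fix e :: real assume e: "e > 0"
  obtain d where d: "d > 0" "\<And>s s'. Re s > 0 \<Longrightarrow> Re s' > 0 \<Longrightarrow> dist s' s < d \<Longrightarrow> dist (f s') (f s) < e / 2"
    using f e unfolding in_A_def uniformly_continuous_on_def by (metis half_gt_zero mem_half_plane)
  obtain r where r: "r > 0" "\<And>u s. 0 \<le> u \<Longrightarrow> u \<le> r \<Longrightarrow> Re s > 0 \<Longrightarrow> norm (\<phi> u s) \<le> d / 2"
    using \<phi>_small[of "d / 2"] d(1) by auto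
  have "dist (supnorm (\<lambda>s. f (\<Phi> t s) - f s)) 0 < e" if t: "0 < t" "t < r" for t
  proof -
    have le: "norm (f (\<Phi> t s) - f s) \<le> e / 2" if s: "s \<in> \<complex>\<^sub>+" for s
    proof -
      have "norm (\<phi> t s) \<le> d / 2" using r(2)[of t s] t s by simp
      then have "dist (\<Phi> t s) s < d" using d(1) by (simp add: dist_norm \<phi>_def)
      then have "dist (f (\<Phi> t s)) (f s) < e / 2" using d(2)[of s "\<Phi> t s"] s Re_pos[of t s] t by simp
      then show ?thesis by (simp add: dist_norm)
    qed
    have "supnorm (\<lambda>s. f (\<Phi> t s) - f s) \<le> e / 2"
      unfolding supnorm_def by (rule cSUP_least) (use le mem_half_plane[of 1 0] in fastforce)+
    \<comment> \<open>The distance to 0 also requires the supremum to be nonnegative; the point 1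
      witnesses this, the values being bounded.\<close>
    moreover have "norm (f (\<Phi> t 1) - f 1) \<le> supnorm (\<lambda>s. f (\<Phi> t s) - f s)"
      unfolding supnorm_def by (rule cSUP_upper[OF _ bdd_aboveI2[OF le]]) simp
    then have "0 \<le> supnorm (\<lambda>s. f (\<Phi> t s) - f s)" by (rule order_trans[OF norm_ge_zero])
    ultimately show ?thesis using e by simp
  qed
  then show "\<forall>\<^sub>F t in at_right 0. dist (supnorm (\<lambda>s. f (\<Phi> t s) - f s)) 0 < e"
    using r(1) by (auto simp: eventually_at_right[of 0 1])
qed

lemma strongly_continuous_compose:
  assumes T: "\<And>t. t \<ge> 0 \<Longrightarrow> T t = composition_operator (\<Phi> t)" and \<phi>: "\<And>t. t > 0 \<Longrightarrow> in_A (\<phi> t)"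
  shows "strongly_continuous_semigroup_A T"
  unfolding strongly_continuous_semigroup_A_def
proof (intro conjI allI impI ballI)
  fix t :: real assume t: "t \<ge> 0"
  have "uniformly_continuous_on \<complex>\<^sub>+ (\<Phi> t)"
  \<comment> \<open>Membership of the displacement is assumed for positive times; at time 0 the map
    is the identity on the half-plane.\<close>
  proof (cases "t = 0")
    case True
    then show ?thesis unfolding uniformly_continuous_on_def by auto
  next
    case False
    then show ?thesis using in_A_imp_uniformly_continuous[OF t \<phi>] t by simp
  qed
  then show "bounded_operator_A (T t)" using bounded_operator_compose[OF t] T[OF t] by simp
next
  fix f s assume "s \<in> \<complex>\<^sub>+"
  then show "T 0 f s = f s" by (simp add: T composition_operator_def)
next
  fix t u :: real and f s assume "0 \<le> t" "0 \<le> u" "s \<in> \<complex>\<^sub>+"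
  \<comment> \<open>Composition operators reverse the order: \<open>\<Phi> t\<close> is the inner
    map, so the semigroup law is used with \<open>u\<close> and \<open>t\<close> exchanged.\<close>
  then show "T t (T u f) s = T (t + u) f s"
    using semigroup[of u t s] by (simp add: T composition_operator_def add.commute)
next
  fix f assume "in_A f"
  then have "((\<lambda>t. supnorm (\<lambda>s. f (\<Phi> t s) - f s)) \<longlongrightarrow> 0) (at_right 0)" by (rule supnorm_compose_tendsto)
  moreover have "\<forall>\<^sub>F t in at_right 0. supnorm (\<lambda>s. f (\<Phi> t s) - f s) = supnorm (\<lambda>s. T t f s - f s)"
    using eventually_at_right_less[of 0] by eventually_elim (simp add: T composition_operator_def)
  ultimately show "((\<lambda>t. supnorm (\<lambda>s. T t f s - f s)) \<longlongrightarrow> 0) (at_right 0)"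
    by (rule tendsto_cong[THEN iffD1, rotated])
qed

lemma strongly_continuous_imp_G_A:
  assumes T: "T t = composition_operator (\<Phi> t)" "strongly_continuous_semigroup_A T" and t: "t \<ge> 0"
  shows "G_A (\<Phi> t)"
proof -
  have "in_A (composition_operator (\<Phi> t) (\<lambda>s. 2 powr - s))"
    using assms in_A_two_powr unfolding strongly_continuous_semigroup_A_def bounded_operator_A_def by metis
  then have "uniformly_continuous_on \<complex>\<^sub>+ (\<lambda>s. 2 powr - \<Phi> t s)"
    by (simp add: in_A_def composition_operator_def o_def)
  from uniformly_continuous_on_strip_of_two_powr[OF holomorphic_on_imp_continuous_on[OF hol[OF t]] this]
  have "uniformly_continuous_on {s \<in> \<complex>\<^sub>+. 0 < Re (\<Phi> t s) \<and> Re (\<Phi> t s) < M} (\<Phi> t)" for M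
    by (rule uniformly_continuous_on_subset) auto
  then show ?thesis using G[OF t] by (simp add: G_A_def)
qed

end

theorem theorem6p4:
  fixes \<Phi> \<phi> :: "real \<Rightarrow> complex \<Rightarrow> complex"
    and T :: "real \<Rightarrow> (complex \<Rightarrow> complex) \<Rightarrow> (complex \<Rightarrow> complex)"
  assumes "continuous_semigroup \<Phi>"
    and "\<forall>t\<ge>0. G_infinity (\<Phi> t)"
    and "\<forall>t\<ge>0. \<forall>s\<in>\<complex>\<^sub>+. \<Phi> t s = s + \<phi> t s"
    and "\<forall>t\<ge>0. T t = composition_operator (\<Phi> t)"
  shows "(strongly_continuous_semigroup_A T \<longleftrightarrow> (\<forall>t>0. G_A (\<Phi> t))) \<and>
         ((\<forall>t>0. G_A (\<Phi> t)) \<longleftrightarrow> (\<forall>t>0. in_A (\<phi> t)))"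
proof -
  interpret S: G_semigroup \<Phi> by unfold_locales (use assms in auto)
  \<comment> \<open>The given displacement and that of the locale may differ outside the half-plane;
    membership in the algebra depends only on the values inside.\<close>
  have eq: "in_A (S.\<phi> t) \<longleftrightarrow> in_A (\<phi> t)" if "t \<ge> 0" for t
  proof -
    have "S.\<phi> t s = \<phi> t s" if "s \<in> \<complex>\<^sub>+" for s
      using assms(3) \<open>t \<ge> 0\<close> that by (auto simp: S.\<phi>_def)
    then show ?thesis using in_A_cong[of "S.\<phi> t" "\<phi> t"] in_A_cong[of "\<phi> t" "S.\<phi> t"] by auto
  qed
  have bc: "G_A (\<Phi> t) \<longleftrightarrow> in_A (\<phi> t)" if "t > 0" for t
    using S.G_A_imp_in_A_\<phi>[of t] S.in_A_\<phi>_imp_G_A[of t] eq[of t] that by auto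
  have ab: "G_A (\<Phi> t)" if "strongly_continuous_semigroup_A T" "t > 0" for t
    using S.strongly_continuous_imp_G_A[of T t] assms(4) that by auto
  have ca: "strongly_continuous_semigroup_A T" if "\<forall>t>0. in_A (\<phi> t)"
    by (rule S.strongly_continuous_compose) (use assms(4) that eq in auto)
  show ?thesis using ab bc ca by blast
qed

end
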